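(* Let $S$ be a cancellative left amenable semigroup, let $K$ be a totally disconnected compact abelian group, let $S\overset{\gamma}{\curvearrowright}K$ be a left action by continuous endomorphisms, and let $L$ be a closed $\gamma$-invariant subgroup of $K$. Denote by $\gamma_L$ and $\gamma_{K/L}$ the induced actions of $S$ on $L$ and on $K/L$. Then $$h_{top}(\gamma)=h_{top}(\gamma_L)+h_{top}(\gamma_{K/L}).$$
   Context: A semigroup $S$ is cancellative if all left and right multiplications are injective. $S$ is left amenable if there is a finitely additive $\mu:\mathcal P(S)\to[0,1]$ with $\mu(S)=1$ and $\mu(L_s^{-1}(F))=\mu(F)$ for all $s\in S$, $F\subseteq S$, where $L_s(x)=sx$. A left Følner net of $S$ is a net $(F_i)_{i\in I}$ of non-empty finite subsets of $S$ with $\lim_{i\in I}|sF_i\setminus F_i|/|F_i|=0$ for every $s\in S$ (such nets exist when $S$ is cancellative left amenable). A left action satisfies $\gamma(st)=\gamma(s)\gamma(t)$ for all $s,t\in S$ (and, if $S$ is a monoid, $\gamma(1)=\mathrm{id}$). $L$ is $\gamma$-invariant if $\gamma(s)(L)\subseteq L$ for all $s\in S$; then $\gamma_L(s)=\gamma(s)|_L$ and $\gamma_{K/L}(s)(k+L)=\gamma(s)(k)+L$. Topological entropy. Let $S$ act on the left on a compact space $C$ by continuous maps via $\gamma$. For open covers $\mathcal U,\mathcal V$ of $C$ let $\mathcal U\vee\mathcal V=\{U\cap V:U\in\mathcal U,V\in\mathcal V\}$, let $N(\mathcal U)$ be the minimal cardinality of a subcover of $\mathcal U$, and for non-empty finite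 $F\subseteq S$ let $\mathcal U_{\gamma,F}=\bigvee_{s\in F}\gamma(s)^{-1}(\mathcal U)$, where $\gamma(s)^{-1}(\mathcal U)=\{\gamma(s)^{-1}(U):U\in\mathcal U\}$. Put $H_{top}(\gamma,\mathcal U)=\lim_{i\in I}\frac{\log N(\mathcal U_{\gamma,F_i})}{|F_i|}$ for any left Følner net $(F_i)_{i\in I}$ of $S$ (the limit is known to exist and not to depend on the net), and $h_{top}(\gamma)=\sup_{\mathcal U}H_{top}(\gamma,\mathcal U)\in[0,\infty]$ over all open covers $\mathcal U$ of $C$. *)

theory Defs
  imports "HOL-Analysis.Analysis" "HOL-Algebra.Coset"
begin

section \<open>Amenable semigroups and Folner nets\<close>

class cancel_semigroup_mult = semigroup_mult +
  assumes inj_mult_left: "inj (\<lambda>x. s * x)"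
    and inj_mult_right: "inj (\<lambda>x. x * s)"

definition left_invariant_mean :: "('s::semigroup_mult set \<Rightarrow> real) \<Rightarrow> bool" where
  "left_invariant_mean \<mu> \<longleftrightarrow>
     range \<mu> \<subseteq> {0..1} \<and> \<mu> UNIV = 1 \<and>
     (\<forall>A B. disjnt A B \<longrightarrow> \<mu> (A \<union> B) = \<mu> A + \<mu> B) \<and>
     (\<forall>s A. \<mu> ((\<lambda>x. s * x) -` A) = \<mu> A)"

definition left_amenable :: "'s::semigroup_mult itself \<Rightarrow> bool" where
  "left_amenable _ \<longleftrightarrow> (\<exists>\<mu> :: 's set \<Rightarrow> real. left_invariant_mean \<mu>)"

text \<open>
  As usual, the index set of a net enters only through its filter of tails, so a net is a
  function \<open>F\<close> together with a proper filter \<open>I\<close> on its indices.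
\<close>

definition left_Folner_net :: "('i \<Rightarrow> 's::semigroup_mult set) \<Rightarrow> 'i filter \<Rightarrow> bool" where
  "left_Folner_net F I \<longleftrightarrow>
     I \<noteq> bot \<and> (\<forall>\<^sub>F i in I. finite (F i) \<and> F i \<noteq> {}) \<and>
     (\<forall>s. ((\<lambda>i. real (card ((\<lambda>x. s * x) ` F i - F i)) / real (card (F i))) \<longlongrightarrow> 0) I)"

text \<open>
  Every left Folner net can be indexed by the subsets of the semigroup themselves, and a
  function of finite subsets has the same limits along both nets. A quantification over all left
  Folner nets, with arbitrary index types, is therefore a quantification over the filters \<open>I\<close>
  such that \<open>left_Folner_net (\<lambda>F. F) I\<close>.
\<close>

lemma left_Folner_net_filtermap:
  "left_Folner_net F I \<longleftrightarrow> left_Folner_net (\<lambda>A. A) (filtermap F I)"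
  by (simp add: left_Folner_net_def filtermap_bot_iff eventually_filtermap filterlim_filtermap)

lemma tendsto_along_Folner_net:
  fixes \<phi> :: "'s set \<Rightarrow> real"
  shows "((\<lambda>i. \<phi> (F i)) \<longlongrightarrow> h) I \<longleftrightarrow> (\<phi> \<longlongrightarrow> h) (filtermap F I)"
  by (simp add: filterlim_filtermap)


section \<open>Topological entropy\<close>

definition left_action :: "'c set \<Rightarrow> ('s::semigroup_mult \<Rightarrow> 'c \<Rightarrow> 'c) \<Rightarrow> bool" where
  "left_action C \<gamma> \<longleftrightarrow>
     (\<forall>s. \<forall>x\<in>C. \<gamma> s x \<in> C) \<and>
     (\<forall>s t. \<forall>x\<in>C. \<gamma> (s * t) x = \<gamma> s (\<gamma> t x)) \<and>
     (\<forall>e. (\<forall>s. e * s = s \<and> s * e = s) \<longrightarrow> (\<forall>x\<in>C. \<gamma> e x = x))"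

definition open_cover :: "'c topology \<Rightarrow> 'c set set \<Rightarrow> bool" where
  "open_cover X \<U> \<longleftrightarrow> (\<forall>U\<in>\<U>. openin X U) \<and> \<Union>\<U> = topspace X"

definition cover_number :: "'c topology \<Rightarrow> 'c set set \<Rightarrow> nat" where
  "cover_number X \<U> = (LEAST n. \<exists>\<V>\<subseteq>\<U>. finite \<V> \<and> \<Union>\<V> = topspace X \<and> card \<V> = n)"

definition pullback_cover :: "'c topology \<Rightarrow> ('c \<Rightarrow> 'c) \<Rightarrow> 'c set set \<Rightarrow> 'c set set" where
  "pullback_cover X f \<U> = (\<lambda>U. {x \<in> topspace X. f x \<in> U}) ` \<U>"

text \<open>\<open>join_covers J \<U>\<close> is \<open>\<U> j\<^sub>1 \<or> \<dots> \<or> \<U> j\<^sub>n\<close> for \<open>J = {j\<^sub>1, \<dots>, j\<^sub>n}\<close> nonempty.\<close>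

definition join_covers :: "'j set \<Rightarrow> ('j \<Rightarrow> 'c set set) \<Rightarrow> 'c set set" where
  "join_covers J \<U> = {\<Inter>j\<in>J. V j | V. \<forall>j\<in>J. V j \<in> \<U> j}"

lemma join_covers_two:
  assumes "i \<noteq> j"
  shows "join_covers {i, j} \<U> = {U \<inter> V | U V. U \<in> \<U> i \<and> V \<in> \<U> j}"
proof -
  have "\<exists>W. U \<inter> V = (\<Inter>k\<in>{i, j}. W k) \<and> (\<forall>k\<in>{i, j}. W k \<in> \<U> k)"
    if "U \<in> \<U> i" "V \<in> \<U> j" for U V
    using that assms by (intro exI[of _ "\<lambda>k. if k = i then U else V"]) auto
  then show ?thesis
    unfolding join_covers_def by (intro equalityI subsetI) (simp, blast, simp, blast)
qed

text \<open>The limit is required to be the same along all left Folner nets.\<close>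

definition entropy_cover ::
    "'c topology \<Rightarrow> ('s::semigroup_mult \<Rightarrow> 'c \<Rightarrow> 'c) \<Rightarrow> 'c set set \<Rightarrow> real" where
  "entropy_cover X \<gamma> \<U> =
     (THE h. \<forall>I. left_Folner_net (\<lambda>F. F) I \<longrightarrow>
        ((\<lambda>F. ln (real (cover_number X (join_covers F (\<lambda>s. pullback_cover X (\<gamma> s) \<U>))))
               / real (card F)) \<longlongrightarrow> h) I)"

definition top_entropy ::
    "'c topology \<Rightarrow> ('s::semigroup_mult \<Rightarrow> 'c \<Rightarrow> 'c) \<Rightarrow> ereal" where
  "top_entropy X \<gamma> = (SUP \<U>\<in>{\<U>. open_cover X \<U>}. ereal (entropy_cover X \<gamma> \<U>))"


section \<open>Compact abelian groups, subgroups and quotients\<close>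

locale compact_abelian_group = comm_group G
  for G :: "('a, 'b) monoid_scheme" (structure) +
  fixes T :: "'a topology"
  assumes topspace_carrier: "topspace T = carrier G"
    and continuous_mult: "continuous_map (prod_topology T T) T (\<lambda>(x, y). x \<otimes> y)"
    and continuous_inv: "continuous_map T T (\<lambda>x. inv x)"
    and compact: "compact_space T"
    and hausdorff: "Hausdorff_space T"

definition totally_disconnected_space :: "'a topology \<Rightarrow> bool" where
  "totally_disconnected_space X \<longleftrightarrow> (\<forall>x\<in>topspace X. connected_component_of_set X x = {x})"

definition quotient_topology :: "'a topology \<Rightarrow> ('a \<Rightarrow> 'b) \<Rightarrow> 'b topology" where
  "quotient_topology X f =
     topology (\<lambda>V. V \<subseteq> f ` topspace X \<and> openin X {x \<in> topspace X. f x \<in> V})"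

lemma openin_quotient_topology:
  "openin (quotient_topology X f) V \<longleftrightarrow>
     V \<subseteq> f ` topspace X \<and> openin X {x \<in> topspace X. f x \<in> V}"
proof -
  have "istopology (\<lambda>V. V \<subseteq> f ` topspace X \<and> openin X {x \<in> topspace X. f x \<in> V})"
    unfolding istopology_def
  proof (intro conjI allI impI; (elim conjE)?)
    fix S R
    assume "openin X {x \<in> topspace X. f x \<in> S}" "openin X {x \<in> topspace X. f x \<in> R}"
    then have "openin X ({x \<in> topspace X. f x \<in> S} \<inter> {x \<in> topspace X. f x \<in> R})"
      by (rule openin_Int)
    also have "{x \<in> topspace X. f x \<in> S} \<inter> {x \<in> topspace X. f x \<in> R}
        = {x \<in> topspace X. f x \<in> S \<inter> R}" by auto
    finally show "openin X {x \<in> topspace X. f x \<in> S \<inter> R}" .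
  next
    fix \<K>
    assume *: "\<forall>K\<in>\<K>. K \<subseteq> f ` topspace X \<and> openin X {x \<in> topspace X. f x \<in> K}"
    then have "openin X (\<Union>K\<in>\<K>. {x \<in> topspace X. f x \<in> K})" by auto
    also have "(\<Union>K\<in>\<K>. {x \<in> topspace X. f x \<in> K}) = {x \<in> topspace X. f x \<in> \<Union>\<K>}" by auto
    finally show "openin X {x \<in> topspace X. f x \<in> \<Union>\<K>}" .
    show "\<Union>\<K> \<subseteq> f ` topspace X" using * by auto
  qed auto
  then show ?thesis
    by (simp add: quotient_topology_def)
qed

lemma topspace_quotient_topology: "topspace (quotient_topology X f) = f ` topspace X"
proof
  show "topspace (quotient_topology X f) \<subseteq> f ` topspace X"
    using openin_quotient_topology[of X f "topspace (quotient_topology X f)"] by simp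
  have "{x \<in> topspace X. f x \<in> f ` topspace X} = topspace X" by auto
  then have "openin (quotient_topology X f) (f ` topspace X)"
    by (simp add: openin_quotient_topology)
  then show "f ` topspace X \<subseteq> topspace (quotient_topology X f)"
    by (rule openin_subset)
qed

lemma quotient_map_quotient_topology: "quotient_map X (quotient_topology X f) f"
  by (simp add: quotient_map_def topspace_quotient_topology openin_quotient_topology)

definition coset_topology ::
    "('a, 'b) monoid_scheme \<Rightarrow> 'a topology \<Rightarrow> 'a set \<Rightarrow> 'a set topology" where
  "coset_topology G T L = quotient_topology T (\<lambda>k. L #>\<^bsub>G\<^esub> k)"

definition subgroup_action :: "'a set \<Rightarrow> ('s \<Rightarrow> 'a \<Rightarrow> 'a) \<Rightarrow> 's \<Rightarrow> 'a \<Rightarrow> 'a" where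
  "subgroup_action L \<gamma> s = restrict (\<gamma> s) L"

definition quotient_action ::
    "('a, 'b) monoid_scheme \<Rightarrow> 'a set \<Rightarrow> ('s \<Rightarrow> 'a \<Rightarrow> 'a) \<Rightarrow> 's \<Rightarrow> 'a set \<Rightarrow> 'a set" where
  "quotient_action G L \<gamma> s C = the_elem ((\<lambda>k. L #>\<^bsub>G\<^esub> \<gamma> s k) ` C)"

lemma (in group) quotient_action_coset:
  assumes L: "subgroup L G" and hom: "\<gamma> s \<in> hom G G" and inv: "\<gamma> s ` L \<subseteq> L"
    and k: "k \<in> carrier G"
  shows "quotient_action G L \<gamma> s (L #> k) = L #> \<gamma> s k"
proof -
  have const: "L #> \<gamma> s x = L #> \<gamma> s k" if x: "x \<in> L #> k" for x
  proof -
    obtain l where l: "l \<in> L" "x = l \<otimes> k"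
      using x by (auto simp: r_coset_def)
    have lG: "l \<in> carrier G" using l L by (meson subgroup.mem_carrier)
    have "\<gamma> s x = \<gamma> s l \<otimes> \<gamma> s k"
      using hom l lG k by (simp add: hom_mult)
    moreover have "\<gamma> s l \<in> L" using inv l by auto
    moreover have "\<gamma> s k \<in> carrier G" using hom k by (auto simp: hom_def)
    ultimately have "\<gamma> s x \<in> L #> \<gamma> s k" by (auto simp: r_coset_def)
    then show ?thesis
      using repr_independence[OF _ \<open>\<gamma> s k \<in> carrier G\<close> L] by simp
  qed
  have "(\<lambda>x. L #> \<gamma> s x) ` (L #> k) = (\<lambda>x. L #> \<gamma> s k) ` (L #> k)"
    by (rule image_cong[OF refl const])
  also have "\<dots> = {L #> \<gamma> s k}"
    using rcos_self[OF k L] by (intro image_constant)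
  finally have "(\<lambda>x. L #> \<gamma> s x) ` (L #> k) = {L #> \<gamma> s k}" .
  then show ?thesis
    by (simp add: quotient_action_def)
qed

end

theory Submission
  imports Defs
begin

text \<open>
  For an open subgroup \<open>U\<close>, the covers by cosets have \<open>N(\<U>\<^sub>F) = [K : U\<^sub>F]\<close> with
  \<open>U\<^sub>F = \<Inter>\<^sub>s\<^sub>\<in>\<^sub>F \<gamma>(s)\<^sup>-\<^sup>1(U)\<close>, and since \<open>K\<close> is totally disconnected these covers (and their analogues for
  \<open>L\<close> and \<open>K/L\<close>) refine every open cover. The chain \<open>U\<^sub>F \<subseteq> L U\<^sub>F \<subseteq> K\<close> gives
  \<open>[K : U\<^sub>F] \<ge> [K : (L U)\<^sub>F] [L : L \<inter> U\<^sub>F]\<close>, hence one inequality. For the other one put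
  \<open>V = L U\<^sub>E\<close>. The function \<open>F \<mapsto> log [V\<^sub>F : V\<^sub>F \<inter> U\<^sub>F]\<close> is strongly subadditive, so it can be
  estimated by averaging over the translates \<open>E s\<close> with \<open>s \<in> F\<close>; each of them contributes at most
  \<open>log [L : L \<inter> U\<^sub>E]\<close>.

  The entropy of an arbitrary open cover is a meaningful limit only if a Folner net exists and the
  limit along all of them is the same. The former holds because otherwise Hall's marriage theorem
  yields a paradoxical decomposition by left translations; the latter is the Ornstein--Weiss lemma,
  proved by quasi-tilings.
\<close>

section \<open>Folner sets in left amenable cancellative semigroups\<close>

text \<open>The obstacle is that an element which every \<open>\<gamma> s\<close>, s in F, maps into
  L U need not be the product of an element of L and one of \<open>U\<^sub>F\<close>: the factor
  from L may change with s. So \<open>(L U)\<^sub>F\<close> can exceed \<open>L U\<^sub>F\<close>,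
  and the chain bounds the entropy from one side only. Working with \<open>U\<^sub>E\<close> in
  place of U confines the excess to one factor per translate of E. But then V depends on E, so its
  entropy is bounded by that of the quotient action before E varies, and the limits are taken in
  this order: along F with E fixed, then along E. Sides matter throughout. By the action law a right
  translate E s corresponds to pulling back along \<open>\<gamma> s\<close>, so entropies behave
  well under right translation, whereas Folner sets are almost invariant on the left. The two fit
  together because the points e s of the translates E s, s in F, form the sets e F, each of which is
  almost F. Open subgroups of the quotient are represented by open subgroups of the whole group that
  contain L, so that all indices are computed upstairs.\<close>

lemma locally_finite_marriage:
  fixes R :: "('i \<times> 'a) set"
  assumes fin: "\<And>i. finite (R `` {i})"
    and hall: "\<And>J. finite J \<Longrightarrow> card J \<le> card (R `` J)"
  shows "\<exists>f. inj f \<and> (\<forall>i. (i, f i) \<in> R)"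
proof -
  define hallian :: "('i \<times> 'a) set \<Rightarrow> bool"
    where "hallian Q \<longleftrightarrow> (\<forall>J. finite J \<longrightarrow> card J \<le> card (Q `` J))" for Q
  \<comment> \<open>\<open>M\<close> is a set of pairs that can be deleted without violating Hall's
    condition. A maximal one, given by Zorn, leaves a minimal Hall relation \<open>Q\<close>, which
    turns out to be the graph of an injection.\<close>
  define \<A> where "\<A> = {M. M \<subseteq> R \<and> hallian (R - M)}"
  have fin_image: "finite (Q `` J)" if "Q \<subseteq> R" "finite J" for Q J
  proof -
    have "Q `` J \<subseteq> (\<Union>i\<in>J. R `` {i})" using that by blast
    then show ?thesis using fin that(2) by (meson finite_UN_I finite_subset)
  qed
  have bound: "\<exists>U\<in>\<A>. \<forall>X\<in>\<C>. X \<subseteq> U" if \<C>: "\<C> \<in> chains \<A>" for \<C>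
  proof (cases "\<C> = {}")
    case True
    have "{} \<in> \<A>" using hall by (simp add: \<A>_def hallian_def)
    with True show ?thesis by auto
  next
    case False
    have sub: "\<Union>\<C> \<subseteq> R" using \<C> by (auto simp: chains_def \<A>_def)
    have "card J \<le> card ((R - \<Union>\<C>) `` J)" if J: "finite J" for J
    proof -
      \<comment> \<open>Hall's condition at \<open>J\<close> sees only the finitely many pairs that
        start in \<open>J\<close>. Those deleted by the union of the chain are already deleted by a
        single member \<open>M\<close>.\<close>
      define B where "B = \<Union>\<C> \<inter> (J \<times> UNIV)"
      have "B \<subseteq> J \<times> (R `` J)" using sub by (auto simp: B_def)
      then have "finite B"
        using J fin_image[OF order_refl J] by (meson finite_SigmaI finite_subset)
      moreover have "B \<subseteq> \<Union>\<C>" by (auto simp: B_def)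
      moreover have "subset.chain \<A> \<C>" using \<C> by (simp add: chains_alt_def)
      ultimately obtain M where M: "M \<in> \<C>" "B \<subseteq> M"
        using finite_subset_Union_chain[of B \<C> \<A>] False by blast
      have "(i, y) \<in> R - \<Union>\<C> \<longleftrightarrow> (i, y) \<in> R - M" if "i \<in> J" for i y
        using M that by (auto simp: B_def)
      then have "(R - \<Union>\<C>) `` J = (R - M) `` J"
        unfolding Image_def by (intro Collect_cong bex_cong refl)
      moreover have "hallian (R - M)" using M \<C> by (auto simp: chains_def \<A>_def)
      ultimately show ?thesis using J by (simp add: hallian_def)
    qed
    then have "\<Union>\<C> \<in> \<A>" using sub by (auto simp: \<A>_def hallian_def)
    then show ?thesis by (rule bexI[rotated]) (simp add: Union_upper)
  qed
  have "\<exists>M\<in>\<A>. \<forall>X\<in>\<A>. M \<subseteq> X \<longrightarrow> X = M"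
    by (rule Zorn_Lemma2) (rule ballI, rule bound)
  then obtain M where M: "M \<in> \<A>" and max: "\<And>X. X \<in> \<A> \<Longrightarrow> M \<subseteq> X \<Longrightarrow> X = M"
    by (elim bexE) simp
  define Q where "Q = R - M"
  have QR: "Q \<subseteq> R" and hQ: "hallian Q" using M by (auto simp: Q_def \<A>_def)
  have min: "\<not> hallian (Q - {p})" if "p \<in> Q" for p
  proof
    assume h: "hallian (Q - {p})"
    have "R - insert p M = Q - {p}" by (auto simp: Q_def)
    then have "insert p M \<in> \<A>" using h that M by (auto simp: \<A>_def Q_def)
    then have "insert p M = M" using max[of "insert p M"] by blast
    with that show False by (auto simp: Q_def)
  qed
  \<comment> \<open>By minimality, deleting (i, x) breaks Hall's condition at some set containing i.
    Without i, this set has no more elements than its partners and the rest of row i have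
    together.\<close>
  have single: "\<exists>J. finite J \<and> i \<notin> J \<and> card (Q `` J \<union> (Q `` {i} - {x})) \<le> card J"
    if x: "(i, x) \<in> Q" for i x
  proof -
    obtain J where J: "finite J" "card ((Q - {(i, x)}) `` J) < card J"
      using min[OF x] by (auto simp: hallian_def not_le)
    have "i \<in> J"
    proof (rule ccontr)
      assume "i \<notin> J"
      then have "(Q - {(i, x)}) `` J = Q `` J" by auto
      with J hQ show False by (auto simp: hallian_def not_le[symmetric])
    qed
    moreover have "Q `` (J - {i}) \<union> (Q `` {i} - {x}) \<subseteq> (Q - {(i, x)}) `` J"
      using \<open>i \<in> J\<close> by auto
    then have "card (Q `` (J - {i}) \<union> (Q `` {i} - {x})) \<le> card ((Q - {(i, x)}) `` J)"
      using QR J(1) by (intro card_mono fin_image) auto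
    ultimately have "card (Q `` (J - {i}) \<union> (Q `` {i} - {x})) \<le> card (J - {i})"
      using J by simp
    then show ?thesis using J(1) by (intro exI[of _ "J - {i}"]) auto
  qed
  \<comment> \<open>Rado's counting: \<open>X \<union> Y\<close> contains all partners of
    \<open>insert i (I \<union> J)\<close> because x and y differ, and \<open>X \<inter> Y\<close>
    all those of \<open>I \<inter> J\<close>. Hall's condition gives |I| + |J| + 1 \<le> |X| + |Y|,
    against the choice of \<open>I\<close> and \<open>J\<close>.\<close>
  have unique: "x = y" if x: "(i, x) \<in> Q" and y: "(i, y) \<in> Q" for i x y
  proof (rule ccontr)
    assume "x \<noteq> y"
    obtain I where I: "finite I" "i \<notin> I" "card (Q `` I \<union> (Q `` {i} - {x})) \<le> card I"
      using single[OF x] by blast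
    obtain J where J: "finite J" "i \<notin> J" "card (Q `` J \<union> (Q `` {i} - {y})) \<le> card J"
      using single[OF y] by blast
    define X where "X = Q `` I \<union> (Q `` {i} - {x})"
    define Y where "Y = Q `` J \<union> (Q `` {i} - {y})"
    have finXY: "finite X" "finite Y" using I J QR by (auto simp: X_def Y_def intro: fin_image)
    have "Q `` (insert i (I \<union> J)) \<subseteq> X \<union> Y"
      using \<open>x \<noteq> y\<close> by (auto simp: X_def Y_def)
    then have "card (insert i (I \<union> J)) \<le> card (X \<union> Y)"
      using hQ I J finXY unfolding hallian_def by (meson card_mono finite_UnI finite_insert le_trans)
    moreover have "Q `` (I \<inter> J) \<subseteq> X \<inter> Y" by (auto simp: X_def Y_def)
    then have "card (I \<inter> J) \<le> card (X \<inter> Y)"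
      using hQ I J finXY unfolding hallian_def by (meson card_mono finite_Int le_trans)
    moreover have "card X + card Y = card (X \<union> Y) + card (X \<inter> Y)"
      using finXY by (rule card_Un_Int)
    moreover have "card I + card J = card (I \<union> J) + card (I \<inter> J)"
      using I J by (intro card_Un_Int)
    moreover have "card (insert i (I \<union> J)) = Suc (card (I \<union> J))" using I J by simp
    ultimately show False using I(3) J(3) unfolding X_def Y_def by linarith
  qed
  have "\<exists>x. (i, x) \<in> Q" for i
  proof -
    have "card {i} \<le> card (Q `` {i})" using hQ[unfolded hallian_def, rule_format, of "{i}"] by simp
    then show ?thesis by (cases "Q `` {i} = {}") auto
  qed
  then obtain f where f: "\<And>i. (i, f i) \<in> Q" by metis
  have "inj f"
  proof (rule injI, rule ccontr)
    fix i j assume ij: "f i = f j" "i \<noteq> j"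
    have "Q `` {i, j} = {f i}" using f[of i] f[of j] unique ij(1) by auto
    moreover have "card {i, j} \<le> card (Q `` {i, j})"
      using hQ[unfolded hallian_def, rule_format, of "{i, j}"] by simp
    ultimately show False using ij(2) by simp
  qed
  with f QR show ?thesis by blast
qed

section \<open>Left amenability yields almost invariant sets\<close>

lemma left_cancel:
  fixes s x y :: "'s::cancel_semigroup_mult"
  shows "s * x = s * y \<longleftrightarrow> x = y"
  using inj_mult_left[of s] by (auto simp: inj_def)

lemma right_cancel:
  fixes s x y :: "'s::cancel_semigroup_mult"
  shows "x * s = y * s \<longleftrightarrow> x = y"
  using inj_mult_right[of s] by (auto simp: inj_def)

lemma card_left_translate:
  fixes s :: "'s::cancel_semigroup_mult"
  shows "card ((\<lambda>x. s * x) ` A) = card A"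
  by (intro card_image) (auto simp: inj_on_def left_cancel)

lemma card_right_translate:
  fixes s :: "'s::cancel_semigroup_mult"
  shows "card ((\<lambda>x. x * s) ` A) = card A"
  by (intro card_image) (auto simp: inj_on_def right_cancel)

text \<open>The mean is invariant under preimages. As left translations are injective, the part of
  \<open>A\<close> where \<open>c\<close> takes the value e is the preimage of its image under e;
  the finitely many parts are added up.\<close>

lemma left_invariant_mean_piecewise_translate:
  fixes \<mu> :: "'s::cancel_semigroup_mult set \<Rightarrow> real"
  assumes \<mu>: "left_invariant_mean \<mu>" and E: "finite E"
    and c: "\<And>x. x \<in> A \<Longrightarrow> c x \<in> E" and inj: "inj_on (\<lambda>x. c x * x) A"
  shows "\<mu> ((\<lambda>x. c x * x) ` A) = \<mu> A"
  using E c inj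
proof (induction E arbitrary: A rule: finite_induct)
  case empty
  then have "A = {}" by auto
  then show ?case by simp
next
  case (insert e E)
  have add: "\<mu> (X \<union> Y) = \<mu> X + \<mu> Y" if "X \<inter> Y = {}" for X Y
    using \<mu> that by (simp add: left_invariant_mean_def disjnt_def)
  define A1 where "A1 = {x \<in> A. c x = e}"
  define A2 where "A2 = {x \<in> A. c x \<noteq> e}"
  have A: "A = A1 \<union> A2" "A1 \<inter> A2 = {}" by (auto simp: A1_def A2_def)
  have "\<mu> ((\<lambda>x. c x * x) ` A1) = \<mu> ((\<lambda>x. e * x) -` ((\<lambda>x. c x * x) ` A1))"
    using \<mu> by (simp add: left_invariant_mean_def)
  also have "(\<lambda>x. e * x) -` ((\<lambda>x. c x * x) ` A1) = A1"
    by (auto simp: A1_def left_cancel image_iff)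
  finally have 1: "\<mu> ((\<lambda>x. c x * x) ` A1) = \<mu> A1" .
  have 2: "\<mu> ((\<lambda>x. c x * x) ` A2) = \<mu> A2"
    using insert.prems by (intro insert.IH) (auto simp: A2_def inj_on_def)
  have "(\<lambda>x. c x * x) ` A1 \<inter> (\<lambda>x. c x * x) ` A2 = (\<lambda>x. c x * x) ` (A1 \<inter> A2)"
    using insert.prems(2) A(1) by (intro inj_on_image_Int[symmetric]) auto
  then have "(\<lambda>x. c x * x) ` A1 \<inter> (\<lambda>x. c x * x) ` A2 = {}" using A(2) by simp
  then have "\<mu> ((\<lambda>x. c x * x) ` A) = \<mu> ((\<lambda>x. c x * x) ` A1) + \<mu> ((\<lambda>x. c x * x) ` A2)"
    using A(1) by (simp add: add image_Un)
  also have "\<dots> = \<mu> A" using 1 2 add[OF A(2)] A(1) by simp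
  finally show ?case .
qed

text \<open>If \<open>K\<close> and \<open>\<delta>\<close> fail, every non-empty finite set grows
  by a factor 1 + \<delta> on adjoining a translate by a suitable element of \<open>K\<close>.
  Iterating, one finite \<open>E\<close> satisfies |E F| \<ge> 2 |F| for all finite
  \<open>F\<close>; matching two copies of the semigroup through \<open>E\<close> then yields two
  disjoint sets of mean 1.\<close>

theorem left_amenable_imp_almost_invariant:
  fixes K :: "'s::cancel_semigroup_mult set"
  assumes amen: "left_amenable TYPE('s)" and K: "finite K" and \<delta>: "0 < \<delta>"
  shows "\<exists>F. finite F \<and> F \<noteq> {} \<and>
    (\<forall>s\<in>K. real (card ((\<lambda>x. s * x) ` F - F)) \<le> \<delta> * real (card F))"
proof (rule ccontr)
  assume contra: "\<not> ?thesis"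
  define ex where "ex E F = (\<Union>e\<in>E. (\<lambda>x. e * x) ` F)" for E F :: "'s set"
  have fin_ex: "finite (ex E F)" if "finite E" "finite F" for E F
    using that by (auto simp: ex_def)
  have "\<exists>E. finite E \<and> E \<noteq> {} \<and> (\<forall>F. finite F \<longrightarrow> (1 + \<delta>) ^ n * real (card F) \<le> card (ex E F))"
    for n :: nat
  proof (induction n)
    case 0
    show ?case
      by (rule exI[of _ "{undefined}"]) (auto simp: ex_def card_left_translate)
  next
    case (Suc n)
    then obtain E where E: "finite E" "E \<noteq> {}"
      "\<And>F. finite F \<Longrightarrow> (1 + \<delta>) ^ n * real (card F) \<le> card (ex E F)" by blast
    \<comment> \<open>Which s expands E F depends on \<open>F\<close>, so all of \<open>K\<close> is
      multiplied in.\<close>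
    define E' where "E' = E \<union> (\<lambda>(s, e). s * e) ` (K \<times> E)"
    have "(1 + \<delta>) ^ Suc n * real (card F) \<le> card (ex E' F)" if F: "finite F" for F
    proof (cases "F = {}")
      case False
      define G where "G = ex E F"
      have G: "finite G" "G \<noteq> {}" using F E False by (auto simp: G_def ex_def)
      with contra obtain s where s: "s \<in> K" "\<delta> * real (card G) < card ((\<lambda>x. s * x) ` G - G)"
        by (meson not_le)
      have "G \<union> ((\<lambda>x. s * x) ` G - G) \<subseteq> ex E' F"
        using s(1) by (auto simp: G_def ex_def E'_def mult.assoc[symmetric])
      then have "card (G \<union> ((\<lambda>x. s * x) ` G - G)) \<le> card (ex E' F)"
        using E F K by (intro card_mono fin_ex) (auto simp: E'_def)
      moreover have "card (G \<union> ((\<lambda>x. s * x) ` G - G)) = card G + card ((\<lambda>x. s * x) ` G - G)"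
        using G by (intro card_Un_disjoint) auto
      ultimately have "(1 + \<delta>) * real (card G) \<le> card (ex E' F)"
        using s(2) by (simp add: algebra_simps)
      moreover have "(1 + \<delta>) * ((1 + \<delta>) ^ n * real (card F)) \<le> (1 + \<delta>) * real (card G)"
        using E(3)[OF F] \<delta> unfolding G_def by (intro mult_left_mono) auto
      ultimately show ?thesis by (simp add: mult.assoc)
    qed auto
    then show ?case using E K by (intro exI[of _ E']) (auto simp: E'_def)
  qed
  moreover obtain n where n: "2 < (1 + \<delta>) ^ n"
    using real_arch_pow[of "1 + \<delta>" 2] \<delta> by auto
  ultimately obtain E where E: "finite E"
    "\<And>F. finite F \<Longrightarrow> (1 + \<delta>) ^ n * real (card F) \<le> card (ex E F)" by blast
  have doubling: "2 * card F \<le> card (ex E F)" if "finite F" for F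
  proof -
    have "2 * real (card F) \<le> (1 + \<delta>) ^ n * real (card F)"
      using n by (intro mult_right_mono) auto
    then show ?thesis using E(2)[OF that] by linarith
  qed
  \<comment> \<open>The boolean labels two copies of the semigroup, and (x, b) may be matched with
    any e x, e in \<open>E\<close>. A finite set of labelled points is at most twice as large as its
    projection, so doubling is Hall's condition.\<close>
  define R where "R = {((x, b :: bool), y). \<exists>e\<in>E. y = e * x}"
  have "R `` {(x, b)} = (\<lambda>e. e * x) ` E" for x b by (auto simp: R_def)
  then have "finite (R `` {i})" for i using E(1) by (cases i) simp
  moreover have "card J \<le> card (R `` J)" if J: "finite J" for J
  proof -
    have "R `` J = ex E (fst ` J)" by (force simp: R_def ex_def)
    moreover have "J \<subseteq> fst ` J \<times> UNIV" by force
    then have "card J \<le> card (fst ` J \<times> (UNIV :: bool set))" using J by (intro card_mono) auto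
    ultimately show ?thesis using doubling[of "fst ` J"] J by (simp add: card_cartesian_product)
  qed
  ultimately obtain f where f: "inj f" "\<And>i. (i, f i) \<in> R"
    using locally_finite_marriage[of R] by blast
  have "\<exists>e. e \<in> E \<and> f (x, b) = e * x" for x b using f(2)[of "(x, b)"] by (auto simp: R_def)
  then obtain c where c: "\<And>x b. c x b \<in> E" "\<And>x b. f (x, b) = c x b * x" by metis
  obtain \<mu> :: "'s set \<Rightarrow> real" where \<mu>: "left_invariant_mean \<mu>"
    using amen by (auto simp: left_amenable_def)
  have "\<mu> (range (\<lambda>x. c x b * x)) = 1" for b
  proof -
    have "inj (\<lambda>x. c x b * x)"
      unfolding c(2)[symmetric] using f(1) by (intro injI) (auto dest: injD)
    then have "\<mu> (range (\<lambda>x. c x b * x)) = \<mu> UNIV"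
      using c(1) by (intro left_invariant_mean_piecewise_translate[OF \<mu> E(1)]) auto
    then show ?thesis using \<mu> by (simp add: left_invariant_mean_def)
  qed
  moreover have "disjnt (range (\<lambda>x. c x True * x)) (range (\<lambda>x. c x False * x))"
    unfolding c(2)[symmetric] using f(1) by (auto simp: disjnt_iff dest: injD)
  then have "\<mu> (range (\<lambda>x. c x True * x) \<union> range (\<lambda>x. c x False * x))
      = \<mu> (range (\<lambda>x. c x True * x)) + \<mu> (range (\<lambda>x. c x False * x))"
    using \<mu> by (simp add: left_invariant_mean_def)
  moreover have "range \<mu> \<subseteq> {0..1}" using \<mu> by (simp add: left_invariant_mean_def)
  then have "\<mu> (range (\<lambda>x. c x True * x) \<union> range (\<lambda>x. c x False * x)) \<le> 1"
    by (meson atLeastAtMost_iff range_subsetD)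
  ultimately show False by simp
qed


section \<open>The Ornstein--Weiss lemma\<close>

definition almost_invariant :: "'s::semigroup_mult set \<Rightarrow> real \<Rightarrow> 's set \<Rightarrow> bool" where
  "almost_invariant K \<delta> F \<longleftrightarrow> finite F \<and> F \<noteq> {} \<and>
     (\<forall>s\<in>K. real (card ((\<lambda>x. s * x) ` F - F)) \<le> \<delta> * real (card F))"

definition Folner_filter :: "'s::semigroup_mult set filter" where
  "Folner_filter = (INF (K, \<delta>)\<in>{(K, \<delta>). finite K \<and> 0 < \<delta>}. principal {F. almost_invariant K \<delta> F})"

lemma almost_invariant_mono:
  assumes "almost_invariant K \<delta> F" "K' \<subseteq> K" "\<delta> \<le> \<delta>'"
  shows "almost_invariant K' \<delta>' F"
  using assms unfolding almost_invariant_def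
  by (meson in_mono mult_right_mono of_nat_0_le_iff order_trans)

lemma eventually_Folner_filter:
  "eventually P Folner_filter \<longleftrightarrow> (\<exists>K \<delta>. finite K \<and> 0 < \<delta> \<and> (\<forall>F. almost_invariant K \<delta> F \<longrightarrow> P F))"
proof -
  have "eventually P Folner_filter \<longleftrightarrow> (\<exists>p\<in>{(K, \<delta>). finite K \<and> 0 < \<delta>}.
      eventually P (case p of (K, \<delta>) \<Rightarrow> principal {F. almost_invariant K \<delta> F}))"
    unfolding Folner_filter_def
  proof (rule eventually_INF_base)
    show "{(K :: 'a set, \<delta> :: real). finite K \<and> 0 < \<delta>} \<noteq> {}"
      by (auto intro!: exI[of _ "{}"] exI[of _ 1])
    fix p q :: "'a set \<times> real"
    assume "p \<in> {(K, \<delta>). finite K \<and> 0 < \<delta>}" "q \<in> {(K, \<delta>). finite K \<and> 0 < \<delta>}"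
    then show "\<exists>r\<in>{(K, \<delta>). finite K \<and> 0 < \<delta>}.
        (case r of (K, \<delta>) \<Rightarrow> principal {F. almost_invariant K \<delta> F})
        \<le> inf (case p of (K, \<delta>) \<Rightarrow> principal {F. almost_invariant K \<delta> F})
              (case q of (K, \<delta>) \<Rightarrow> principal {F. almost_invariant K \<delta> F})"
      by (intro bexI[of _ "(fst p \<union> fst q, min (snd p) (snd q))"])
         (auto elim: almost_invariant_mono)
  qed
  then show ?thesis by (auto simp: eventually_principal)
qed

text \<open>Reduces all Folner nets to a single filter: a limit along \<open>Folner_filter\<close>
  is a limit along each of them, and \<open>Folner_filter\<close>, if proper, is itself among them,
  which pins the limit down.\<close>

lemma left_Folner_net_iff_le_Folner_filter:
  "left_Folner_net (\<lambda>F. F) I \<longleftrightarrow> I \<noteq> bot \<and> I \<le> Folner_filter"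
proof
  assume F: "left_Folner_net (\<lambda>F. F) I"
  then have fin: "\<forall>\<^sub>F F in I. finite F \<and> F \<noteq> {}"
    and lim: "\<And>s. ((\<lambda>F. real (card ((\<lambda>x. s * x) ` F - F)) / real (card F)) \<longlongrightarrow> 0) I"
    by (auto simp: left_Folner_net_def)
  have "eventually P I" if "finite K" "0 < \<delta>" and P: "\<And>F. almost_invariant K \<delta> F \<Longrightarrow> P F" for P K \<delta>
  proof -
    have "\<forall>\<^sub>F F in I. \<forall>s\<in>K. real (card ((\<lambda>x. s * x) ` F - F)) / real (card F) < \<delta>"
      using order_tendstoD(2)[OF lim \<open>0 < \<delta>\<close>] \<open>finite K\<close>
      by (simp add: eventually_ball_finite)
    with fin show ?thesis
    proof eventually_elim
      case (elim F)
      then have "0 < real (card F)" by (simp add: card_gt_0_iff)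
      with elim show ?case
        by (intro P) (auto simp: almost_invariant_def divide_less_eq intro: less_imp_le)
    qed
  qed
  then have "I \<le> Folner_filter"
    by (intro filter_leI) (auto simp: eventually_Folner_filter)
  with F show "I \<noteq> bot \<and> I \<le> Folner_filter" by (simp add: left_Folner_net_def)
next
  assume I: "I \<noteq> bot \<and> I \<le> Folner_filter"
  have ev: "eventually P I"
    if "finite K" "0 < \<delta>" "\<And>F. almost_invariant K \<delta> F \<Longrightarrow> P F" for P K \<delta>
    using I that by (auto simp: le_filter_def eventually_Folner_filter)
  have "((\<lambda>F. real (card ((\<lambda>x. s * x) ` F - F)) / real (card F)) \<longlongrightarrow> 0) I" for s
  proof (rule tendstoI)
    fix e :: real assume "0 < e"
    show "\<forall>\<^sub>F F in I. dist (real (card ((\<lambda>x. s * x) ` F - F)) / real (card F)) 0 < e"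
    \<comment> \<open>Halving turns the weak bound of almost invariance into the strict one demanded
      here.\<close>
    proof (rule ev[of "{s}" "e / 2"])
      fix F assume F: "almost_invariant {s} (e / 2) F"
      then have "0 < real (card F)" by (simp add: almost_invariant_def card_gt_0_iff)
      moreover have "real (card ((\<lambda>x. s * x) ` F - F)) \<le> e / 2 * real (card F)"
        using F by (simp add: almost_invariant_def)
      moreover have "e / 2 * real (card F) < e * real (card F)"
        using \<open>0 < e\<close> \<open>0 < real (card F)\<close> by simp
      ultimately show "dist (real (card ((\<lambda>x. s * x) ` F - F)) / real (card F)) 0 < e"
        by (simp add: divide_less_eq)
    qed (use \<open>0 < e\<close> in auto)
  qed
  moreover have "\<forall>\<^sub>F F in I. finite F \<and> F \<noteq> {}"
    by (rule ev[of "{}" 1]) (auto simp: almost_invariant_def)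
  ultimately show "left_Folner_net (\<lambda>F. F) I" using I by (simp add: left_Folner_net_def)
qed

lemma Folner_filter_neq_bot:
  assumes "left_amenable TYPE('s::cancel_semigroup_mult)"
  shows "(Folner_filter :: 's set filter) \<noteq> bot"
proof
  assume "(Folner_filter :: 's set filter) = bot"
  then have "eventually (\<lambda>_. False) (Folner_filter :: 's set filter)" by simp
  then obtain K :: "'s set" and \<delta> where "finite K" "0 < \<delta>" "\<And>F. \<not> almost_invariant K \<delta> F"
    by (auto simp: eventually_Folner_filter)
  with left_amenable_imp_almost_invariant[OF assms, of K \<delta>] show False
    by (auto simp: almost_invariant_def)
qed

lemma eventually_Folner_filter_nonempty: "\<forall>\<^sub>F F in Folner_filter. finite F \<and> F \<noteq> {}"
  unfolding eventually_Folner_filter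
  by (intro exI[of _ "{}"] exI[of _ 1]) (auto simp: almost_invariant_def)


section \<open>Counting with left and right translates\<close>

lemma sum_card_filter_swap:
  assumes "finite A" "finite B"
  shows "(\<Sum>a\<in>A. card {b \<in> B. P a b}) = (\<Sum>b\<in>B. card {a \<in> A. P a b})"
proof -
  have "(\<Sum>a\<in>A. card {b \<in> B. P a b}) = (\<Sum>a\<in>A. \<Sum>b\<in>B. if P a b then 1 else 0)"
    using assms by (simp add: sum.If_cases Int_def)
  also have "\<dots> = (\<Sum>b\<in>B. \<Sum>a\<in>A. if P a b then 1 else 0)" by (rule sum.swap)
  also have "\<dots> = (\<Sum>b\<in>B. card {a \<in> A. P a b})"
    using assms by (simp add: sum.If_cases Int_def)
  finally show ?thesis .
qed

lemma card_left_preimage_le: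
  fixes e :: "'s::cancel_semigroup_mult"
  assumes "finite A"
  shows "card {s \<in> D. e * s \<in> A} \<le> card A"
  by (rule card_inj_on_le[of "\<lambda>s. e * s"]) (use assms in \<open>auto simp: inj_on_def left_cancel\<close>)

lemma card_right_translate_Int:
  fixes s :: "'s::cancel_semigroup_mult"
  shows "card ((\<lambda>e. e * s) ` E \<inter> A) = card {e \<in> E. e * s \<in> A}"
proof -
  have "(\<lambda>e. e * s) ` E \<inter> A = (\<lambda>e. e * s) ` {e \<in> E. e * s \<in> A}" by auto
  then show ?thesis by (simp add: card_right_translate)
qed

text \<open>By injectivity the points of e D outside \<open>D\<close> can be counted at their
  sources, the points of \<open>D\<close> that leave it.\<close>

lemma card_left_translate_leaving:
  fixes e :: "'s::cancel_semigroup_mult"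
  shows "card {x \<in> D. e * x \<notin> D} = card ((\<lambda>x. e * x) ` D - D)"
proof -
  have "(\<lambda>x. e * x) ` D - D = (\<lambda>x. e * x) ` {x \<in> D. e * x \<notin> D}" by auto
  then show ?thesis by (simp add: card_left_translate)
qed

text \<open>A maximal family of translates \<open>E s \<subseteq> D\<close> overlapping little works: each further translate
  meets the union in a proportion \<open>\<epsilon>\<close>, and by cancellation a point lies in at most \<open>|E|\<close> translates.\<close>

lemma almost_disjoint_translates:
  fixes D E :: "'s::cancel_semigroup_mult set"
  assumes D: "finite D" and E: "finite E" "E \<noteq> {}" and \<epsilon>: "\<epsilon> \<le> 1"
  obtains C where "C \<subseteq> {s \<in> D. \<forall>e\<in>E. e * s \<in> D}"
    and "real (card C) * real (card E) * (1 - \<epsilon>) \<le> card (\<Union>s\<in>C. (\<lambda>e. e * s) ` E)"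
    and "\<epsilon> * card {s \<in> D. \<forall>e\<in>E. e * s \<in> D} \<le> card (\<Union>s\<in>C. (\<lambda>e. e * s) ` E)"
proof -
  define D' where "D' = {s \<in> D. \<forall>e\<in>E. e * s \<in> D}"
  define U where "U C = (\<Union>s\<in>C. (\<lambda>e. e * s) ` E)" for C
  define \<C> where "\<C> = {C. C \<subseteq> D' \<and> real (card C) * real (card E) * (1 - \<epsilon>) \<le> card (U C)}"
  have finD': "finite D'" using D by (simp add: D'_def)
  have "\<C> \<subseteq> Pow D'" by (auto simp: \<C>_def)
  then have "finite \<C>" using finD' by (meson finite_Pow_iff finite_subset)
  moreover have "{} \<in> \<C>" by (simp add: \<C>_def)
  ultimately obtain C where C: "C \<in> \<C>" and max: "\<And>C'. C' \<in> \<C> \<Longrightarrow> C \<subseteq> C' \<Longrightarrow> C' = C"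
    using finite_has_maximal2[of \<C> "{}"] by metis
  have CD': "C \<subseteq> D'" and C2: "real (card C) * real (card E) * (1 - \<epsilon>) \<le> card (U C)"
    using C by (auto simp: \<C>_def)
  have finU: "finite (U C)" using CD' finD' E by (auto simp: U_def intro: finite_subset)
  have Epos: "0 < real (card E)" using E by (simp add: card_gt_0_iff)
  have overlap: "\<epsilon> * card E \<le> card {e \<in> E. e * s \<in> U C}" if s: "s \<in> D'" for s
  proof (cases "s \<in> C")
    case True
    then have "{e \<in> E. e * s \<in> U C} = E" by (auto simp: U_def)
    then show ?thesis using \<epsilon> Epos by simp
  next
    case False
    show ?thesis
    proof (rule ccontr)
      \<comment> \<open>A translate meeting \<open>U C\<close> in fewer than \<epsilon> |E| points
        would add more than (1 - \<epsilon>) |E| new ones, so the inequality defining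
        \<open>\<C>\<close> would survive, against the maximality of \<open>C\<close>.\<close>
      assume "\<not> ?thesis"
      then have less: "card ((\<lambda>e. e * s) ` E \<inter> U C) < \<epsilon> * card E"
        by (simp add: card_right_translate_Int)
      have "U (insert s C) = (\<lambda>e. e * s) ` E \<union> U C" by (simp add: U_def)
      moreover have "card ((\<lambda>e. e * s) ` E) + card (U C)
          = card ((\<lambda>e. e * s) ` E \<union> U C) + card ((\<lambda>e. e * s) ` E \<inter> U C)"
        using E finU by (intro card_Un_Int) auto
      ultimately have "real (card E) + real (card (U C))
          = real (card (U (insert s C))) + real (card ((\<lambda>e. e * s) ` E \<inter> U C))"
        by (simp add: card_right_translate flip: of_nat_add)
      moreover have "card (insert s C) = Suc (card C)"
        using False CD' finD' by (simp add: finite_subset)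
      ultimately have "insert s C \<in> \<C>"
        using C2 less s CD' by (simp add: \<C>_def algebra_simps)
      with max[of "insert s C"] False show False by auto
    qed
  qed
  have "\<epsilon> * card E * card D' \<le> (\<Sum>s\<in>D'. real (card {e \<in> E. e * s \<in> U C}))"
    using sum_mono[of D' "\<lambda>_. \<epsilon> * card E", OF overlap] by (simp add: mult.commute)
  also have "\<dots> = real (\<Sum>e\<in>E. card {s \<in> D'. e * s \<in> U C})"
    using sum_card_filter_swap[OF finD' E(1), of "\<lambda>s e. e * s \<in> U C"] by (simp flip: of_nat_sum)
  also have "\<dots> \<le> real (\<Sum>e\<in>E. card (U C))"
    using finU by (intro of_nat_mono sum_mono card_left_preimage_le)
  also have "\<dots> = card E * card (U C)" by simp
  finally have "\<epsilon> * card D' \<le> card (U C)"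
    using Epos by (simp add: algebra_simps)
  then show ?thesis
    using that[of C] CD' C2 by (simp add: U_def D'_def)
qed

text \<open>Modelled on the logarithm of the cover number of a cover joined over \<open>A\<close>.
  Right translates occur because \<open>\<gamma> (t * s)\<close> applies \<open>\<gamma> s\<close>
  first, so that passing from \<open>A\<close> to its translate by s is a pullback along
  \<open>\<gamma> s\<close>.\<close>

locale subadditive_set_function =
  fixes f :: "'s::cancel_semigroup_mult set \<Rightarrow> real" and c :: real
  assumes subadditive: "finite A \<Longrightarrow> finite B \<Longrightarrow> f (A \<union> B) \<le> f A + f B"
    and right_subinvariant: "finite A \<Longrightarrow> f ((\<lambda>x. x * s) ` A) \<le> f A"
    and le_card: "finite A \<Longrightarrow> f A \<le> c * card A"
    and nonneg: "finite A \<Longrightarrow> 0 \<le> f A"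
begin

lemma c_nonneg: "0 \<le> c"
  using le_card[of "{undefined}"] nonneg[of "{undefined}"] by simp

lemma subadditive_UN:
  assumes "finite C" "\<And>s. s \<in> C \<Longrightarrow> finite (A s)"
  shows "f (\<Union>s\<in>C. A s) \<le> (\<Sum>s\<in>C. f (A s))"
  using assms
proof (induction C rule: finite_induct)
  case empty
  then show ?case using le_card[of "{}"] by simp
next
  case (insert s C)
  have "f (A s \<union> (\<Union>s\<in>C. A s)) \<le> f (A s) + f (\<Union>s\<in>C. A s)"
    using insert by (intro subadditive) auto
  with insert show ?case by simp
qed

text \<open>The invariance of \<open>D\<close> is measured against a fixed \<open>M\<close>, the size of the set tiled in the
  end, since \<open>D\<close> is what remains of that set after some tiles were removed.\<close>

lemma quasi_tiling:
  fixes \<epsilon> r :: real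
  assumes \<epsilon>: "0 < \<epsilon>" "\<epsilon> < 1" and lam: "0 \<le> r"
    and tiles: "\<forall>K \<delta>. finite K \<and> 0 < \<delta> \<longrightarrow> (\<exists>E. almost_invariant K \<delta> E \<and> f E \<le> r * card E)"
  shows "\<exists>K \<delta>. finite K \<and> 0 < \<delta> \<and> (\<forall>D M. finite D \<and> real (card D) \<le> M \<and>
      (\<forall>s\<in>K. real (card ((\<lambda>x. s * x) ` D - D)) \<le> \<delta> * M) \<longrightarrow>
      f D \<le> r / (1 - \<epsilon>) * card D + c * (\<epsilon> * M + (1 - \<epsilon> / 2) ^ n * card D))"
\<comment> \<open>Each of the \<open>n\<close> rounds covers at least the proportion \<epsilon> / 2
  of what remains by tiles, at the price r / (1 - \<epsilon>) per point. Uncovered points cost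
  \<open>c\<close> each: they are at most (1 - \<epsilon> / 2)^n |D| in number, or at most
  \<epsilon> M if the rounds stop early.\<close>
proof (induction n)
  case 0
  have "f D \<le> r / (1 - \<epsilon>) * card D + c * (\<epsilon> * M + (1 - \<epsilon> / 2) ^ 0 * card D)"
    if "finite D" "real (card D) \<le> M" for D M
  proof -
    have "0 \<le> r / (1 - \<epsilon>) * card D" "0 \<le> c * (\<epsilon> * M)"
      using \<epsilon> lam c_nonneg that by auto
    then show ?thesis using le_card[OF that(1)] by (simp add: algebra_simps)
  qed
  then show ?case by (intro exI[of _ "{}"] exI[of _ 1]) auto
next
  case (Suc n)
  then obtain K \<delta> where K: "finite K" "0 < \<delta>"
    and IH: "\<forall>D M. finite D \<and> real (card D) \<le> M \<and>
      (\<forall>s\<in>K. real (card ((\<lambda>x. s * x) ` D - D)) \<le> \<delta> * M) \<longrightarrow>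
      f D \<le> r / (1 - \<epsilon>) * card D + c * (\<epsilon> * M + (1 - \<epsilon> / 2) ^ n * card D)"
    by (elim exE conjE) (rule that)
  \<comment> \<open>The tiles together have boundary at most \<delta>1 |C| |E|, and |C| |E| (1 -
    \<epsilon>) \<le> |A|; this choice makes it at most \<delta> / 2 times |A|.\<close>
  define \<delta>1 where "\<delta>1 = \<delta> * (1 - \<epsilon>) / 2"
  have "0 < \<delta>1" using K \<epsilon> by (simp add: \<delta>1_def)
  \<comment> \<open>The tile of the new round is placed before those of the previous ones, so it
    must be almost invariant under their \<open>K\<close>: removing tiles then leaves a set to which
    the induction hypothesis applies.\<close>
  then obtain E where E: "almost_invariant K \<delta>1 E" "f E \<le> r * card E"
    using tiles K(1) by blast
  have finE: "finite E" "E \<noteq> {}" using E(1) by (auto simp: almost_invariant_def)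
  then have Epos: "0 < real (card E)" by (simp add: card_gt_0_iff)
  \<comment> \<open>The first bound leaves half of \<delta> for the boundary created by the tiles.
    The second makes the points s of \<open>D\<close> with E s not inside \<open>D\<close> at most
    \<epsilon> M / 2 in number.\<close>
  define \<delta>2 where "\<delta>2 = min (\<delta> / 2) (\<epsilon> / (2 * card E))"
  have "0 < \<delta>2" using K \<epsilon> Epos by (simp add: \<delta>2_def)
  have step: "f D \<le> r / (1 - \<epsilon>) * card D + c * (\<epsilon> * M + (1 - \<epsilon> / 2) ^ Suc n * card D)"
    if D: "finite D" "real (card D) \<le> M"
      and inv: "\<And>s. s \<in> K \<union> E \<Longrightarrow> real (card ((\<lambda>x. s * x) ` D - D)) \<le> \<delta>2 * M" for D M
  proof (cases "card D \<le> \<epsilon> * M")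
    case True
    have "f D \<le> c * card D" by (rule le_card[OF D(1)])
    also have "\<dots> \<le> c * (\<epsilon> * M)" using True c_nonneg by (rule mult_left_mono)
    also have "\<dots> \<le> c * (\<epsilon> * M + (1 - \<epsilon> / 2) ^ Suc n * card D)"
      using c_nonneg \<epsilon> by (intro mult_left_mono) auto
    also have "\<dots> \<le> r / (1 - \<epsilon>) * card D + c * (\<epsilon> * M + (1 - \<epsilon> / 2) ^ Suc n * card D)"
      using \<epsilon> lam by simp
    finally show ?thesis .
  next
    case False
    have M: "0 \<le> M" using D(2) by linarith
    define D' where "D' = {s \<in> D. \<forall>e\<in>E. e * s \<in> D}"
    obtain C where C: "C \<subseteq> D'"
      and disj: "real (card C) * real (card E) * (1 - \<epsilon>) \<le> card (\<Union>s\<in>C. (\<lambda>e. e * s) ` E)"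
      and large: "\<epsilon> * card D' \<le> card (\<Union>s\<in>C. (\<lambda>e. e * s) ` E)"
      using almost_disjoint_translates[OF D(1) finE, of \<epsilon>] \<epsilon> unfolding D'_def by auto
    define A where "A = (\<Union>s\<in>C. (\<lambda>e. e * s) ` E)"
    define R where "R = D - A"
    have AD: "A \<subseteq> D" using C by (auto simp: A_def D'_def)
    then have finA: "finite A" using D(1) by (rule finite_subset)
    have finC: "finite C" using C D(1) by (auto simp: D'_def intro: finite_subset)
    have cardR: "real (card R) = real (card D) - real (card A)"
      using AD D(1) finA by (simp add: R_def card_Diff_subset of_nat_diff card_mono)
    have "card (D - D') \<le> (\<Sum>e\<in>E. card ((\<lambda>x. e * x) ` D - D))"
    proof -
      have "D - D' \<subseteq> (\<Union>e\<in>E. {x \<in> D. e * x \<notin> D})" by (auto simp: D'_def)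
      then have "card (D - D') \<le> card (\<Union>e\<in>E. {x \<in> D. e * x \<notin> D})"
        using D(1) finE by (intro card_mono) auto
      also have "\<dots> \<le> (\<Sum>e\<in>E. card {x \<in> D. e * x \<notin> D})" by (rule card_UN_le[OF finE(1)])
      finally show ?thesis by (simp add: card_left_translate_leaving)
    qed
    then have "real (card (D - D')) \<le> (\<Sum>e\<in>E. real (card ((\<lambda>x. e * x) ` D - D)))"
      by (simp flip: of_nat_sum)
    also have "\<dots> \<le> (\<Sum>e\<in>E. \<delta>2 * M)" by (intro sum_mono inv) auto
    also have "\<dots> = card E * \<delta>2 * M" by simp
    also have "\<dots> \<le> card E * (\<epsilon> / (2 * card E)) * M"
      using M by (intro mult_right_mono mult_left_mono) (auto simp: \<delta>2_def)
    also have "\<dots> = \<epsilon> * M / 2" using Epos by simp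
    \<comment> \<open>Here the separate treatment of small \<open>D\<close> pays off: \<epsilon> M <
      |D| converts a boundary measured against \<open>M\<close> into one measured against
      \<open>D\<close>.\<close>
    also have "\<dots> \<le> card D / 2" using False by simp
    finally have "card D / 2 \<le> card D'"
      using D(1) by (simp add: D'_def card_Diff_subset of_nat_diff card_mono)
    then have "\<epsilon> * (card D / 2) \<le> \<epsilon> * card D'" using \<epsilon> by (intro mult_left_mono) auto
    with large have cardA: "\<epsilon> / 2 * card D \<le> card A" by (simp add: A_def)
    have "f A \<le> (\<Sum>s\<in>C. f ((\<lambda>e. e * s) ` E))"
      unfolding A_def using finC finE by (intro subadditive_UN) auto
    also have "\<dots> \<le> (\<Sum>s\<in>C. r * card E)"
      using right_subinvariant[OF finE(1)] E(2) by (intro sum_mono) (meson order_trans)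
    also have "\<dots> = r / (1 - \<epsilon>) * (card C * card E * (1 - \<epsilon>))" using \<epsilon> by simp
    also have "\<dots> \<le> r / (1 - \<epsilon>) * card A"
      using disj lam \<epsilon> by (intro mult_left_mono) (auto simp: A_def)
    finally have fA: "f A \<le> r / (1 - \<epsilon>) * card A" .
    have "real (card ((\<lambda>x. s * x) ` R - R)) \<le> \<delta> * M" if s: "s \<in> K" for s
    proof -
      have "{x \<in> R. s * x \<notin> R} \<subseteq> {x \<in> D. s * x \<notin> D} \<union> {x \<in> R. s * x \<in> A}"
        by (auto simp: R_def)
      then have "card {x \<in> R. s * x \<notin> R} \<le> card ({x \<in> D. s * x \<notin> D} \<union> {x \<in> R. s * x \<in> A})"
        using D(1) by (intro card_mono) (auto simp: R_def)
      also have "\<dots> \<le> card {x \<in> D. s * x \<notin> D} + card {x \<in> R. s * x \<in> A}" by (rule card_Un_le)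
      finally have 1: "card ((\<lambda>x. s * x) ` R - R)
          \<le> card ((\<lambda>x. s * x) ` D - D) + card {x \<in> R. s * x \<in> A}"
        by (simp add: card_left_translate_leaving)
      \<comment> \<open>Left multiplication by \<open>s\<close> is injective, so \<open>A\<close> is entered from outside at most as often as it is left.\<close>
      have "{x \<in> R. s * x \<in> A} \<union> {x \<in> A. s * x \<in> A} \<subseteq> {x \<in> D. s * x \<in> A}"
        using AD by (auto simp: R_def)
      then have "card ({x \<in> R. s * x \<in> A} \<union> {x \<in> A. s * x \<in> A}) \<le> card {x \<in> D. s * x \<in> A}"
        using D(1) by (intro card_mono) auto
      also have "\<dots> \<le> card A" by (rule card_left_preimage_le[OF finA])
      finally have "card {x \<in> R. s * x \<in> A} + card {x \<in> A. s * x \<in> A} \<le> card A"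
        using D(1) finA by (subst (asm) card_Un_disjoint) (auto simp: R_def)
      moreover have "card ({x \<in> A. s * x \<in> A} \<union> {x \<in> A. s * x \<notin> A})
          = card {x \<in> A. s * x \<in> A} + card {x \<in> A. s * x \<notin> A}"
        using finA by (intro card_Un_disjoint) auto
      moreover have "{x \<in> A. s * x \<in> A} \<union> {x \<in> A. s * x \<notin> A} = A" by blast
      ultimately have 2: "card {x \<in> R. s * x \<in> A} \<le> card ((\<lambda>x. s * x) ` A - A)"
        by (simp add: card_left_translate_leaving)
      \<comment> \<open>By associativity, s leaves \<open>A\<close> only through right translates of
        the boundary of the tile \<open>E\<close>.\<close>
      have "(\<lambda>x. s * x) ` A - A \<subseteq> (\<Union>t\<in>C. (\<lambda>x. x * t) ` ((\<lambda>x. s * x) ` E - E))"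
      proof
        fix y assume y: "y \<in> (\<lambda>x. s * x) ` A - A"
        then obtain t e where t: "t \<in> C" "e \<in> E" "y = (s * e) * t"
          by (auto simp: A_def mult.assoc)
        with y have "s * e \<notin> E" by (auto simp: A_def)
        with t show "y \<in> (\<Union>t\<in>C. (\<lambda>x. x * t) ` ((\<lambda>x. s * x) ` E - E))" by blast
      qed
      then have "card ((\<lambda>x. s * x) ` A - A)
          \<le> card (\<Union>t\<in>C. (\<lambda>x. x * t) ` ((\<lambda>x. s * x) ` E - E))"
        using finC finE by (intro card_mono) auto
      also have "\<dots> \<le> (\<Sum>t\<in>C. card ((\<lambda>x. x * t) ` ((\<lambda>x. s * x) ` E - E)))"
        by (rule card_UN_le[OF finC])
      also have "\<dots> = card C * card ((\<lambda>x. s * x) ` E - E)" by (simp add: card_right_translate)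
      finally have "real (card ((\<lambda>x. s * x) ` A - A))
          \<le> real (card C) * real (card ((\<lambda>x. s * x) ` E - E))"
        by (metis of_nat_mono of_nat_mult)
      also have "\<dots> \<le> card C * (\<delta>1 * card E)"
        using E(1) s by (intro mult_left_mono) (auto simp: almost_invariant_def)
      also have "\<dots> = \<delta> / 2 * (card C * card E * (1 - \<epsilon>))" by (simp add: \<delta>1_def)
      also have "\<dots> \<le> \<delta> / 2 * card A"
        using disj K by (intro mult_left_mono) (auto simp: A_def)
      also have "real (card A) \<le> M" using card_mono[OF D(1) AD] D(2) by linarith
      finally have 3: "real (card ((\<lambda>x. s * x) ` A - A)) \<le> \<delta> / 2 * M" using K by simp
      have "\<delta>2 * M \<le> \<delta> / 2 * M" using M by (intro mult_right_mono) (auto simp: \<delta>2_def)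
      with inv[of s] s have 4: "real (card ((\<lambda>x. s * x) ` D - D)) \<le> \<delta> / 2 * M" by force
      show ?thesis using 1 2 3 4 by linarith
    qed
    then have "f R \<le> r / (1 - \<epsilon>) * card R + c * (\<epsilon> * M + (1 - \<epsilon> / 2) ^ n * card R)"
      using D cardR by (intro IH[rule_format]) (auto simp: R_def)
    also have "\<dots> \<le> r / (1 - \<epsilon>) * card R + c * (\<epsilon> * M + (1 - \<epsilon> / 2) ^ n * ((1 - \<epsilon> / 2) * card D))"
      using cardA cardR c_nonneg \<epsilon>
      by (intro add_left_mono mult_left_mono) (auto simp: algebra_simps)
    finally have fR: "f R \<le> r / (1 - \<epsilon>) * card R + c * (\<epsilon> * M + (1 - \<epsilon> / 2) ^ Suc n * card D)"
      by (simp add: mult.assoc mult.commute mult.left_commute)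
    have "D = A \<union> R" using AD by (auto simp: R_def)
    then have "f D \<le> f A + f R" using subadditive[of A R] finA D(1) by (simp add: R_def)
    also have "\<dots> \<le> r / (1 - \<epsilon>) * card D + c * (\<epsilon> * M + (1 - \<epsilon> / 2) ^ Suc n * card D)"
      using fA fR by (simp add: cardR algebra_simps)
    finally show ?thesis .
  qed
  show ?case
    using K finE \<open>0 < \<delta>2\<close>
    by (intro exI[of _ "K \<union> E"] exI[of _ \<delta>2] conjI allI impI step) (simp_all only: finite_UnI)
qed

text \<open>Occurring frequently along the filter means having arbitrarily invariant tiles of ratio
  at most \<open>r\<close>. Quasi-tiling any sufficiently invariant \<open>F\<close> by these costs
  r / (1 - \<epsilon>) + 2 c \<epsilon> per point, which is below r + e for small
  \<epsilon>.\<close>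

lemma eventually_le_of_frequently_le:
  fixes r e :: real
  assumes freq: "\<exists>\<^sub>F E in Folner_filter. f E \<le> r * card E" and lam: "0 \<le> r" and "0 < e"
  shows "\<forall>\<^sub>F F in Folner_filter. f F \<le> (r + e) * card F"
proof -
  have tiles: "\<forall>K \<delta>. finite K \<and> 0 < \<delta> \<longrightarrow> (\<exists>E. almost_invariant K \<delta> E \<and> f E \<le> r * card E)"
    using freq unfolding frequently_def eventually_Folner_filter by blast
  \<comment> \<open>One \<epsilon> pays for the term \<epsilon> M of the tiling bound, the other for
    what is left after \<open>n\<close> rounds.\<close>
  have "((\<lambda>\<epsilon>. r / (1 - \<epsilon>) + c * (\<epsilon> + \<epsilon>)) \<longlongrightarrow> r / (1 - 0) + c * (0 + 0)) (at_right 0)"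
    by (intro tendsto_intros) auto
  then have "\<forall>\<^sub>F \<epsilon> in at_right 0. r / (1 - \<epsilon>) + c * (\<epsilon> + \<epsilon>) < r + e"
    using \<open>0 < e\<close> by (intro order_tendstoD) auto
  then have "\<forall>\<^sub>F \<epsilon> in at_right 0. \<epsilon> \<in> {0<..<1} \<and> r / (1 - \<epsilon>) + c * (\<epsilon> + \<epsilon>) < r + e"
    by (intro eventually_conj) (auto intro: eventually_at_rightI[of 0 1])
  then obtain \<epsilon> :: real where \<epsilon>: "0 < \<epsilon>" "\<epsilon> < 1" "r / (1 - \<epsilon>) + c * (\<epsilon> + \<epsilon>) < r + e"
    using eventually_happens[of _ "at_right (0 :: real)"] by (auto simp: trivial_limit_at_right_real)
  obtain n where n: "(1 - \<epsilon> / 2) ^ n < \<epsilon>"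
    using real_arch_pow_inv[of \<epsilon> "1 - \<epsilon> / 2"] \<epsilon> by auto
  obtain K \<delta> where K: "finite K" "0 < \<delta>"
    and tiling: "\<forall>D M. finite D \<and> real (card D) \<le> M \<and>
      (\<forall>s\<in>K. real (card ((\<lambda>x. s * x) ` D - D)) \<le> \<delta> * M) \<longrightarrow>
      f D \<le> r / (1 - \<epsilon>) * card D + c * (\<epsilon> * M + (1 - \<epsilon> / 2) ^ n * card D)"
    using quasi_tiling[OF \<epsilon>(1,2) lam tiles, of n] by (elim exE conjE) (rule that)
  have "f F \<le> (r + e) * card F" if F: "almost_invariant K \<delta> F" for F
  proof -
    have "f F \<le> r / (1 - \<epsilon>) * card F + c * (\<epsilon> * card F + (1 - \<epsilon> / 2) ^ n * card F)"
      using F by (intro tiling[rule_format]) (auto simp: almost_invariant_def)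
    also have "\<dots> \<le> r / (1 - \<epsilon>) * card F + c * (\<epsilon> * card F + \<epsilon> * card F)"
      using n c_nonneg by (intro add_left_mono mult_left_mono mult_right_mono) auto
    also have "\<dots> = (r / (1 - \<epsilon>) + c * (\<epsilon> + \<epsilon>)) * card F" by (simp add: algebra_simps)
    also have "\<dots> \<le> (r + e) * card F" using \<epsilon>(3) by (intro mult_right_mono) auto
    finally show ?thesis .
  qed
  then show ?thesis using K by (auto simp: eventually_Folner_filter)
qed

theorem convergent_along_Folner_filter:
  assumes nonbot: "(Folner_filter :: 's set filter) \<noteq> bot"
  shows "\<exists>h. ((\<lambda>F. f F / card F) \<longlongrightarrow> h) Folner_filter"
proof -
  \<comment> \<open>The infimum is the lower limit of the ratios. Each member of
    \<open>\<Lambda>\<close> is, up to any e > 0, also an eventual upper bound, so lower and upper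
    limit agree.\<close>
  define \<Lambda> where "\<Lambda> = {r :: real. 0 \<le> r \<and> (\<exists>\<^sub>F E in Folner_filter. f E \<le> r * card E)}"
  define h where "h = Inf \<Lambda>"
  have "\<forall>\<^sub>F E in Folner_filter. f E \<le> c * card E"
    using eventually_Folner_filter_nonempty by eventually_elim (auto intro: le_card)
  then have "c \<in> \<Lambda>" using nonbot c_nonneg by (auto simp: \<Lambda>_def eventually_frequently)
  then have ne: "\<Lambda> \<noteq> {}" by blast
  have bdd: "bdd_below \<Lambda>" by (auto simp: \<Lambda>_def bdd_below_def)
  have "((\<lambda>F. f F / card F) \<longlongrightarrow> h) Folner_filter"
  proof (rule order_tendstoI)
    fix a assume "a < h"
    have "\<forall>\<^sub>F F in Folner_filter. \<not> f F \<le> a * card F"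
    proof (cases "0 \<le> a")
      case True
      have "a \<notin> \<Lambda>" using \<open>a < h\<close> cInf_lower[OF _ bdd, of a] by (auto simp: h_def)
      with True show ?thesis by (simp add: \<Lambda>_def not_frequently)
    next
      case False
      show ?thesis using eventually_Folner_filter_nonempty
      proof eventually_elim
        case (elim F)
        then have "a * card F < 0" using False by (simp add: mult_neg_pos card_gt_0_iff)
        with nonneg[of F] elim show ?case by linarith
      qed
    qed
    with eventually_Folner_filter_nonempty show "\<forall>\<^sub>F F in Folner_filter. a < f F / card F"
      by eventually_elim (simp add: less_divide_eq card_gt_0_iff)
  next
    fix a assume "h < a"
    then obtain r where lam: "r \<in> \<Lambda>" "r < a" using cInf_lessD[OF ne] by (auto simp: h_def)
    then have "\<forall>\<^sub>F F in Folner_filter. f F \<le> (r + (a - r) / 2) * card F"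
      by (intro eventually_le_of_frequently_le) (auto simp: \<Lambda>_def)
    with eventually_Folner_filter_nonempty show "\<forall>\<^sub>F F in Folner_filter. f F / card F < a"
    proof eventually_elim
      case (elim F)
      then have pos: "0 < real (card F)" by (simp add: card_gt_0_iff)
      have "(r + (a - r) / 2) * card F < a * card F" 
        using lam pos by (intro mult_strict_right_mono) (auto simp: field_simps)
      with elim have "f F < a * card F" by linarith
      with pos show ?case by (simp add: divide_less_eq)
    qed
  qed
  then show ?thesis ..
qed

end


section \<open>Cover numbers and entropy of open covers\<close>

lemma cover_number_attained:
  assumes "compact_space X" "open_cover X \<U>"
  obtains \<V> where "\<V> \<subseteq> \<U>" "finite \<V>" "\<Union>\<V> = topspace X" "card \<V> = cover_number X \<U>"
proof -
  have "\<exists>\<V>. finite \<V> \<and> \<V> \<subseteq> \<U> \<and> \<Union>\<V> = topspace X"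
    using assms(1)[unfolded compact_space, THEN spec, THEN mp, OF assms(2)[unfolded open_cover_def]] .
  then obtain \<V> where "finite \<V>" "\<V> \<subseteq> \<U>" "\<Union>\<V> = topspace X" by (elim exE conjE)
  then have "\<exists>\<W>\<subseteq>\<U>. finite \<W> \<and> \<Union>\<W> = topspace X \<and> card \<W> = card \<V>"
    by (intro exI[of _ \<V>] conjI refl)
  then have "\<exists>\<V>\<subseteq>\<U>. finite \<V> \<and> \<Union>\<V> = topspace X \<and> card \<V> = cover_number X \<U>"
    unfolding cover_number_def by (rule LeastI)
  then show ?thesis using that by (elim exE conjE)
qed

lemma cover_number_le:
  assumes "\<V> \<subseteq> \<U>" "finite \<V>" "\<Union>\<V> = topspace X"
  shows "cover_number X \<U> \<le> card \<V>"
  unfolding cover_number_def by (rule Least_le) (use assms in blast)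

lemma cover_number_le_finer:
  assumes \<W>: "finite \<W>" "\<Union>\<W> = topspace X"
    and finer: "\<And>B. B \<in> \<W> \<Longrightarrow> \<exists>A\<in>\<U>. B \<subseteq> A" and sub: "\<Union>\<U> \<subseteq> topspace X"
  shows "cover_number X \<U> \<le> card \<W>"
proof -
  obtain \<alpha> where \<alpha>: "\<And>B. B \<in> \<W> \<Longrightarrow> \<alpha> B \<in> \<U> \<and> B \<subseteq> \<alpha> B" using finer by metis
  have "topspace X \<subseteq> \<Union>(\<alpha> ` \<W>)" using \<alpha> \<W>(2) by blast
  moreover have "\<Union>(\<alpha> ` \<W>) \<subseteq> topspace X" using \<alpha> sub by blast
  ultimately have "cover_number X \<U> \<le> card (\<alpha> ` \<W>)"
    using \<alpha> \<W>(1) by (intro cover_number_le) auto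
  also have "\<dots> \<le> card \<W>" using \<W>(1) by (rule card_image_le)
  finally show ?thesis .
qed

lemma cover_number_mono:
  assumes "compact_space X" "open_cover X \<V>" "open_cover X \<U>"
    and finer: "\<And>B. B \<in> \<V> \<Longrightarrow> \<exists>A\<in>\<U>. B \<subseteq> A"
  shows "cover_number X \<U> \<le> cover_number X \<V>"
proof -
  obtain \<W> where \<W>: "\<W> \<subseteq> \<V>" "finite \<W>" "\<Union>\<W> = topspace X" "card \<W> = cover_number X \<V>"
    using cover_number_attained[OF assms(1,2)] .
  have "cover_number X \<U> \<le> card \<W>"
    by (rule cover_number_le_finer) (use \<W> assms in \<open>auto simp: open_cover_def\<close>)
  with \<W> show ?thesis by simp
qed

lemma cover_number_pos:
  assumes "compact_space X" "open_cover X \<U>" "topspace X \<noteq> {}"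
  shows "1 \<le> cover_number X \<U>"
proof -
  obtain \<W> where \<W>: "\<W> \<subseteq> \<U>" "finite \<W>" "\<Union>\<W> = topspace X" "card \<W> = cover_number X \<U>"
    using cover_number_attained[OF assms(1,2)] .
  then have "\<W> \<noteq> {}" using assms(3) by (metis Union_empty)
  then have "0 < card \<W>" using \<W>(2) by (simp add: card_gt_0_iff)
  then show ?thesis using \<W>(4) by simp
qed

lemma cover_number_partition:
  assumes \<P>: "\<P> \<subseteq> \<U>" "finite \<P>" "\<Union>\<P> = topspace X" "disjoint \<P>" "{} \<notin> \<P>"
    and rest: "\<U> \<subseteq> insert {} \<P>"
  shows "cover_number X \<U> = card \<P>"
  unfolding cover_number_def
proof (rule Least_equality)
  show "\<exists>\<V>\<subseteq>\<U>. finite \<V> \<and> \<Union>\<V> = topspace X \<and> card \<V> = card \<P>" using \<P> by blast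
next
  fix n assume "\<exists>\<V>\<subseteq>\<U>. finite \<V> \<and> \<Union>\<V> = topspace X \<and> card \<V> = n"
  then obtain \<V> where \<V>: "\<V> \<subseteq> \<U>" "finite \<V>" "\<Union>\<V> = topspace X" "card \<V> = n" by blast
  have "P \<in> \<V>" if P: "P \<in> \<P>" for P
  proof -
    obtain x where x: "x \<in> P" using P \<P>(5) by (metis all_not_in_conv)
    then obtain A where A: "A \<in> \<V>" "x \<in> A" using P \<P>(3) \<V>(3) by blast
    then have "A \<in> \<P>" using \<V>(1) rest by blast
    then have "A = P" using A x P \<P>(4) unfolding disjoint_def by blast
    with A show ?thesis by simp
  qed
  then show "card \<P> \<le> n" using \<V> card_mono[of \<V> \<P>] by blast
qed


text \<open>Members of the join are sets of points with a prescribed itinerary. For empty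
  \<open>F\<close> the join would consist of \<open>UNIV\<close> instead of the whole space.\<close>

lemma join_pullback_covers:
  assumes "F \<noteq> {}"
  shows "join_covers F (\<lambda>s. pullback_cover X (g s) \<U>) =
    {{x \<in> topspace X. \<forall>s\<in>F. g s x \<in> V s} | V. \<forall>s\<in>F. V s \<in> \<U>}"
proof (intro equalityI subsetI)
  fix A assume "A \<in> join_covers F (\<lambda>s. pullback_cover X (g s) \<U>)"
  then obtain W where W: "A = (\<Inter>s\<in>F. W s)" "\<forall>s\<in>F. W s \<in> pullback_cover X (g s) \<U>"
    by (auto simp: join_covers_def)
  then have "\<forall>s\<in>F. \<exists>V. V \<in> \<U> \<and> W s = {x \<in> topspace X. g s x \<in> V}"
    by (auto simp: pullback_cover_def)
  then obtain V where V: "\<forall>s\<in>F. V s \<in> \<U> \<and> W s = {x \<in> topspace X. g s x \<in> V s}" by metis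
  then have "A = {x \<in> topspace X. \<forall>s\<in>F. g s x \<in> V s}" using assms by (auto simp: W(1))
  with V show "A \<in> {{x \<in> topspace X. \<forall>s\<in>F. g s x \<in> V s} | V. \<forall>s\<in>F. V s \<in> \<U>}" by blast
next
  fix A assume "A \<in> {{x \<in> topspace X. \<forall>s\<in>F. g s x \<in> V s} | V. \<forall>s\<in>F. V s \<in> \<U>}"
  then obtain V where V: "A = {x \<in> topspace X. \<forall>s\<in>F. g s x \<in> V s}" "\<forall>s\<in>F. V s \<in> \<U>" by blast
  then have "A = (\<Inter>s\<in>F. {x \<in> topspace X. g s x \<in> V s})" using assms by auto
  with V(2) show "A \<in> join_covers F (\<lambda>s. pullback_cover X (g s) \<U>)"
    by (auto simp: join_covers_def pullback_cover_def intro!: exI[of _ "\<lambda>s. {x \<in> topspace X. g s x \<in> V s}"])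
qed

section \<open>Entropy of open covers under an action on a compact space\<close>

locale compact_action =
  fixes X :: "'c topology" and g :: "'s::cancel_semigroup_mult \<Rightarrow> 'c \<Rightarrow> 'c"
  assumes compact: "compact_space X" and nonempty: "topspace X \<noteq> {}"
    and continuous: "continuous_map X X (g s)"
    and action: "x \<in> topspace X \<Longrightarrow> g (s * t) x = g s (g t x)"
begin

lemma maps_into: "x \<in> topspace X \<Longrightarrow> g s x \<in> topspace X"
  using continuous[of s] by (auto simp: continuous_map_def)

definition joined :: "'c set set \<Rightarrow> 's set \<Rightarrow> 'c set set" where
  "joined \<U> F = join_covers F (\<lambda>s. pullback_cover X (g s) \<U>)"

lemma joined_eq:
  "F \<noteq> {} \<Longrightarrow> joined \<U> F = {{x \<in> topspace X. \<forall>s\<in>F. g s x \<in> V s} | V. \<forall>s\<in>F. V s \<in> \<U>}"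
  by (simp add: joined_def join_pullback_covers)

lemma joinedI:
  "F \<noteq> {} \<Longrightarrow> (\<And>s. s \<in> F \<Longrightarrow> V s \<in> \<U>) \<Longrightarrow> {x \<in> topspace X. \<forall>s\<in>F. g s x \<in> V s} \<in> joined \<U> F"
  by (auto simp: joined_eq)

lemma joinedE:
  assumes "A \<in> joined \<U> F" "F \<noteq> {}"
  obtains V where "A = {x \<in> topspace X. \<forall>s\<in>F. g s x \<in> V s}" "\<And>s. s \<in> F \<Longrightarrow> V s \<in> \<U>"
  using assms by (auto simp: joined_eq)

lemma open_cover_joined:
  assumes \<U>: "open_cover X \<U>" and F: "finite F" "F \<noteq> {}"
  shows "open_cover X (joined \<U> F)"
  unfolding open_cover_def
proof (intro conjI ballI)
  fix A assume "A \<in> joined \<U> F"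
  then obtain V where V: "A = {x \<in> topspace X. \<forall>s\<in>F. g s x \<in> V s}" "\<And>s. s \<in> F \<Longrightarrow> V s \<in> \<U>"
    using F(2) by (rule joinedE) blast
  have "openin X (\<Inter>s\<in>F. {x \<in> topspace X. g s x \<in> V s})"
    using F V(2) \<U> continuous by (intro openin_Inter) (auto simp: open_cover_def continuous_map_def)
  also have "(\<Inter>s\<in>F. {x \<in> topspace X. g s x \<in> V s}) = A" using F(2) by (auto simp: V(1))
  finally show "openin X A" .
next
  show "\<Union>(joined \<U> F) = topspace X"
  proof
    show "\<Union>(joined \<U> F) \<subseteq> topspace X" by (auto elim: joinedE[OF _ F(2)])
    show "topspace X \<subseteq> \<Union>(joined \<U> F)"
    proof
      fix x assume x: "x \<in> topspace X"
      then have "g s x \<in> \<Union>\<U>" for s using \<U> maps_into by (simp add: open_cover_def)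
      then have "\<forall>s. \<exists>V. V \<in> \<U> \<and> g s x \<in> V" by blast
      then obtain V where V: "\<And>s. V s \<in> \<U>" "\<And>s. g s x \<in> V s" by metis
      have "{x \<in> topspace X. \<forall>s\<in>F. g s x \<in> V s} \<in> joined \<U> F"
        using F(2) V(1) by (intro joinedI)
      then show "x \<in> \<Union>(joined \<U> F)" by (rule UnionI) (use x V(2) in simp)
    qed
  qed
qed

lemma cover_number_joined_Un:
  assumes \<U>: "open_cover X \<U>" and F: "finite F" "F \<noteq> {}" and E: "finite E" "E \<noteq> {}"
  shows "cover_number X (joined \<U> (F \<union> E)) \<le> cover_number X (joined \<U> F) * cover_number X (joined \<U> E)"
proof -
  obtain \<V> where \<V>: "\<V> \<subseteq> joined \<U> F" "finite \<V>" "\<Union>\<V> = topspace X"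
    "card \<V> = cover_number X (joined \<U> F)"
    using cover_number_attained[OF compact open_cover_joined[OF \<U> F]] .
  obtain \<W> where \<W>: "\<W> \<subseteq> joined \<U> E" "finite \<W>" "\<Union>\<W> = topspace X"
    "card \<W> = cover_number X (joined \<U> E)"
    using cover_number_attained[OF compact open_cover_joined[OF \<U> E]] .
  define \<Z> where "\<Z> = (\<lambda>(A, B). A \<inter> B) ` (\<V> \<times> \<W>)"
  have "cover_number X (joined \<U> (F \<union> E)) \<le> card \<Z>"
  proof (rule cover_number_le_finer)
    show "finite \<Z>" using \<V> \<W> by (simp add: \<Z>_def)
    have "\<Union>\<Z> = \<Union>\<V> \<inter> \<Union>\<W>" by (auto simp: \<Z>_def)
    then show "\<Union>\<Z> = topspace X" using \<V> \<W> by simp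
    show "\<Union>(joined \<U> (F \<union> E)) \<subseteq> topspace X" using F by (auto elim: joinedE)
    fix C assume "C \<in> \<Z>"
    then have "\<exists>A\<in>\<V>. \<exists>B\<in>\<W>. C = A \<inter> B" by (auto simp: \<Z>_def)
    then obtain A B where C: "C = A \<inter> B" "A \<in> joined \<U> F" "B \<in> joined \<U> E"
      using \<V>(1) \<W>(1) by blast
    obtain V where V: "A = {x \<in> topspace X. \<forall>s\<in>F. g s x \<in> V s}" "\<And>s. s \<in> F \<Longrightarrow> V s \<in> \<U>"
      using C(2) F(2) by (rule joinedE) blast
    obtain W where W: "B = {x \<in> topspace X. \<forall>s\<in>E. g s x \<in> W s}" "\<And>s. s \<in> E \<Longrightarrow> W s \<in> \<U>"
      using C(3) E(2) by (rule joinedE) blast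
    define Y where "Y s = (if s \<in> F then V s else W s)" for s
    have "{x \<in> topspace X. \<forall>s\<in>F \<union> E. g s x \<in> Y s} \<in> joined \<U> (F \<union> E)"
      using F V(2) W(2) by (intro joinedI) (auto simp: Y_def)
    moreover have "C \<subseteq> {x \<in> topspace X. \<forall>s\<in>F \<union> E. g s x \<in> Y s}"
      by (auto simp: C(1) V(1) W(1) Y_def)
    ultimately show "\<exists>D\<in>joined \<U> (F \<union> E). C \<subseteq> D" by blast
  qed
  also have "card \<Z> \<le> card (\<V> \<times> \<W>)" using \<V> \<W> unfolding \<Z>_def by (intro card_image_le) simp
  finally show ?thesis using \<V> \<W> by (simp add: card_cartesian_product)
qed

text \<open>A subcover of the join over \<open>F\<close>, pulled back along \<open>g s\<close>,
  refines the join over the translate because \<open>g (t * s)\<close> is \<open>g t\<close> after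
  \<open>g s\<close>. Equality can fail when \<open>g s\<close> is not surjective.\<close>

lemma cover_number_joined_translate:
  assumes \<U>: "open_cover X \<U>" and F: "finite F" "F \<noteq> {}"
  shows "cover_number X (joined \<U> ((\<lambda>t. t * s) ` F)) \<le> cover_number X (joined \<U> F)"
proof -
  obtain \<V> where \<V>: "\<V> \<subseteq> joined \<U> F" "finite \<V>" "\<Union>\<V> = topspace X"
    "card \<V> = cover_number X (joined \<U> F)"
    using cover_number_attained[OF compact open_cover_joined[OF \<U> F]] .
  define \<Z> where "\<Z> = (\<lambda>A. {x \<in> topspace X. g s x \<in> A}) ` \<V>"
  have "cover_number X (joined \<U> ((\<lambda>t. t * s) ` F)) \<le> card \<Z>"
  proof (rule cover_number_le_finer)
    show "finite \<Z>" using \<V> by (simp add: \<Z>_def)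
    have "\<Union>\<Z> = {x \<in> topspace X. g s x \<in> \<Union>\<V>}" by (auto simp: \<Z>_def)
    then show "\<Union>\<Z> = topspace X" using \<V> maps_into by auto
    show "\<Union>(joined \<U> ((\<lambda>t. t * s) ` F)) \<subseteq> topspace X" using F by (auto elim: joinedE)
    fix B assume "B \<in> \<Z>"
    then obtain A where A: "A \<in> joined \<U> F" "B = {x \<in> topspace X. g s x \<in> A}"
      using \<V> by (auto simp: \<Z>_def)
    obtain V where V: "A = {x \<in> topspace X. \<forall>t\<in>F. g t x \<in> V t}" "\<And>t. t \<in> F \<Longrightarrow> V t \<in> \<U>"
      using A(1) F(2) by (rule joinedE) blast
    \<comment> \<open>Right cancellation recovers t from \<open>t * s\<close>, so the itinerary can
      be re-indexed by the translate.\<close>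
    define Y where "Y u = V (THE t. u = t * s)" for u
    have Y: "Y (t * s) = V t" for t by (simp add: Y_def right_cancel)
    have "{x \<in> topspace X. \<forall>u\<in>(\<lambda>t. t * s) ` F. g u x \<in> Y u} \<in> joined \<U> ((\<lambda>t. t * s) ` F)"
      using F V(2) by (intro joinedI) (auto simp: Y)
    moreover have "B \<subseteq> {x \<in> topspace X. \<forall>u\<in>(\<lambda>t. t * s) ` F. g u x \<in> Y u}"
      by (auto simp: A(2) V(1) Y action)
    ultimately show "\<exists>D\<in>joined \<U> ((\<lambda>t. t * s) ` F). B \<subseteq> D" by blast
  qed
  also have "card \<Z> \<le> card \<V>" using \<V> unfolding \<Z>_def by (intro card_image_le) simp
  finally show ?thesis using \<V> by simp
qed

lemma cover_number_joined_singleton: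
  assumes \<U>: "open_cover X \<U>"
  shows "cover_number X (joined \<U> {s}) \<le> cover_number X \<U>"
proof -
  obtain \<V> where \<V>: "\<V> \<subseteq> \<U>" "finite \<V>" "\<Union>\<V> = topspace X" "card \<V> = cover_number X \<U>"
    using cover_number_attained[OF compact \<U>] .
  define \<Z> where "\<Z> = (\<lambda>A. {x \<in> topspace X. g s x \<in> A}) ` \<V>"
  have "\<Z> \<subseteq> joined \<U> {s}"
  proof
    fix B assume "B \<in> \<Z>"
    then obtain A where A: "A \<in> \<U>" "B = {x \<in> topspace X. g s x \<in> A}" using \<V> by (auto simp: \<Z>_def)
    then show "B \<in> joined \<U> {s}" using joinedI[of "{s}" "\<lambda>_. A" \<U>] by simp
  qed
  moreover have "\<Union>\<Z> = {x \<in> topspace X. g s x \<in> \<Union>\<V>}" by (auto simp: \<Z>_def)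
  then have "\<Union>\<Z> = topspace X" using \<V> maps_into by auto
  ultimately have "cover_number X (joined \<U> {s}) \<le> card \<Z>"
    using \<V> by (intro cover_number_le) (auto simp: \<Z>_def)
  also have "card \<Z> \<le> card \<V>" using \<V> unfolding \<Z>_def by (intro card_image_le) simp
  finally show ?thesis using \<V> by simp
qed

text \<open>The value at the empty set is fixed by hand: non-negativity and the bound by cardinality
  force 0 there, while the empty join is not a cover of the space in general.\<close>

definition cover_entropy :: "'c set set \<Rightarrow> 's set \<Rightarrow> real" where
  "cover_entropy \<U> F = (if F = {} then 0 else ln (cover_number X (joined \<U> F)))"

lemma subadditive_cover_entropy:
  assumes \<U>: "open_cover X \<U>"
  shows "subadditive_set_function (cover_entropy \<U>) (ln (cover_number X \<U>))"
proof
  have pos: "1 \<le> cover_number X (joined \<U> F)" if "finite F" "F \<noteq> {}" for F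
    using that \<U> by (intro cover_number_pos compact nonempty open_cover_joined)
  show nonneg: "0 \<le> cover_entropy \<U> A" if "finite A" for A
    using pos[OF that] by (auto simp: cover_entropy_def)
  show sub: "cover_entropy \<U> (A \<union> B) \<le> cover_entropy \<U> A + cover_entropy \<U> B"
    if AB: "finite A" "finite B" for A B
  proof (cases "A = {} \<or> B = {}")
    case False
    then have "ln (real (cover_number X (joined \<U> (A \<union> B))))
        \<le> ln (real (cover_number X (joined \<U> A) * cover_number X (joined \<U> B)))"
      using AB pos[of "A \<union> B"] cover_number_joined_Un[OF \<U>, of A B]
      by (intro ln_mono) (auto simp flip: of_nat_mult)
    also have "\<dots> = ln (cover_number X (joined \<U> A)) + ln (cover_number X (joined \<U> B))"
      using AB False pos[of A] pos[of B] by (auto simp: ln_mult)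
    finally show ?thesis using False by (simp add: cover_entropy_def)
  qed (auto simp: cover_entropy_def)
  show "cover_entropy \<U> ((\<lambda>x. x * s) ` A) \<le> cover_entropy \<U> A" if A: "finite A" for A s
  proof (cases "A = {}")
    case False
    then show ?thesis
      using A pos[of "(\<lambda>x. x * s) ` A"] cover_number_joined_translate[OF \<U>, of A s]
      by (auto simp: cover_entropy_def intro!: ln_mono)
  qed (auto simp: cover_entropy_def)
  show "cover_entropy \<U> A \<le> ln (cover_number X \<U>) * card A" if "finite A" for A
    using that
  proof (induction A rule: finite_induct)
    case (insert s A)
    have "cover_entropy \<U> {s} \<le> ln (cover_number X \<U>)"
      using pos[of "{s}"] cover_number_joined_singleton[OF \<U>, of s]
      by (auto simp: cover_entropy_def intro!: ln_mono)
    moreover have "cover_entropy \<U> (insert s A) \<le> cover_entropy \<U> {s} + cover_entropy \<U> A"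
      using sub[of "{s}" A] insert by simp
    ultimately show ?case using insert by (simp add: algebra_simps)
  qed (simp add: cover_entropy_def)
qed

text \<open>Resolves the definite description: the Ornstein--Weiss lemma gives existence along
  \<open>Folner_filter\<close> and hence along all finer filters, and properness of
  \<open>Folner_filter\<close> gives uniqueness.\<close>

theorem entropy_cover_limit:
  assumes amen: "left_amenable TYPE('s)" and \<U>: "open_cover X \<U>"
  shows "((\<lambda>F. ln (cover_number X (joined \<U> F)) / card F) \<longlongrightarrow> entropy_cover X g \<U>) Folner_filter"
proof -
  interpret subadditive_set_function "cover_entropy \<U>" "ln (cover_number X \<U>)"
    by (rule subadditive_cover_entropy[OF \<U>])
  have nonbot: "(Folner_filter :: 's set filter) \<noteq> bot" by (rule Folner_filter_neq_bot[OF amen])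
  obtain h where "((\<lambda>F. cover_entropy \<U> F / card F) \<longlongrightarrow> h) Folner_filter"
    using convergent_along_Folner_filter[OF nonbot] by blast
  moreover have "\<forall>\<^sub>F F in Folner_filter. cover_entropy \<U> F / card F = ln (cover_number X (joined \<U> F)) / card F"
    using eventually_Folner_filter_nonempty by eventually_elim (simp add: cover_entropy_def)
  ultimately have h: "((\<lambda>F. ln (cover_number X (joined \<U> F)) / card F) \<longlongrightarrow> h) Folner_filter"
    by (rule Lim_transform_eventually)
  have "entropy_cover X g \<U> = h"
    unfolding entropy_cover_def joined_def[symmetric]
  proof (rule the_equality)
    show "\<forall>I. left_Folner_net (\<lambda>F. F) I \<longrightarrow> ((\<lambda>F. ln (cover_number X (joined \<U> F)) / card F) \<longlongrightarrow> h) I"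
      using h by (auto simp: left_Folner_net_iff_le_Folner_filter intro: tendsto_mono)
    fix h' assume "\<forall>I. left_Folner_net (\<lambda>F. F) I \<longrightarrow> ((\<lambda>F. ln (cover_number X (joined \<U> F)) / card F) \<longlongrightarrow> h') I"
    then have "((\<lambda>F. ln (cover_number X (joined \<U> F)) / card F) \<longlongrightarrow> h') Folner_filter"
      using nonbot by (auto simp: left_Folner_net_iff_le_Folner_filter)
    then show "h' = h" using h nonbot by (metis tendsto_unique)
  qed
  with h show ?thesis by simp
qed

lemma entropy_cover_nonneg:
  assumes amen: "left_amenable TYPE('s)" and \<U>: "open_cover X \<U>"
  shows "0 \<le> entropy_cover X g \<U>"
proof (rule tendsto_lowerbound[OF entropy_cover_limit[OF amen \<U>]])
  show "\<forall>\<^sub>F F in Folner_filter. 0 \<le> ln (cover_number X (joined \<U> F)) / card F"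
    using eventually_Folner_filter_nonempty
  proof eventually_elim
    case (elim F)
    then have "1 \<le> cover_number X (joined \<U> F)"
      using \<U> by (intro cover_number_pos compact nonempty open_cover_joined) auto
    then show ?case by simp
  qed
qed (rule Folner_filter_neq_bot[OF amen])

lemma entropy_cover_mono:
  assumes amen: "left_amenable TYPE('s)" and \<V>: "open_cover X \<V>" and \<U>: "open_cover X \<U>"
    and finer: "\<And>B. B \<in> \<V> \<Longrightarrow> \<exists>A\<in>\<U>. B \<subseteq> A"
  shows "entropy_cover X g \<U> \<le> entropy_cover X g \<V>"
proof (rule tendsto_le[OF _ entropy_cover_limit[OF amen \<V>] entropy_cover_limit[OF amen \<U>]])
  show "\<forall>\<^sub>F F in Folner_filter. ln (cover_number X (joined \<U> F)) / card F
      \<le> ln (cover_number X (joined \<V> F)) / card F"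
    using eventually_Folner_filter_nonempty
  proof eventually_elim
    case (elim F)
    have "\<exists>A\<in>joined \<U> F. B \<subseteq> A" if B: "B \<in> joined \<V> F" for B
    proof -
      obtain V where V: "B = {x \<in> topspace X. \<forall>s\<in>F. g s x \<in> V s}" "\<And>s. s \<in> F \<Longrightarrow> V s \<in> \<V>"
        using B elim[THEN conjunct2] by (rule joinedE) blast
      then have "\<forall>s\<in>F. \<exists>A\<in>\<U>. V s \<subseteq> A" using finer by blast
      then obtain W where W: "\<And>s. s \<in> F \<Longrightarrow> W s \<in> \<U> \<and> V s \<subseteq> W s" by metis
      then have "{x \<in> topspace X. \<forall>s\<in>F. g s x \<in> W s} \<in> joined \<U> F"
        using elim by (intro joinedI) auto
      moreover have "B \<subseteq> {x \<in> topspace X. \<forall>s\<in>F. g s x \<in> W s}" using V W by auto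
      ultimately show ?thesis by blast
    qed
    then have "cover_number X (joined \<U> F) \<le> cover_number X (joined \<V> F)"
      using elim \<U> \<V> by (intro cover_number_mono compact open_cover_joined) auto
    moreover have "1 \<le> cover_number X (joined \<U> F)"
      using elim \<U> by (intro cover_number_pos compact nonempty open_cover_joined) auto
    ultimately have "ln (real (cover_number X (joined \<U> F))) \<le> ln (real (cover_number X (joined \<V> F)))"
      by (intro ln_mono) auto
    then show ?case by (rule divide_right_mono) simp
  qed
qed (rule Folner_filter_neq_bot[OF amen])

text \<open>With \<open>q\<close> sending a point to its coset this is a cover by cosets. Encoding a
  partition by a map makes its joins the fibres of the tuple of maps \<open>q\<close> after
  \<open>g s\<close>.\<close>

definition fibres :: "('c \<Rightarrow> 'd) \<Rightarrow> 'c set set" where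
  "fibres q = (\<lambda>a. {x \<in> topspace X. q x = a}) ` q ` topspace X"

text \<open>The join is a partition by itineraries, up to the empty set, so its cover number counts
  itineraries. The parametrization \<open>p\<close> lets them be counted upstairs when the space is
  a quotient.\<close>

lemma cover_number_joined_fibres:
  assumes \<U>: "open_cover X (fibres q)" and F: "finite F" "F \<noteq> {}" and p: "p ` Q = topspace X"
  shows "cover_number X (joined (fibres q) F) = card ((\<lambda>x. restrict (\<lambda>s. q (g s (p x))) F) ` Q)"
proof -
  define \<Phi> where "\<Phi> x = restrict (\<lambda>s. q (g s x)) F" for x
  define \<P> where "\<P> = (\<lambda>a. {x \<in> topspace X. \<Phi> x = a}) ` \<Phi> ` topspace X"
  have eq: "\<Phi> x = \<Phi> y \<longleftrightarrow> (\<forall>s\<in>F. q (g s x) = q (g s y))" for x y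
    by (auto simp: \<Phi>_def fun_eq_iff)
  have \<P>: "\<P> \<subseteq> joined (fibres q) F"
  proof
    fix P assume "P \<in> \<P>"
    then obtain y where y: "y \<in> topspace X" "P = {x \<in> topspace X. \<Phi> x = \<Phi> y}" by (auto simp: \<P>_def)
    have "{x \<in> topspace X. \<forall>s\<in>F. g s x \<in> {x \<in> topspace X. q x = q (g s y)}} \<in> joined (fibres q) F"
      using F(2) y(1) by (intro joinedI) (auto simp: fibres_def maps_into)
    also have "{x \<in> topspace X. \<forall>s\<in>F. g s x \<in> {x \<in> topspace X. q x = q (g s y)}} = P"
      using maps_into by (auto simp: y(2) eq)
    finally show "P \<in> joined (fibres q) F" .
  qed
  have rest: "joined (fibres q) F \<subseteq> insert {} \<P>"
  proof
    fix A assume "A \<in> joined (fibres q) F"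
    then obtain V where V: "A = {x \<in> topspace X. \<forall>s\<in>F. g s x \<in> V s}" "\<And>s. s \<in> F \<Longrightarrow> V s \<in> fibres q"
      using F(2) by (rule joinedE) blast
    show "A \<in> insert {} \<P>"
    proof (cases "A = {}")
      case False
      then obtain y where y: "y \<in> A" by blast
      have "g s x \<in> V s \<longleftrightarrow> q (g s x) = q (g s y)" if "s \<in> F" "x \<in> topspace X" for s x
      proof -
        have "g s y \<in> V s" using y that V(1) by simp
        with V(2)[OF that(1)] show ?thesis using maps_into[OF that(2)] by (auto simp: fibres_def)
      qed
      then have "A = {x \<in> topspace X. \<Phi> x = \<Phi> y}" by (auto simp: V(1) eq)
      moreover have "y \<in> topspace X" using y V(1) by simp
      ultimately show ?thesis by (auto simp: \<P>_def)
    qed simp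
  qed
  have UP: "\<Union>\<P> = topspace X" by (auto simp: \<P>_def)
  have disj: "disjoint \<P>" by (auto simp: \<P>_def disjoint_def)
  have ne: "{} \<notin> \<P>" by (auto simp: \<P>_def)
  \<comment> \<open>By compactness: a finite subcover of the join must contain every block.\<close>
  have "finite \<P>"
  proof -
    obtain \<V> where \<V>: "\<V> \<subseteq> joined (fibres q) F" "finite \<V>" "\<Union>\<V> = topspace X"
      using cover_number_attained[OF compact open_cover_joined[OF \<U> F]] .
    have "P \<in> \<V>" if P: "P \<in> \<P>" for P
    proof -
      obtain x where x: "x \<in> P" using P ne by (metis all_not_in_conv)
      then obtain A where A: "A \<in> \<V>" "x \<in> A" using P UP \<V>(3) by blast
      then have "A \<in> \<P>" using \<V>(1) rest by blast
      then have "A = P" using A x P disj unfolding disjoint_def by blast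
      with A show ?thesis by simp
    qed
    then show ?thesis using \<V>(2) by (meson finite_subset subsetI)
  qed
  then have "cover_number X (joined (fibres q) F) = card \<P>"
    by (intro cover_number_partition \<P> UP disj ne rest)
  also have "\<dots> = card (\<Phi> ` topspace X)"
    unfolding \<P>_def by (intro card_image) (auto simp: inj_on_def)
  also have "\<Phi> ` topspace X = (\<lambda>x. restrict (\<lambda>s. q (g s (p x))) F) ` Q"
    unfolding p[symmetric] image_image \<Phi>_def ..
  finally show ?thesis .
qed

end


section \<open>Open subgroups of totally disconnected compact groups\<close>

context compact_abelian_group
begin

definition open_subgroup :: "'a set \<Rightarrow> bool" where
  "open_subgroup U \<longleftrightarrow> subgroup U G \<and> openin T U"

lemma continuous_map_translate:
  assumes "a \<in> carrier G"
  shows "continuous_map T T (\<lambda>x. x \<otimes> a)"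
proof -
  have "continuous_map T (prod_topology T T) (\<lambda>x. (x, a))"
    using assms by (intro continuous_map_pairedI) (auto simp: topspace_carrier)
  then have "continuous_map T T ((\<lambda>(x, y). x \<otimes> y) \<circ> (\<lambda>x. (x, a)))"
    using continuous_mult by (rule continuous_map_compose)
  then show ?thesis by (simp add: o_def)
qed

lemma openin_r_coset:
  assumes U: "openin T U" and a: "a \<in> carrier G"
  shows "openin T (U #> a)"
proof -
  have UG: "U \<subseteq> carrier G" using openin_subset[OF U] by (simp add: topspace_carrier)
  have "openin T {x \<in> topspace T. x \<otimes> inv a \<in> U}"
    using continuous_map_translate[of "inv a"] a U by (auto simp: continuous_map_def)
  also have "{x \<in> topspace T. x \<otimes> inv a \<in> U} = U #> a"
  proof (intro equalityI subsetI)
    fix x assume "x \<in> {x \<in> topspace T. x \<otimes> inv a \<in> U}"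
    then have x: "x \<in> carrier G" "x \<otimes> inv a \<in> U" by (auto simp: topspace_carrier)
    then have "x = (x \<otimes> inv a) \<otimes> a" using a by (simp add: m_assoc)
    with x show "x \<in> U #> a" by (auto simp: r_coset_def)
  next
    fix x assume "x \<in> U #> a"
    then obtain u where u: "u \<in> U" "x = u \<otimes> a" by (auto simp: r_coset_def)
    moreover have "u \<in> carrier G" using u UG by blast
    ultimately show "x \<in> {x \<in> topspace T. x \<otimes> inv a \<in> U}"
      using a by (simp add: topspace_carrier m_assoc)
  qed
  finally show ?thesis .
qed

text \<open>In a compact Hausdorff space, closed sets that no connected set joins can be separated
  by a clopen set. A connected set through \<open>\<one>\<close> is a single point here, so it
  misses the complement of \<open>W\<close>.\<close>

lemma clopen_neighbourhood_one:
  assumes td: "totally_disconnected_space T" and W: "openin T W" "\<one> \<in> W"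
  obtains C where "openin T C" "closedin T C" "\<one> \<in> C" "C \<subseteq> W"
proof -
  have "separated_between T {\<one>} (topspace T - W)"
  proof (rule cut_wire_fence_theorem[OF compact hausdorff])
    show "closedin T {\<one>}"
      using hausdorff by (intro closedin_Hausdorff_singleton) (auto simp: topspace_carrier)
    show "closedin T (topspace T - W)" using W by blast
    fix C assume C: "connectedin T C"
    show "disjnt C {\<one>} \<or> disjnt C (topspace T - W)"
    proof (cases "\<one> \<in> C")
      case True
      then have "C \<subseteq> connected_component_of_set T \<one>"
        using C by (rule connected_component_of_maximal[rotated])
      also have "\<dots> = {\<one>}" using td by (simp add: totally_disconnected_space_def topspace_carrier)
      finally show ?thesis using W by (auto simp: disjnt_def)
    qed (auto simp: disjnt_def)
  qed
  then obtain C where "closedin T C" "openin T C" "\<one> \<in> C" "topspace T - W \<subseteq> topspace T - C"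
    by (auto simp: separated_between)
  moreover have "C \<subseteq> W" using calculation openin_subset[of T C] by blast
  ultimately show ?thesis using that by blast
qed

text \<open>The stabilizer of a compact open set under translation is an open subgroup.\<close>

lemma open_subgroup_neighbourhood_one:
  assumes td: "totally_disconnected_space T" and W: "openin T W" "\<one> \<in> W"
  obtains U where "open_subgroup U" "U \<subseteq> W"
proof -
  obtain C where C: "openin T C" "closedin T C" "\<one> \<in> C" "C \<subseteq> W"
    using clopen_neighbourhood_one[OF td W] .
  have CG: "C \<subseteq> carrier G" using openin_subset[OF C(1)] by (simp add: topspace_carrier)
  \<comment> \<open>The x with C x inside C form only a submonoid; requiring the same of the inverse
    makes it a group. It lies in \<open>C\<close> because \<open>\<one>\<close> does.\<close>
  define S where "S = {x \<in> carrier G. \<forall>c\<in>C. c \<otimes> x \<in> C}"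
  define U where "U = {x \<in> S. inv x \<in> S}"
  have "openin T S"
  \<comment> \<open>Compactness of \<open>C\<close> enters through the tube lemma, applied to the
    preimage of \<open>C\<close> under multiplication, which contains C \<times> {x}.\<close>
  proof (subst openin_subopen, intro ballI)
    fix x assume x: "x \<in> S"
    define V where "V = {p \<in> topspace (prod_topology T T). (case p of (c, y) \<Rightarrow> c \<otimes> y) \<in> C}"
    have "openin (prod_topology T T) V"
      using continuous_mult C(1) unfolding V_def by (rule openin_continuous_map_preimage)
    moreover have "compactin T C" using C(2) compact by (rule closedin_compact_space[rotated])
    moreover have "C \<times> {x} \<subseteq> V"
      using x CG by (auto simp: V_def S_def topspace_carrier)
    ultimately obtain A B where AB: "openin T A" "openin T B" "C \<subseteq> A" "x \<in> B" "A \<times> B \<subseteq> V"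
      using tube_lemma_left[of T T V C x] x by (auto simp: S_def topspace_carrier)
    have "B \<subseteq> S"
    proof
      fix y assume y: "y \<in> B"
      have "c \<otimes> y \<in> C" if "c \<in> C" for c
      proof -
        have "(c, y) \<in> V" using AB y that by blast
        then show ?thesis by (simp add: V_def)
      qed
      moreover have "y \<in> carrier G" using y openin_subset[OF AB(2)] by (auto simp: topspace_carrier)
      ultimately show "y \<in> S" by (simp add: S_def)
    qed
    with AB show "\<exists>B. openin T B \<and> x \<in> B \<and> B \<subseteq> S" by blast
  qed
  then have "openin T {x \<in> topspace T. inv x \<in> S}"
    using continuous_inv by (rule openin_continuous_map_preimage[rotated])
  with \<open>openin T S\<close> have "openin T (S \<inter> {x \<in> topspace T. inv x \<in> S})" by blast
  also have "S \<inter> {x \<in> topspace T. inv x \<in> S} = U" by (auto simp: U_def S_def topspace_carrier)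
  finally have "openin T U" .
  have mult: "x \<otimes> y \<in> S" if "x \<in> S" "y \<in> S" for x y
  proof -
    have "c \<otimes> (x \<otimes> y) = (c \<otimes> x) \<otimes> y" if "c \<in> C" for c
      using that \<open>x \<in> S\<close> \<open>y \<in> S\<close> CG by (auto simp: S_def m_assoc)
    then show ?thesis using that by (auto simp: S_def)
  qed
  have "c \<otimes> \<one> = c" if "c \<in> C" for c using that CG by auto
  then have "\<one> \<in> S" by (simp add: S_def)
  have "subgroup U G"
  proof
    show "U \<subseteq> carrier G" by (auto simp: U_def S_def)
    show "x \<otimes> y \<in> U" if "x \<in> U" "y \<in> U" for x y
    proof -
      have xy: "x \<in> carrier G" "y \<in> carrier G" using that by (auto simp: U_def S_def)
      then have "inv (x \<otimes> y) = inv x \<otimes> inv y" by (rule inv_mult)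
      with that mult show ?thesis by (simp add: U_def)
    qed
    show "\<one> \<in> U" using \<open>\<one> \<in> S\<close> by (simp add: U_def)
    show "inv x \<in> U" if "x \<in> U" for x using that by (auto simp: U_def S_def)
  qed
  moreover have "U \<subseteq> C"
  proof
    fix x assume "x \<in> U"
    then have "\<one> \<otimes> x \<in> C" "x \<in> carrier G" using C(3) by (auto simp: U_def S_def)
    then show "x \<in> C" by simp
  qed
  ultimately show ?thesis using that[of U] \<open>openin T U\<close> C(4) by (auto simp: open_subgroup_def)
qed

lemma open_subgroup_Int:
  "open_subgroup U \<Longrightarrow> open_subgroup V \<Longrightarrow> open_subgroup (U \<inter> V)"
  by (auto simp: open_subgroup_def intro: subgroups_Inter_pair)

lemma open_subgroup_carrier: "open_subgroup (carrier G)"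
  unfolding open_subgroup_def using subgroup_self by (metis openin_topspace topspace_carrier)

text \<open>A Lebesgue number argument. Finitely many cosets \<open>\<upsilon> x #> x\<close> inside
  members of the cover exhaust the group. If y lies in one of them, that coset is
  \<open>\<upsilon> x #> y\<close>, so the intersection of the finitely many
  \<open>\<upsilon> x\<close> works at every point.\<close>

lemma open_subgroup_refines_cover:
  assumes td: "totally_disconnected_space T" and \<W>: "open_cover T \<W>"
  obtains U where "open_subgroup U" "\<And>x. x \<in> carrier G \<Longrightarrow> \<exists>W\<in>\<W>. U #> x \<subseteq> W"
proof -
  have "\<exists>U. open_subgroup U \<and> (\<exists>W\<in>\<W>. U #> x \<subseteq> W)" if x: "x \<in> carrier G" for x
  proof -
    obtain W where W: "W \<in> \<W>" "x \<in> W" using \<W> x by (auto simp: open_cover_def topspace_carrier)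
    then have oW: "openin T W" using \<W> by (auto simp: open_cover_def)
    have WG: "W \<subseteq> carrier G" using openin_subset[OF oW] by (simp add: topspace_carrier)
    have "\<one> \<in> W #> inv x" using W x WG by (auto simp: r_coset_def intro!: bexI[of _ x])
    then obtain U where U: "open_subgroup U" "U \<subseteq> W #> inv x"
      using open_subgroup_neighbourhood_one[OF td openin_r_coset[OF oW]] x by (metis inv_closed)
    have "U #> x \<subseteq> (W #> inv x) #> x" using U(2) by (auto simp: r_coset_def)
    also have "\<dots> = W" using WG x by (simp add: coset_mult_assoc)
    finally show ?thesis using U(1) W(1) by blast
  qed
  then obtain \<upsilon> where \<upsilon>: "\<And>x. x \<in> carrier G \<Longrightarrow> open_subgroup (\<upsilon> x) \<and> (\<exists>W\<in>\<W>. \<upsilon> x #> x \<subseteq> W)"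
    by metis
  have cover: "x \<in> \<upsilon> x #> x" if "x \<in> carrier G" for x
    using \<upsilon>[OF that] that by (auto simp: open_subgroup_def intro: rcos_self)
  have op: "openin T (\<upsilon> x #> x)" if "x \<in> carrier G" for x
    using \<upsilon>[OF that] that by (auto simp: open_subgroup_def intro: openin_r_coset)
  have "\<exists>D. finite D \<and> D \<subseteq> carrier G \<and> carrier G \<subseteq> (\<Union>x\<in>D. \<upsilon> x #> x)"
  proof -
    have "compactin T (carrier G)" using compact by (simp add: compact_space_def topspace_carrier)
    moreover have "carrier G \<subseteq> \<Union>((\<lambda>x. \<upsilon> x #> x) ` carrier G)" using cover by blast
    ultimately have "\<exists>\<F>. finite \<F> \<and> \<F> \<subseteq> (\<lambda>x. \<upsilon> x #> x) ` carrier G \<and> carrier G \<subseteq> \<Union>\<F>"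
      using op by (intro compactinD) auto
    then obtain \<F> where \<F>: "finite \<F>" "\<F> \<subseteq> (\<lambda>x. \<upsilon> x #> x) ` carrier G" "carrier G \<subseteq> \<Union>\<F>"
      by (elim exE conjE)
    obtain D where "D \<subseteq> carrier G" "finite D" "\<F> = (\<lambda>x. \<upsilon> x #> x) ` D"
      using finite_subset_image[OF \<F>(1,2)] by (elim exE conjE)
    with \<F>(3) show ?thesis by (intro exI[of _ D]) simp
  qed
  then obtain D where D: "finite D" "D \<subseteq> carrier G" "carrier G \<subseteq> (\<Union>x\<in>D. \<upsilon> x #> x)" by blast
  define U where "U = carrier G \<inter> (\<Inter>x\<in>D. \<upsilon> x)"
  have "open_subgroup (carrier G \<inter> (\<Inter>x\<in>D. \<upsilon> x))"
    using D(1,2)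
  proof (induction D rule: finite_induct)
    case empty
    then show ?case using open_subgroup_carrier by simp
  next
    case (insert x D)
    then have "open_subgroup (\<upsilon> x \<inter> (carrier G \<inter> (\<Inter>x\<in>D. \<upsilon> x)))"
      using \<upsilon> by (intro open_subgroup_Int[of "\<upsilon> x"]) auto
    then show ?case by (simp add: Int_ac)
  qed
  then have U: "open_subgroup U" by (simp add: U_def)
  have "\<exists>W\<in>\<W>. U #> y \<subseteq> W" if y: "y \<in> carrier G" for y
  proof -
    obtain x where x: "x \<in> D" "y \<in> \<upsilon> x #> x" using D y by blast
    then have xG: "x \<in> carrier G" using D by blast
    have "U \<subseteq> \<upsilon> x" using x by (auto simp: U_def)
    then have "U #> y \<subseteq> \<upsilon> x #> y" by (auto simp: r_coset_def)
    also have "\<dots> = \<upsilon> x #> x"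
      using repr_independence[OF x(2) xG] \<upsilon>[OF xG] by (simp add: open_subgroup_def)
    finally show ?thesis using \<upsilon>[OF xG] by blast
  qed
  with U show ?thesis using that by blast
qed

end


section \<open>Indices of preimages along orbits\<close>

text \<open>Both images are in bijection with the classes of the common kernel, so the equality
  holds for infinite images too, where \<open>card\<close> is 0.\<close>

lemma card_image_eq_of_same_kernel:
  assumes "\<And>x y. x \<in> Q \<Longrightarrow> y \<in> Q \<Longrightarrow> f x = f y \<longleftrightarrow> h x = h y"
  shows "card (f ` Q) = card (h ` Q)"
proof -
  define k where "k a = h (inv_into Q f a)" for a
  have k: "k (f x) = h x" if "x \<in> Q" for x
    using that assms[OF inv_into_into[of "f x" f Q] that] f_inv_into_f[of "f x" f Q]
    by (simp add: k_def)
  have "inj_on k (f ` Q)" using k assms by (auto simp: inj_on_def)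
  then have "card (k ` f ` Q) = card (f ` Q)" by (rule card_image)
  moreover have "k ` f ` Q = h ` Q" using k by (force simp: image_image)
  ultimately show ?thesis by simp
qed

context group
begin

lemma r_coset_eq_iff:
  assumes V: "subgroup V G" and x: "x \<in> carrier G" and y: "y \<in> carrier G"
  shows "V #> x = V #> y \<longleftrightarrow> x \<otimes> inv y \<in> V"
proof
  assume "V #> x = V #> y"
  then have "x \<in> V #> y" using rcos_self[OF x V] by simp
  then obtain v where v: "v \<in> V" "x = v \<otimes> y" by (auto simp: r_coset_def)
  then have "x \<otimes> inv y = v" using y subgroup.mem_carrier[OF V] by (simp add: m_assoc)
  with v show "x \<otimes> inv y \<in> V" by simp
next
  assume v: "x \<otimes> inv y \<in> V"
  have "x = (x \<otimes> inv y) \<otimes> y" using x y by (simp add: m_assoc)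
  with v have "x \<in> V #> y" by (auto simp: r_coset_def)
  then show "V #> x = V #> y" using repr_independence[OF _ y V] by simp
qed

text \<open>For subgroups this is the index [Q : Q \<inter> V]; \<open>V\<close> need not lie in
  \<open>Q\<close>. An infinite index is recorded as 0.\<close>

definition coset_index :: "'a set \<Rightarrow> 'a set \<Rightarrow> nat" where
  "coset_index Q V = card ((\<lambda>x. V #> x) ` Q)"

lemma coset_index_mono:
  assumes "finite ((\<lambda>x. V #> x) ` R)" "Q \<subseteq> R"
  shows "coset_index Q V \<le> coset_index R V"
  unfolding coset_index_def using assms by (intro card_mono) auto

lemma coset_index_antimono:
  assumes fin: "finite ((\<lambda>x. V #> x) ` Q)" and VW: "V \<subseteq> W"
    and sub: "subgroup V G" "subgroup W G" and Q: "Q \<subseteq> carrier G"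
  shows "coset_index Q W \<le> coset_index Q V"
proof -
  have eq: "(\<lambda>x. W #> x) ` Q = (\<lambda>A. W #> (SOME x. x \<in> Q \<and> V #> x = A)) ` (\<lambda>x. V #> x) ` Q"
    unfolding image_image
  proof (rule image_cong[OF refl])
    fix x assume x: "x \<in> Q"
    define y where "y = (SOME y. y \<in> Q \<and> V #> y = V #> x)"
    have y: "y \<in> Q \<and> V #> y = V #> x" unfolding y_def by (rule someI[of _ x]) (use x in auto)
    then have G: "x \<in> carrier G" "y \<in> carrier G" using x Q by auto
    then have "x \<otimes> inv y \<in> W" using r_coset_eq_iff[OF sub(1) G] y VW by auto
    then show "W #> x = W #> y" using r_coset_eq_iff[OF sub(2) G] by simp
  qed
  show ?thesis unfolding coset_index_def eq by (rule card_image_le[OF fin])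
qed

text \<open>Multiplicativity of the index along the chain of Q, Q \<inter> V and Q \<inter> V
  \<inter> W.\<close>

lemma coset_index_Int:
  assumes sub: "subgroup Q G" "subgroup V G" "subgroup W G"
  shows "coset_index Q (V \<inter> W) = coset_index Q V * coset_index (Q \<inter> V) W"
proof -
  have QG: "x \<in> carrier G" if "x \<in> Q" for x using that sub(1) by (rule subgroup.mem_carrier[rotated])
  define r where "r A = (SOME y. y \<in> Q \<and> V #> y = A)" for A
  have r: "r (V #> x) \<in> Q \<and> V #> r (V #> x) = V #> x" if "x \<in> Q" for x
    unfolding r_def by (rule someI[of _ x]) (use that in simp)
  \<comment> \<open>Relative to the chosen representative of its \<open>V\<close>-coset, x has a
    component in Q \<inter> V; the second coordinate is the \<open>W\<close>-coset of that
    component.\<close>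
  define \<phi> where "\<phi> x = (V #> x, W #> (x \<otimes> inv (r (V #> x))))" for x
  have "(V \<inter> W) #> x = (V \<inter> W) #> y \<longleftrightarrow> \<phi> x = \<phi> y" if xy: "x \<in> Q" "y \<in> Q" for x y
  proof -
    have VW: "(V \<inter> W) #> x = (V \<inter> W) #> y \<longleftrightarrow> x \<otimes> inv y \<in> V \<and> x \<otimes> inv y \<in> W"
      using r_coset_eq_iff[OF subgroups_Inter_pair[OF sub(2,3)]] xy QG by simp
    have V: "V #> x = V #> y \<longleftrightarrow> x \<otimes> inv y \<in> V" using r_coset_eq_iff[OF sub(2)] xy QG by simp
    have W: "W #> (x \<otimes> inv a) = W #> (y \<otimes> inv a) \<longleftrightarrow> x \<otimes> inv y \<in> W" if "a \<in> Q" for a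
    proof -
      have "(x \<otimes> inv a) \<otimes> inv (y \<otimes> inv a) = x \<otimes> inv y"
        using xy that QG by (simp add: inv_mult_group m_assoc) (simp flip: m_assoc)
      then show ?thesis using r_coset_eq_iff[OF sub(3)] xy that QG by simp
    qed
    show ?thesis
      unfolding VW \<phi>_def using V W[of "r (V #> y)"] r[of y] xy by auto
  qed
  then have "coset_index Q (V \<inter> W) = card (\<phi> ` Q)"
    unfolding coset_index_def by (rule card_image_eq_of_same_kernel)
  also have "\<phi> ` Q = ((\<lambda>x. V #> x) ` Q) \<times> ((\<lambda>x. W #> x) ` (Q \<inter> V))"
  proof (intro equalityI subsetI)
    fix p assume "p \<in> \<phi> ` Q"
    then obtain x where x: "x \<in> Q" "p = \<phi> x" by blast
    have "x \<otimes> inv (r (V #> x)) \<in> Q"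
      using x r[of x] sub(1) by (auto intro: subgroup.m_closed subgroup.m_inv_closed)
    moreover have "x \<otimes> inv (r (V #> x)) \<in> V"
      using r_coset_eq_iff[OF sub(2), of x "r (V #> x)"] r[of x] x QG by auto
    ultimately show "p \<in> ((\<lambda>x. V #> x) ` Q) \<times> ((\<lambda>x. W #> x) ` (Q \<inter> V))"
      using x by (auto simp: \<phi>_def)
  next
    fix p assume "p \<in> ((\<lambda>x. V #> x) ` Q) \<times> ((\<lambda>x. W #> x) ` (Q \<inter> V))"
    then obtain x y where xy: "x \<in> Q" "y \<in> Q" "y \<in> V" "p = (V #> x, W #> y)" by blast
    define a where "a = r (V #> x)"
    have a: "a \<in> Q" "V #> a = V #> x" using r[of x] xy by (auto simp: a_def)
    define z where "z = y \<otimes> a"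
    have z: "z \<in> Q" using xy a sub(1) by (auto simp: z_def intro: subgroup.m_closed)
    have zy: "z \<otimes> inv a = y" using xy a QG by (simp add: z_def m_assoc)
    then have "V #> z = V #> a" using r_coset_eq_iff[OF sub(2), of z a] z a xy QG by simp
    then have "V #> z = V #> x" using a by simp
    then have "\<phi> z = p" using zy xy by (simp add: \<phi>_def a_def)
    with z show "p \<in> \<phi> ` Q" by blast
  qed
  also have "card \<dots> = coset_index Q V * coset_index (Q \<inter> V) W"
    by (simp add: coset_index_def card_cartesian_product)
  finally show ?thesis .
qed

end

text \<open>The second isomorphism theorem, [L W : W] = [L : L \<inter> W]: by commutativity a
  factor from \<open>W\<close> does not change the \<open>W\<close>-coset.\<close>

lemma (in comm_group) coset_index_set_mult:
  assumes W: "subgroup W G" and L: "L \<subseteq> carrier G"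
  shows "coset_index (L <#> W) W = coset_index L W"
proof -
  have eq: "W #> (l \<otimes> w) = W #> l" if "l \<in> L" "w \<in> W" for l w
  proof -
    have lw: "l \<in> carrier G" "w \<in> carrier G" using that L subgroup.mem_carrier[OF W] by auto
    then have "(l \<otimes> w) \<otimes> inv l = w" using m_comm[of l w] by (simp add: m_assoc)
    then show ?thesis using r_coset_eq_iff[OF W, of "l \<otimes> w" l] lw that by simp
  qed
  have "(\<lambda>x. W #> x) ` (L <#> W) = (\<lambda>x. W #> x) ` L"
  proof (intro equalityI subsetI)
    fix A assume "A \<in> (\<lambda>x. W #> x) ` (L <#> W)"
    then show "A \<in> (\<lambda>x. W #> x) ` L" using eq by (auto simp: set_mult_def)
  next
    fix A assume "A \<in> (\<lambda>x. W #> x) ` L"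
    then obtain l where l: "l \<in> L" "A = W #> l" by blast
    moreover have "l \<otimes> \<one> \<in> L <#> W" using l subgroup.one_closed[OF W] by (auto simp: set_mult_def)
    moreover have "l \<otimes> \<one> = l" using l L by auto
    ultimately show "A \<in> (\<lambda>x. W #> x) ` (L <#> W)" by (metis imageI)
  qed
  then show ?thesis by (simp add: coset_index_def)
qed

text \<open>Shearer's inequality with an error term. If the sets \<open>A j\<close> cover each point
  of \<open>F\<close> exactly \<open>m\<close> times, the error vanishes; otherwise each missing
  occurrence costs at most \<open>c\<close>. The points of \<open>F\<close> are added one at a
  time.\<close>

lemma strongly_subadditive_cover_bound:
  fixes f :: "'s set \<Rightarrow> real" and A :: "'j \<Rightarrow> 's set"
  assumes J: "finite J" and F: "finite F" and empty: "f {} = 0"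
    and concave: "\<And>A B x. A \<subseteq> B \<Longrightarrow> finite B \<Longrightarrow> f (insert x B) - f B \<le> f (insert x A) - f A"
    and mono: "\<And>A x. finite A \<Longrightarrow> f A \<le> f (insert x A)"
    and bound: "\<And>A x. finite A \<Longrightarrow> f (insert x A) - f A \<le> c"
    and count: "\<And>x. x \<in> F \<Longrightarrow> card {j \<in> J. x \<in> A j} \<le> m"
  shows "real m * f F \<le> (\<Sum>j\<in>J. f (A j \<inter> F)) + c * (\<Sum>x\<in>F. real m - card {j \<in> J. x \<in> A j})"
  using F count
proof (induction F rule: finite_induct)
  case empty
  then show ?case by (simp add: \<open>f {} = 0\<close>)
next
  case (insert x F)
  define d where "d = f (insert x F) - f F"
  define n where "n = card {j \<in> J. x \<in> A j}"
  \<comment> \<open>Decreasing marginal gains: x adds at least as much to the smaller set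
    \<open>A j \<inter> F\<close> as to \<open>F\<close>.\<close>
  have "f (A j \<inter> F) + (if x \<in> A j then d else 0) \<le> f (A j \<inter> insert x F)" for j
  proof (cases "x \<in> A j")
    case True
    then have "A j \<inter> insert x F = insert x (A j \<inter> F)" by auto
    then show ?thesis using True concave[of "A j \<inter> F" F x] insert.hyps by (simp add: d_def)
  qed simp
  then have "(\<Sum>j\<in>J. f (A j \<inter> F) + (if x \<in> A j then d else 0)) \<le> (\<Sum>j\<in>J. f (A j \<inter> insert x F))"
    by (intro sum_mono)
  then have 1: "(\<Sum>j\<in>J. f (A j \<inter> F)) + n * d \<le> (\<Sum>j\<in>J. f (A j \<inter> insert x F))"
    using J by (simp add: sum.distrib sum.If_cases n_def Int_def)
  have "n \<le> m" using insert.prems by (simp add: n_def)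
  moreover have "d \<le> c" using bound[of F x] insert.hyps by (simp add: d_def)
  ultimately have 2: "(real m - n) * d \<le> (real m - n) * c" by (intro mult_left_mono) auto
  have "real m * f (insert x F) = real m * f F + n * d + (real m - n) * d"
    by (simp add: d_def algebra_simps)
  also have "\<dots> \<le> (\<Sum>j\<in>J. f (A j \<inter> insert x F)) + c * (\<Sum>x\<in>insert x F. real m - card {j \<in> J. x \<in> A j})"
    using insert.IH insert.prems 1 2 insert.hyps by (simp add: n_def algebra_simps)
  finally show ?case .
qed

text \<open>Both sides count the pairs (e, s) with e s = x; by cancellation either coordinate
  determines the other.\<close>

lemma card_translates_containing:
  fixes E F :: "'s::cancel_semigroup_mult set"
  shows "card {s \<in> F. x \<in> (\<lambda>e. e * s) ` E} = card {e \<in> E. x \<in> (\<lambda>s. e * s) ` F}"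
proof -
  define P where "P = {(e, s). e \<in> E \<and> s \<in> F \<and> x = e * s}"
  have "inj_on fst P" "inj_on snd P"
    by (auto simp: inj_on_def P_def left_cancel right_cancel)
  then have "card (fst ` P) = card P" "card (snd ` P) = card P" by (simp_all add: card_image)
  moreover have "fst ` P = {e \<in> E. x \<in> (\<lambda>s. e * s) ` F}" by (force simp: P_def)
  moreover have "snd ` P = {s \<in> F. x \<in> (\<lambda>e. e * s) ` E}" by (force simp: P_def)
  ultimately show ?thesis by simp
qed

text \<open>Here the left Folner condition comes to control a covering by right translates: x is
  missed once for each e with x outside e F, and F - e F has as many elements as e F - F since |e F|
  = |F|.\<close>

lemma sum_uncovered_by_translates:
  fixes E F :: "'s::cancel_semigroup_mult set"
  assumes E: "finite E" and F: "finite F"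
  shows "(\<Sum>x\<in>F. real (card E) - card {s \<in> F. x \<in> (\<lambda>e. e * s) ` E})
    = (\<Sum>e\<in>E. real (card ((\<lambda>s. e * s) ` F - F)))"
proof -
  have "real (card E) - card {s \<in> F. x \<in> (\<lambda>e. e * s) ` E} = card {e \<in> E. x \<notin> (\<lambda>s. e * s) ` F}" for x
  proof -
    have "card ({e \<in> E. x \<in> (\<lambda>s. e * s) ` F} \<union> {e \<in> E. x \<notin> (\<lambda>s. e * s) ` F})
        = card {e \<in> E. x \<in> (\<lambda>s. e * s) ` F} + card {e \<in> E. x \<notin> (\<lambda>s. e * s) ` F}"
      using E by (intro card_Un_disjoint) auto
    moreover have "{e \<in> E. x \<in> (\<lambda>s. e * s) ` F} \<union> {e \<in> E. x \<notin> (\<lambda>s. e * s) ` F} = E" by blast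
    ultimately show ?thesis by (simp add: card_translates_containing)
  qed
  then have "(\<Sum>x\<in>F. real (card E) - card {s \<in> F. x \<in> (\<lambda>e. e * s) ` E})
      = real (\<Sum>x\<in>F. card {e \<in> E. x \<notin> (\<lambda>s. e * s) ` F})" by simp
  also have "(\<Sum>x\<in>F. card {e \<in> E. x \<notin> (\<lambda>s. e * s) ` F}) = (\<Sum>e\<in>E. card {x \<in> F. x \<notin> (\<lambda>s. e * s) ` F})"
    by (rule sum_card_filter_swap[OF F E])
  also have "\<dots> = (\<Sum>e\<in>E. card ((\<lambda>s. e * s) ` F - F))"
  proof (rule sum.cong[OF refl])
    fix e
    have "card (F - (\<lambda>s. e * s) ` F) + card (F \<inter> (\<lambda>s. e * s) ` F)
        = card ((\<lambda>s. e * s) ` F - F) + card ((\<lambda>s. e * s) ` F \<inter> F)"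
      using F card_left_translate[of e F] by (simp add: card_Diff_subset_Int Int_commute card_mono)
    moreover have "{x \<in> F. x \<notin> (\<lambda>s. e * s) ` F} = F - (\<lambda>s. e * s) ` F" by blast
    ultimately show "card {x \<in> F. x \<notin> (\<lambda>s. e * s) ` F} = card ((\<lambda>s. e * s) ` F - F)"
      by (simp add: Int_commute)
  qed
  finally show ?thesis by simp
qed

section \<open>Indices of preimages of open subgroups under finite sets\<close>

locale compact_group_action = compact_abelian_group G T
  for G :: "('a, 'b) monoid_scheme" (structure) and T :: "'a topology" +
  fixes \<gamma> :: "'s::cancel_semigroup_mult \<Rightarrow> 'a \<Rightarrow> 'a"
  assumes hom: "\<gamma> s \<in> hom G G" and continuous: "continuous_map T T (\<gamma> s)"
    and action: "x \<in> carrier G \<Longrightarrow> \<gamma> (s * t) x = \<gamma> s (\<gamma> t x)"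
begin

lemma closed: "x \<in> carrier G \<Longrightarrow> \<gamma> s x \<in> carrier G"
  using hom[of s] by (auto simp: hom_def)

lemma map_div:
  assumes "x \<in> carrier G" "y \<in> carrier G"
  shows "\<gamma> s (x \<otimes> inv y) = \<gamma> s x \<otimes> inv (\<gamma> s y)"
proof -
  interpret h: group_hom G G "\<gamma> s" by unfold_locales (rule hom)
  show ?thesis using assms by simp
qed

text \<open>The subgroup \<open>U\<^sub>F\<close> of the overview.\<close>

definition orbit_preimage :: "'a set \<Rightarrow> 's set \<Rightarrow> 'a set" where
  "orbit_preimage U F = {x \<in> carrier G. \<forall>s\<in>F. \<gamma> s x \<in> U}"

lemma open_subgroup_orbit_preimage:
  assumes U: "open_subgroup U" and "finite F"
  shows "open_subgroup (orbit_preimage U F)"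
  using \<open>finite F\<close>
proof (induction F rule: finite_induct)
  case empty
  then show ?case using open_subgroup_carrier by (simp add: orbit_preimage_def)
next
  case (insert s F)
  interpret h: group_hom G G "\<gamma> s" by unfold_locales (rule hom)
  have UG: "subgroup U G" using U by (simp add: open_subgroup_def)
  have "openin T {x \<in> topspace T. \<gamma> s x \<in> U}"
    using continuous U unfolding open_subgroup_def by (intro openin_continuous_map_preimage) auto
  moreover have "subgroup {x \<in> carrier G. \<gamma> s x \<in> U} G"
    using subgroup.one_closed[OF UG] subgroup.m_closed[OF UG] subgroup.m_inv_closed[OF UG]
    by unfold_locales auto
  ultimately have "open_subgroup {x \<in> carrier G. \<gamma> s x \<in> U}"
    by (simp add: open_subgroup_def topspace_carrier)
  then have "open_subgroup ({x \<in> carrier G. \<gamma> s x \<in> U} \<inter> orbit_preimage U F)"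
    using insert.IH by (rule open_subgroup_Int)
  also have "{x \<in> carrier G. \<gamma> s x \<in> U} \<inter> orbit_preimage U F = orbit_preimage U (insert s F)"
    by (auto simp: orbit_preimage_def)
  finally show ?case .
qed

lemma orbit_preimage_empty: "orbit_preimage U {} = carrier G"
  by (simp add: orbit_preimage_def)

lemma orbit_preimage_Un: "orbit_preimage U (A \<union> B) = orbit_preimage U A \<inter> orbit_preimage U B"
  by (auto simp: orbit_preimage_def)

lemma orbit_preimage_antimono: "A \<subseteq> B \<Longrightarrow> orbit_preimage U B \<subseteq> orbit_preimage U A"
  by (auto simp: orbit_preimage_def)

lemma orbit_preimage_mono: "U \<subseteq> V \<Longrightarrow> orbit_preimage U F \<subseteq> orbit_preimage V F"
  by (auto simp: orbit_preimage_def)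

lemma orbit_preimage_translate:
  "x \<in> carrier G \<Longrightarrow> x \<in> orbit_preimage U ((\<lambda>e. e * s) ` E) \<longleftrightarrow> \<gamma> s x \<in> orbit_preimage U E"
  by (auto simp: orbit_preimage_def action closed)

text \<open>Cosets of \<open>U\<close> are open and disjoint, so a finite subcover of the group by
  them contains all of them.\<close>

lemma finite_cosets:
  assumes U: "open_subgroup U" and Q: "Q \<subseteq> carrier G"
  shows "finite ((\<lambda>x. U #> x) ` Q)"
proof -
  have sub: "subgroup U G" using U by (simp add: open_subgroup_def)
  define \<R> where "\<R> = (\<lambda>x. U #> x) ` carrier G"
  have self: "x \<in> U #> x" if "x \<in> carrier G" for x using rcos_self[OF that sub] .
  have "compactin T (carrier G)" using compact by (simp add: compact_space_def topspace_carrier)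
  moreover have "openin T R" if "R \<in> \<R>" for R
    using that U by (auto simp: \<R>_def open_subgroup_def intro: openin_r_coset)
  moreover have "carrier G \<subseteq> \<Union>\<R>" using self by (auto simp: \<R>_def)
  ultimately have "\<exists>\<F>. finite \<F> \<and> \<F> \<subseteq> \<R> \<and> carrier G \<subseteq> \<Union>\<F>" by (rule compactinD)
  then obtain \<F> where \<F>: "finite \<F>" "\<F> \<subseteq> \<R>" "carrier G \<subseteq> \<Union>\<F>" by (elim exE conjE)
  have "\<R> \<subseteq> \<F>"
  proof
    fix R assume "R \<in> \<R>"
    then obtain x where x: "x \<in> carrier G" "R = U #> x" by (auto simp: \<R>_def)
    then obtain A where A: "A \<in> \<F>" "x \<in> A" using \<F>(3) by blast
    then obtain y where y: "y \<in> carrier G" "A = U #> y" using \<F>(2) by (auto simp: \<R>_def)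
    then have "A = R" using repr_independence[OF _ y(1) sub, of x] A(2) x(2) by simp
    with A show "R \<in> \<F>" by simp
  qed
  then have "finite \<R>" using \<F>(1) by (rule finite_subset)
  moreover have "(\<lambda>x. U #> x) ` Q \<subseteq> \<R>" using Q by (auto simp: \<R>_def)
  ultimately show ?thesis by (rule finite_subset[rotated])
qed

lemma coset_index_pos:
  assumes "open_subgroup U" "Q \<subseteq> carrier G" "Q \<noteq> {}"
  shows "1 \<le> coset_index Q U"
  using finite_cosets[OF assms(1,2)] assms(3) by (simp add: coset_index_def Suc_le_eq card_gt_0_iff)

text \<open>Translates cover numbers into indices: two points visit the same cosets of
  \<open>U\<close> along \<open>F\<close> iff x times the inverse of y lies in
  \<open>U\<^sub>F\<close>.\<close>

lemma card_coset_itineraries: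
  assumes U: "open_subgroup U" and F: "finite F" and Q: "Q \<subseteq> carrier G"
  shows "card ((\<lambda>x. restrict (\<lambda>s. U #> \<gamma> s x) F) ` Q) = coset_index Q (orbit_preimage U F)"
  unfolding coset_index_def
proof (rule card_image_eq_of_same_kernel)
  fix x y assume xy: "x \<in> Q" "y \<in> Q"
  have sub: "subgroup U G" using U by (simp add: open_subgroup_def)
  have sub': "subgroup (orbit_preimage U F) G"
    using open_subgroup_orbit_preimage[OF U F] by (simp add: open_subgroup_def)
  have G: "x \<in> carrier G" "y \<in> carrier G" using xy Q by auto
  have "restrict (\<lambda>s. U #> \<gamma> s x) F = restrict (\<lambda>s. U #> \<gamma> s y) F \<longleftrightarrow> (\<forall>s\<in>F. U #> \<gamma> s x = U #> \<gamma> s y)"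
    by (auto simp: fun_eq_iff restrict_def)
  also have "\<dots> \<longleftrightarrow> (\<forall>s\<in>F. \<gamma> s (x \<otimes> inv y) \<in> U)"
    using r_coset_eq_iff[OF sub] G by (simp add: closed map_div)
  also have "\<dots> \<longleftrightarrow> orbit_preimage U F #> x = orbit_preimage U F #> y"
    using r_coset_eq_iff[OF sub' G] G by (simp add: orbit_preimage_def)
  finally show "restrict (\<lambda>s. U #> \<gamma> s x) F = restrict (\<lambda>s. U #> \<gamma> s y) F
      \<longleftrightarrow> orbit_preimage U F #> x = orbit_preimage U F #> y" .
qed

text \<open>\<open>\<gamma> s\<close> induces an injection between the cosets, because x lies in the
  preimage subgroup for the translate E s iff \<open>\<gamma> s x\<close> lies in
  \<open>U\<^sub>E\<close>.\<close>

lemma coset_index_translate_le: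
  assumes U: "open_subgroup U" and E: "finite E" and Q: "Q \<subseteq> carrier G" and R: "R \<subseteq> carrier G"
    and maps: "\<gamma> s ` Q \<subseteq> R"
  shows "coset_index Q (orbit_preimage U ((\<lambda>e. e * s) ` E)) \<le> coset_index R (orbit_preimage U E)"
proof -
  have o: "open_subgroup (orbit_preimage U E)" "open_subgroup (orbit_preimage U ((\<lambda>e. e * s) ` E))"
    using U E by (auto intro: open_subgroup_orbit_preimage)
  then have sub: "subgroup (orbit_preimage U E) G" "subgroup (orbit_preimage U ((\<lambda>e. e * s) ` E)) G"
    by (auto simp: open_subgroup_def)
  have "coset_index Q (orbit_preimage U ((\<lambda>e. e * s) ` E)) = card ((\<lambda>x. orbit_preimage U E #> \<gamma> s x) ` Q)"
    unfolding coset_index_def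
  proof (rule card_image_eq_of_same_kernel)
    fix x y assume "x \<in> Q" "y \<in> Q"
    then have G: "x \<in> carrier G" "y \<in> carrier G" using Q by auto
    show "orbit_preimage U ((\<lambda>e. e * s) ` E) #> x = orbit_preimage U ((\<lambda>e. e * s) ` E) #> y
        \<longleftrightarrow> orbit_preimage U E #> \<gamma> s x = orbit_preimage U E #> \<gamma> s y"
      using r_coset_eq_iff[OF sub(2) G] r_coset_eq_iff[OF sub(1), of "\<gamma> s x" "\<gamma> s y"] G
      by (simp add: orbit_preimage_translate closed map_div)
  qed
  also have "\<dots> \<le> coset_index R (orbit_preimage U E)"
    unfolding coset_index_def using finite_cosets[OF o(1) R] maps by (intro card_mono) auto
  finally show ?thesis .
qed

text \<open>The gain from adding x to A is the logarithm of the number of cosets of the preimage of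
  \<open>U\<close> under \<open>\<gamma> x\<close> met by
  \<open>Q \<inter> orbit_preimage U A\<close>. It decreases in A because this subgroup shrinks, and
  is at most ln [G : U] because \<open>\<gamma> x\<close> sends these cosets injectively to cosets
  of \<open>U\<close>.\<close>

lemma coset_index_orbit_preimage_cover_bound:
  assumes U: "open_subgroup U" and Q: "subgroup Q G" and F: "finite F" and J: "finite J"
    and count: "\<And>x. x \<in> F \<Longrightarrow> card {j \<in> J. x \<in> A j} \<le> m"
  shows "real m * ln (coset_index Q (orbit_preimage U F))
    \<le> (\<Sum>j\<in>J. ln (coset_index Q (orbit_preimage U (A j \<inter> F))))
      + ln (coset_index (carrier G) U) * (\<Sum>x\<in>F. real m - card {j \<in> J. x \<in> A j})"
proof -
  have QG: "Q \<subseteq> carrier G" and Q1: "\<one> \<in> Q"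
    using Q by (auto dest: subgroup.subset subgroup.one_closed)
  define f where "f A = ln (real (coset_index Q (orbit_preimage U A)))" for A
  have o: "open_subgroup (orbit_preimage U A)" if "finite A" for A
    using that U by (intro open_subgroup_orbit_preimage)
  have sub: "subgroup (orbit_preimage U A) G" if "finite A" for A
    using o[OF that] by (simp add: open_subgroup_def)
  have one: "\<one> \<in> Q \<inter> orbit_preimage U A" if "finite A" for A
    using Q1 subgroup.one_closed[OF sub[OF that]] by simp
  have marginal: "f (insert x A) - f A = ln (coset_index (Q \<inter> orbit_preimage U A) (orbit_preimage U {x}))"
    if A: "finite A" for x A
  proof -
    have "orbit_preimage U (insert x A) = orbit_preimage U A \<inter> orbit_preimage U {x}"
      using orbit_preimage_Un[of U A "{x}"] by simp
    then have "coset_index Q (orbit_preimage U (insert x A))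
        = coset_index Q (orbit_preimage U A) * coset_index (Q \<inter> orbit_preimage U A) (orbit_preimage U {x})"
      using coset_index_Int[OF Q sub[OF A] sub[of "{x}"]] by simp
    moreover have "1 \<le> coset_index Q (orbit_preimage U A)"
      using o[OF A] QG Q1 by (intro coset_index_pos) auto
    moreover have "1 \<le> coset_index (Q \<inter> orbit_preimage U A) (orbit_preimage U {x})"
      using o[of "{x}"] QG one[OF A] by (intro coset_index_pos) auto
    ultimately show ?thesis by (simp add: f_def ln_mult)
  qed
  have pos: "1 \<le> coset_index (Q \<inter> orbit_preimage U A) (orbit_preimage U {x})" if "finite A" for x A
    using o[of "{x}"] QG one[OF that] by (intro coset_index_pos) auto
  have "real m * f F \<le> (\<Sum>j\<in>J. f (A j \<inter> F))
      + ln (coset_index (carrier G) U) * (\<Sum>x\<in>F. real m - card {j \<in> J. x \<in> A j})"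
  proof (rule strongly_subadditive_cover_bound[OF J F])
    have "(\<lambda>x. carrier G #> x) ` Q = (\<lambda>x. carrier G) ` Q"
      using QG by (intro image_cong refl coset_join2 subgroup_self) auto
    also have "\<dots> = {carrier G}" using Q1 by (intro image_constant)
    finally have "(\<lambda>x. carrier G #> x) ` Q = {carrier G}" .
    then show "f {} = 0" by (simp add: f_def orbit_preimage_empty coset_index_def)
    fix A B :: "'s set" and x
    show "f (insert x B) - f B \<le> f (insert x A) - f A" if AB: "A \<subseteq> B" "finite B"
    proof -
      have A: "finite A" using AB by (rule finite_subset)
      have "coset_index (Q \<inter> orbit_preimage U B) (orbit_preimage U {x})
          \<le> coset_index (Q \<inter> orbit_preimage U A) (orbit_preimage U {x})"
        using o[of "{x}"] QG orbit_preimage_antimono[OF AB(1), of U]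
        by (intro coset_index_mono finite_cosets) auto
      then show ?thesis
        using pos[OF AB(2), of x] unfolding marginal[OF A] marginal[OF AB(2)] by (intro ln_mono) auto
    qed
    show "f A \<le> f (insert x A)" if A: "finite A"
      using marginal[OF A, of x] pos[OF A, of x] by (smt (verit) ln_ge_zero of_nat_1 of_nat_mono)
    show "f (insert x A) - f A \<le> ln (coset_index (carrier G) U)" if A: "finite A"
    proof -
      have "coset_index (Q \<inter> orbit_preimage U A) (orbit_preimage U {x})
          = card ((\<lambda>y. restrict (\<lambda>s. U #> \<gamma> s y) {x}) ` (Q \<inter> orbit_preimage U A))"
        using U QG by (intro card_coset_itineraries[symmetric]) auto
      also have "\<dots> = card ((\<lambda>y. U #> \<gamma> x y) ` (Q \<inter> orbit_preimage U A))"
        by (rule card_image_eq_of_same_kernel) (auto simp: fun_eq_iff restrict_def)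
      also have "\<dots> \<le> coset_index (carrier G) U"
        unfolding coset_index_def using finite_cosets[OF U order_refl] closed QG
        by (intro card_mono) auto
      finally show ?thesis using pos[OF A, of x] unfolding marginal[OF A] by (intro ln_mono) auto
    qed
  qed (fact count)
  then show ?thesis by (simp add: f_def)
qed

text \<open>A union of cosets of \<open>W\<close>, hence open whatever the topology of
  \<open>L\<close>.\<close>

lemma open_subgroup_set_mult:
  assumes L: "subgroup L G" and W: "open_subgroup W"
  shows "open_subgroup (L <#> W)"
proof -
  have "subgroup (L <#> W) G" using L W by (intro mult_subgroups) (auto simp: open_subgroup_def)
  moreover have "L <#> W = (\<Union>l\<in>L. W #> l)"
  proof -
    have "l \<otimes> w = w \<otimes> l" if "l \<in> L" "w \<in> W" for l w
      using that L W subgroup.mem_carrier by (metis m_comm open_subgroup_def)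
    then show ?thesis unfolding set_mult_def r_coset_def by (intro SUP_cong refl) simp
  qed
  moreover have "openin T (\<Union>l\<in>L. W #> l)"
    using W subgroup.mem_carrier[OF L] by (intro openin_Union) (auto simp: open_subgroup_def intro: openin_r_coset)
  ultimately show ?thesis by (simp add: open_subgroup_def)
qed

lemma subset_set_mult:
  assumes "subgroup L G" "subgroup W G"
  shows "L \<subseteq> L <#> W" "W \<subseteq> L <#> W"
proof -
  have "l \<otimes> \<one> \<in> L <#> W" if "l \<in> L" for l
    using that subgroup.one_closed[OF assms(2)] by (auto simp: set_mult_def)
  then show "L \<subseteq> L <#> W" using subgroup.mem_carrier[OF assms(1)] by fastforce
  have "\<one> \<otimes> w \<in> L <#> W" if "w \<in> W" for w
    using that subgroup.one_closed[OF assms(1)] by (auto simp: set_mult_def)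
  then show "W \<subseteq> L <#> W" using subgroup.mem_carrier[OF assms(2)] by fastforce
qed

text \<open>The lower bound comes from the chain \<open>U\<^sub>F \<subseteq> L U\<^sub>F \<subseteq> G\<close>.\<close>

lemma coset_index_orbit_preimage_ge:
  assumes L: "subgroup L G" "\<And>s. \<gamma> s ` L \<subseteq> L" and U: "open_subgroup U" and V: "open_subgroup V"
    and LUV: "L <#> U \<subseteq> V" and F: "finite F"
  shows "coset_index (carrier G) (orbit_preimage V F) * coset_index L (orbit_preimage U F)
    \<le> coset_index (carrier G) (orbit_preimage U F)"
proof -
  define W where "W = orbit_preimage U F"
  have W: "open_subgroup W" "subgroup W G"
    using open_subgroup_orbit_preimage[OF U F] by (auto simp: W_def open_subgroup_def)
  have oV: "open_subgroup (orbit_preimage V F)" by (rule open_subgroup_orbit_preimage[OF V F])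
  have LW: "open_subgroup (L <#> W)" by (rule open_subgroup_set_mult[OF L(1) W(1)])
  have LG: "L \<subseteq> carrier G" by (rule subgroup.subset[OF L(1)])
  \<comment> \<open>Invariance of \<open>L\<close> enters here: \<open>\<gamma> s\<close> maps the
    factor from \<open>L\<close> into \<open>L\<close> and the factor from \<open>W\<close> into
    \<open>U\<close>.\<close>
  have "L <#> W \<subseteq> orbit_preimage V F"
  proof
    fix x assume "x \<in> L <#> W"
    then obtain l w where lw: "l \<in> L" "w \<in> W" "x = l \<otimes> w" by (auto simp: set_mult_def)
    have G: "l \<in> carrier G" "w \<in> carrier G" using lw LG by (auto simp: W_def orbit_preimage_def)
    have "\<gamma> s x \<in> V" if "s \<in> F" for s
    proof -
      have "\<gamma> s x = \<gamma> s l \<otimes> \<gamma> s w" using hom[of s] G by (simp add: lw hom_mult)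
      moreover have "\<gamma> s l \<in> L" using L(2) lw by blast
      moreover have "\<gamma> s w \<in> U" using lw that by (simp add: W_def orbit_preimage_def)
      ultimately have "\<gamma> s x \<in> L <#> U" by (auto simp: set_mult_def)
      with LUV show ?thesis by blast
    qed
    then show "x \<in> orbit_preimage V F" using G by (simp add: orbit_preimage_def lw)
  qed
  then have "coset_index (carrier G) (orbit_preimage V F) \<le> coset_index (carrier G) (L <#> W)"
    using LW oV by (intro coset_index_antimono finite_cosets) (auto simp: open_subgroup_def)
  moreover have "coset_index (carrier G) ((L <#> W) \<inter> W)
      = coset_index (carrier G) (L <#> W) * coset_index (carrier G \<inter> (L <#> W)) W"
    using LW W by (intro coset_index_Int subgroup_self) (auto simp: open_subgroup_def)
  moreover have "(L <#> W) \<inter> W = W" using subset_set_mult(2)[OF L(1) W(2)] by blast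
  moreover have "carrier G \<inter> (L <#> W) = L <#> W"
    using LW by (auto simp: open_subgroup_def dest: subgroup.subset)
  moreover have "coset_index (L <#> W) W = coset_index L W"
    by (rule coset_index_set_mult[OF W(2) LG])
  ultimately show ?thesis by (simp add: W_def)
qed

text \<open>Within \<open>Q = V\<^sub>F\<close>, where \<open>V = L U\<^sub>E\<close>, each translate \<open>E s\<close> with \<open>s \<in> F\<close> contributes at most
  \<open>[V : U\<^sub>E] = [L : L \<inter> U\<^sub>E]\<close>, and these translates cover most points of \<open>F\<close> exactly \<open>|E|\<close> times.\<close>

lemma coset_index_orbit_preimage_le:
  assumes L: "subgroup L G" and U: "open_subgroup U" and E: "finite E" and F: "finite F"
  defines "V \<equiv> L <#> orbit_preimage U E"
  shows "card E * ln (coset_index (carrier G) (orbit_preimage U F))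
    \<le> card E * ln (coset_index (carrier G) (orbit_preimage V F))
      + card F * ln (coset_index L (orbit_preimage U E))
      + ln (coset_index (carrier G) U) * (\<Sum>e\<in>E. real (card ((\<lambda>x. e * x) ` F - F)))"
proof -
  have oU: "open_subgroup (orbit_preimage U A)" if "finite A" for A
    by (rule open_subgroup_orbit_preimage[OF U that])
  have sU: "subgroup (orbit_preimage U A) G" if "finite A" for A
    using oU[OF that] by (simp add: open_subgroup_def)
  have V: "open_subgroup V" unfolding V_def by (rule open_subgroup_set_mult[OF L oU[OF E]])
  have LG: "L \<subseteq> carrier G" by (rule subgroup.subset[OF L])
  define Q where "Q = orbit_preimage V F"
  have Q: "open_subgroup Q" "subgroup Q G" 
    using open_subgroup_orbit_preimage[OF V F] by (auto simp: Q_def open_subgroup_def)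
  have QG: "Q \<subseteq> carrier G" "\<one> \<in> Q" using Q(2) by (auto dest: subgroup.subset subgroup.one_closed)
  have pos: "1 \<le> coset_index R (orbit_preimage U A)" if "finite A" "subgroup R G" for A R
    using that subgroup.subset[OF that(2)] subgroup.one_closed[OF that(2)]
    by (intro coset_index_pos oU) auto
  \<comment> \<open>\<open>U\<^sub>F\<close> need not lie in \<open>Q\<close>, since
    \<open>U\<close> need not lie in \<open>V\<close>; intersecting with \<open>Q\<close> can only
    raise the index and allows a factorization through \<open>Q\<close>.\<close>
  have "coset_index (carrier G) (orbit_preimage U F) \<le> coset_index (carrier G) (Q \<inter> orbit_preimage U F)"
    using Q oU[OF F] sU[OF F]
    by (intro coset_index_antimono finite_cosets open_subgroup_Int subgroups_Inter_pair) auto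
  also have "\<dots> = coset_index (carrier G) Q * coset_index Q (orbit_preimage U F)"
    using coset_index_Int[OF subgroup_self Q(2) sU[OF F]] QG by (simp add: Int_absorb1)
  finally have "ln (real (coset_index (carrier G) (orbit_preimage U F)))
      \<le> ln (real (coset_index (carrier G) Q * coset_index Q (orbit_preimage U F)))"
    using pos[OF F subgroup_self] by (intro ln_mono) (auto simp flip: of_nat_mult)
  also have "\<dots> = ln (coset_index (carrier G) Q) + ln (coset_index Q (orbit_preimage U F))"
  proof -
    have "carrier G \<noteq> {}" using one_closed by blast
    then have "1 \<le> coset_index (carrier G) Q" by (rule coset_index_pos[OF Q(1) order_refl])
    then show ?thesis using pos[OF F Q(2)] by (simp add: ln_mult)
  qed
  finally have 1: "card E * ln (coset_index (carrier G) (orbit_preimage U F))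
      \<le> card E * ln (coset_index (carrier G) Q) + card E * ln (coset_index Q (orbit_preimage U F))"
    by (metis (no_types) distrib_left mult_left_mono of_nat_0_le_iff)
  have count: "card {s \<in> F. x \<in> (\<lambda>e. e * s) ` E} \<le> card E" for x
    unfolding card_translates_containing using E by (intro card_mono) auto
  have 2: "card E * ln (coset_index Q (orbit_preimage U F))
      \<le> (\<Sum>s\<in>F. ln (coset_index Q (orbit_preimage U ((\<lambda>e. e * s) ` E \<inter> F))))
        + ln (coset_index (carrier G) U) * (\<Sum>x\<in>F. real (card E) - card {s \<in> F. x \<in> (\<lambda>e. e * s) ` E})"
    by (rule coset_index_orbit_preimage_cover_bound[OF U Q(2) F F count])
  have "ln (coset_index Q (orbit_preimage U ((\<lambda>e. e * s) ` E \<inter> F))) \<le> ln (coset_index L (orbit_preimage U E))"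
    if s: "s \<in> F" for s
  proof -
    have "coset_index Q (orbit_preimage U ((\<lambda>e. e * s) ` E \<inter> F))
        \<le> coset_index Q (orbit_preimage U ((\<lambda>e. e * s) ` E))"
      using E QG oU sU by (intro coset_index_antimono finite_cosets orbit_preimage_antimono) auto
    \<comment> \<open>As s lies in \<open>F\<close>, the map \<open>\<gamma> s\<close> sends
      \<open>Q\<close> into \<open>V\<close>.\<close>
    also have "\<dots> \<le> coset_index V (orbit_preimage U E)"
      using s V QG by (intro coset_index_translate_le U E)
        (auto simp: Q_def orbit_preimage_def open_subgroup_def dest: subgroup.mem_carrier)
    also have "\<dots> = coset_index L (orbit_preimage U E)"
      unfolding V_def by (rule coset_index_set_mult[OF sU[OF E] LG])
    finally show ?thesis
      using pos[OF _ Q(2), of "(\<lambda>e. e * s) ` E \<inter> F"] E by (intro ln_mono) auto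
  qed
  then have "(\<Sum>s\<in>F. ln (coset_index Q (orbit_preimage U ((\<lambda>e. e * s) ` E \<inter> F))))
      \<le> (\<Sum>s\<in>F. ln (coset_index L (orbit_preimage U E)))"
    by (rule sum_mono)
  with 1 2 show ?thesis
    by (simp add: Q_def sum_uncovered_by_translates[OF E F])
qed

end


section \<open>The addition formula\<close>

text \<open>The entropy of a cover grows under refinement, so a cofinal family of covers already
  attains the supremum.\<close>

lemma (in compact_action) top_entropy_eq_SUP:
  assumes amen: "left_amenable TYPE('s)"
    and open_cover: "\<And>i. i \<in> P \<Longrightarrow> open_cover X (\<C> i)"
    and cofinal: "\<And>\<W>. open_cover X \<W> \<Longrightarrow> \<exists>i\<in>P. \<forall>B\<in>\<C> i. \<exists>A\<in>\<W>. B \<subseteq> A"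
  shows "top_entropy X g = (SUP i\<in>P. ereal (entropy_cover X g (\<C> i)))"
  unfolding top_entropy_def
proof (rule antisym; rule SUP_least)
  fix \<W> assume "\<W> \<in> {\<U>. open_cover X \<U>}"
  then have \<W>: "open_cover X \<W>" by simp
  obtain i where i: "i \<in> P" "\<forall>B\<in>\<C> i. \<exists>A\<in>\<W>. B \<subseteq> A" using cofinal[OF \<W>] by blast
  then have "entropy_cover X g \<W> \<le> entropy_cover X g (\<C> i)"
    using \<W> by (intro entropy_cover_mono amen open_cover) auto
  then show "ereal (entropy_cover X g \<W>) \<le> (SUP i\<in>P. ereal (entropy_cover X g (\<C> i)))"
    using i(1) by (intro SUP_upper2[of i]) auto
qed (auto intro!: SUP_upper open_cover)

text \<open>The summands are moved across one at a time. For finite \<open>z\<close>, non-negativity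
  and non-emptiness keep every subtracted term finite.\<close>

lemma SUP_ereal_add_le:
  fixes f :: "'i \<Rightarrow> ereal" and h :: "'j \<Rightarrow> ereal"
  assumes le: "\<And>i j. i \<in> I \<Longrightarrow> j \<in> J \<Longrightarrow> f i + h j \<le> z"
    and f: "\<And>i. i \<in> I \<Longrightarrow> 0 \<le> f i" and h: "\<And>j. j \<in> J \<Longrightarrow> 0 \<le> h j"
    and ne: "I \<noteq> {}" "J \<noteq> {}"
  shows "(SUP i\<in>I. f i) + (SUP j\<in>J. h j) \<le> z"
proof (cases "z = \<infinity>")
  case False
  have pos: "0 \<le> (SUP i\<in>I. f i)" using ne f by (meson SUP_upper2 all_not_in_conv)
  have "h j \<noteq> \<infinity>" if j: "j \<in> J" for j
  proof -
    obtain i where "i \<in> I" using ne by blast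
    then have "h j \<le> z" using le[of i j] f[of i] j by (metis add_increasing order_refl order_trans)
    with False show ?thesis by auto
  qed
  then have h_fin: "\<bar>h j\<bar> \<noteq> \<infinity>" if "j \<in> J" for j using h[OF that] that by auto
  then have f_le: "(SUP i\<in>I. f i) \<le> z - h j" if "j \<in> J" for j
    using le that by (intro SUP_least) (simp add: ereal_le_minus)
  have f_fin: "\<bar>SUP i\<in>I. f i\<bar> \<noteq> \<infinity>"
  proof -
    obtain j where j: "j \<in> J" using ne by blast
    then have "(SUP i\<in>I. f i) + h j \<le> z" using f_le[OF j] h_fin[OF j] by (simp add: ereal_le_minus)
    then have "(SUP i\<in>I. f i) \<le> z" using h[OF j] by (metis add_increasing2 order_refl order_trans)
    with False pos show ?thesis by auto
  qed
  have "h j \<le> z - (SUP i\<in>I. f i)" if "j \<in> J" for j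
    using f_le[OF that] h_fin[OF that] f_fin by (simp add: ereal_le_minus add.commute)
  then have "(SUP j\<in>J. h j) \<le> z - (SUP i\<in>I. f i)" by (rule SUP_least)
  then show ?thesis using f_fin by (simp add: ereal_le_minus add.commute)
qed simp

context compact_group_action
begin

lemma r_coset_subset_carrier:
  "subgroup U G \<Longrightarrow> x \<in> carrier G \<Longrightarrow> U #> x \<subseteq> carrier G"
  by (rule r_coset_subset_G[OF subgroup.subset])

lemma mem_r_coset_iff:
  assumes U: "subgroup U G" and x: "x \<in> carrier G" and y: "y \<in> carrier G"
  shows "y \<in> U #> x \<longleftrightarrow> U #> y = U #> x"
  using repr_independence[OF _ x U, of y] rcos_self[OF y U] by auto

lemma coset_fibre_eq:
  assumes U: "open_subgroup U" and x: "x \<in> carrier G"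
  shows "{y \<in> carrier G. U #> y = U #> x} = U #> x"
  using mem_r_coset_iff[of U x] r_coset_subset_carrier[of U x] U x by (auto simp: open_subgroup_def)

text \<open>Serves all three actions: \<open>p\<close> is the identity on the group or on the
  invariant subgroup, or the projection to the quotient, and \<open>q\<close> reads off the coset of
  \<open>U\<close>. Each entropy becomes a limit of normalized logarithms of indices in
  \<open>G\<close>.\<close>

lemma entropy_cover_cosets_limit:
  fixes X :: "'c topology" and g :: "'s \<Rightarrow> 'c \<Rightarrow> 'c"
  assumes amen: "left_amenable TYPE('s)" and X: "compact_action X g" and U: "open_subgroup U"
    and p: "p ` Q = topspace X" and Q: "Q \<subseteq> carrier G"
    and q: "\<And>s x. x \<in> Q \<Longrightarrow> q (g s (p x)) = U #> \<gamma> s x"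
    and cover: "open_cover X (compact_action.fibres X q)"
  shows "((\<lambda>F. ln (coset_index Q (orbit_preimage U F)) / card F)
    \<longlongrightarrow> entropy_cover X g (compact_action.fibres X q)) Folner_filter"
proof -
  interpret X: compact_action X g by (rule X)
  have "\<forall>\<^sub>F F in Folner_filter. ln (cover_number X (X.joined (X.fibres q) F)) / card F
      = ln (coset_index Q (orbit_preimage U F)) / card F"
    using eventually_Folner_filter_nonempty
  proof eventually_elim
    case (elim F)
    then have "cover_number X (X.joined (X.fibres q) F)
        = card ((\<lambda>x. restrict (\<lambda>s. q (g s (p x))) F) ` Q)"
      using cover p by (intro X.cover_number_joined_fibres) auto
    also have "(\<lambda>x. restrict (\<lambda>s. q (g s (p x))) F) ` Q = (\<lambda>x. restrict (\<lambda>s. U #> \<gamma> s x) F) ` Q"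
      using q by (intro image_cong refl restrict_ext)
    also have "card \<dots> = coset_index Q (orbit_preimage U F)"
      using elim U Q by (intro card_coset_itineraries) auto
    finally show ?case by simp
  qed
  then show ?thesis by (rule Lim_transform_eventually[OF X.entropy_cover_limit[OF amen cover]])
qed

lemma compact_action_group: "compact_action T \<gamma>"
proof
  show "compact_space T" by (rule compact)
  show "topspace T \<noteq> {}" using one_closed by (auto simp: topspace_carrier)
qed (auto simp: continuous action topspace_carrier)

sublocale group: compact_action T \<gamma>
  by (rule compact_action_group)

lemma open_cover_cosets:
  assumes U: "open_subgroup U"
  shows "open_cover T (group.fibres (\<lambda>x. U #> x))"
  unfolding open_cover_def
proof (intro conjI ballI)
  fix A assume "A \<in> group.fibres (\<lambda>x. U #> x)"
  then obtain x where x: "x \<in> carrier G" "A = {y \<in> carrier G. U #> y = U #> x}"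
    by (auto simp: group.fibres_def topspace_carrier)
  then have "A = U #> x" using coset_fibre_eq[OF U] by simp
  then show "openin T A" using x U by (auto simp: open_subgroup_def intro: openin_r_coset)
qed (auto simp: group.fibres_def)

lemma cosets_refine_cover:
  assumes td: "totally_disconnected_space T" and \<W>: "open_cover T \<W>"
  obtains U where "open_subgroup U" "\<And>B. B \<in> group.fibres (\<lambda>x. U #> x) \<Longrightarrow> \<exists>A\<in>\<W>. B \<subseteq> A"
proof -
  obtain U where U: "open_subgroup U" "\<And>x. x \<in> carrier G \<Longrightarrow> \<exists>W\<in>\<W>. U #> x \<subseteq> W"
    using open_subgroup_refines_cover[OF td \<W>] by blast
  have "\<exists>A\<in>\<W>. B \<subseteq> A" if "B \<in> group.fibres (\<lambda>x. U #> x)" for B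
    using that U coset_fibre_eq[OF U(1)] by (auto simp: group.fibres_def topspace_carrier)
  then show ?thesis by (rule that[OF U(1)])
qed

end

section \<open>Coset covers of the invariant subgroup and of the quotient\<close>

locale compact_group_action_subgroup = compact_group_action G T \<gamma>
  for G :: "('a, 'b) monoid_scheme" (structure) and T :: "'a topology"
    and \<gamma> :: "'s::cancel_semigroup_mult \<Rightarrow> 'a \<Rightarrow> 'a" +
  fixes L :: "'a set"
  assumes subgroup_L: "subgroup L G" and closed_L: "closedin T L" and invariant_L: "\<gamma> s ` L \<subseteq> L"
begin

lemma L_subset: "L \<subseteq> carrier G"
  by (rule subgroup.subset[OF subgroup_L])

lemma open_subgroup_set_mult_L:
  assumes "open_subgroup U"
  shows "open_subgroup (L <#> U)" "L \<subseteq> L <#> U"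
  using open_subgroup_set_mult[OF subgroup_L assms] subset_set_mult(1)[OF subgroup_L] assms
  by (simp_all add: open_subgroup_def)

sublocale sub: compact_action "subtopology T L" "subgroup_action L \<gamma>"
proof
  have L: "topspace (subtopology T L) = L" using L_subset by (auto simp: topspace_carrier)
  show "compact_space (subtopology T L)"
    using closed_L compact by (intro compact_space_subtopology closedin_compact_space)
  show "topspace (subtopology T L) \<noteq> {}" unfolding L using subgroup.one_closed[OF subgroup_L] by blast
  show "continuous_map (subtopology T L) (subtopology T L) (subgroup_action L \<gamma> s)" for s
  proof -
    have "continuous_map (subtopology T L) (subtopology T L) (\<gamma> s)"
      using continuous[of s] invariant_L[of s]
      by (auto simp: continuous_map_in_subtopology intro: continuous_map_from_subtopology)
    then show ?thesis by (rule continuous_map_eq) (auto simp: subgroup_action_def)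
  qed
  show "subgroup_action L \<gamma> (s * t) x = subgroup_action L \<gamma> s (subgroup_action L \<gamma> t x)"
    if "x \<in> topspace (subtopology T L)" for x s t
    using that invariant_L[of t] L_subset unfolding L by (auto simp: subgroup_action_def action)
qed

lemma topspace_sub: "topspace (subtopology T L) = L"
  using L_subset by (auto simp: topspace_carrier)

lemma sub_fibre_eq:
  assumes U: "open_subgroup U" and x: "x \<in> L"
  shows "{y \<in> L. U #> y = U #> x} = (U #> x) \<inter> L"
  using coset_fibre_eq[OF U, of x] L_subset x by blast

lemma sub_open_cover_cosets:
  assumes U: "open_subgroup U"
  shows "open_cover (subtopology T L) (sub.fibres (\<lambda>x. U #> x))"
  unfolding open_cover_def
proof (intro conjI ballI)
  fix A assume "A \<in> sub.fibres (\<lambda>x. U #> x)"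
  then obtain x where x: "x \<in> L" "A = {y \<in> L. U #> y = U #> x}"
    by (auto simp: sub.fibres_def topspace_sub simp del: topspace_subtopology)
  then have "A = (U #> x) \<inter> L" using sub_fibre_eq[OF U] by simp
  moreover have "openin T (U #> x)"
    using x U L_subset by (auto simp: open_subgroup_def intro: openin_r_coset)
  ultimately show "openin (subtopology T L) A" by (auto simp: openin_subtopology)
qed (auto simp: sub.fibres_def)

text \<open>The cover is extended to the group by the open complement of \<open>L\<close>. A coset
  of \<open>U\<close> through a point of \<open>L\<close> cannot lie in that complement, so it lies
  in an extension of a member of the cover.\<close>

lemma sub_cosets_refine_cover:
  assumes td: "totally_disconnected_space T" and \<W>: "open_cover (subtopology T L) \<W>"
  obtains U where "open_subgroup U" "\<And>B. B \<in> sub.fibres (\<lambda>x. U #> x) \<Longrightarrow> \<exists>A\<in>\<W>. B \<subseteq> A"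
proof -
  define \<V> where "\<V> = insert (carrier G - L) {V. openin T V \<and> V \<inter> L \<in> \<W>}"
  have "open_cover T \<V>"
    unfolding open_cover_def
  proof (intro conjI ballI equalityI subsetI)
    show "openin T V" if "V \<in> \<V>" for V
      using that closed_L by (auto simp: \<V>_def closedin_def topspace_carrier)
    then show "x \<in> topspace T" if "x \<in> \<Union>\<V>" for x using that openin_subset by blast
    show "x \<in> \<Union>\<V>" if x: "x \<in> topspace T" for x
    proof (cases "x \<in> L")
      case True
      then obtain W where W: "W \<in> \<W>" "x \<in> W" using \<W> by (auto simp: open_cover_def topspace_sub simp del: topspace_subtopology)
      then have "openin (subtopology T L) W" using \<W> by (simp add: open_cover_def)
      then obtain V where "openin T V" "W = V \<inter> L" by (auto simp: openin_subtopology)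
      with W show ?thesis by (auto simp: \<V>_def)
    next
      case False
      with x show ?thesis by (auto simp: \<V>_def topspace_carrier)
    qed
  qed
  then obtain U where U: "open_subgroup U" "\<And>x. x \<in> carrier G \<Longrightarrow> \<exists>V\<in>\<V>. U #> x \<subseteq> V"
    using open_subgroup_refines_cover[OF td] by blast
  have "\<exists>A\<in>\<W>. B \<subseteq> A" if "B \<in> sub.fibres (\<lambda>x. U #> x)" for B
  proof -
    obtain x where x: "x \<in> L" "B = {y \<in> L. U #> y = U #> x}"
      using \<open>B \<in> sub.fibres (\<lambda>x. U #> x)\<close> by (auto simp: sub.fibres_def topspace_sub simp del: topspace_subtopology)
    then have B: "B = (U #> x) \<inter> L" using sub_fibre_eq[OF U(1)] by simp
    have xG: "x \<in> carrier G" using x L_subset by blast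
    obtain V where V: "V \<in> \<V>" "U #> x \<subseteq> V" using U(2)[OF xG] by blast
    have "x \<in> V" using V(2) rcos_self[OF xG] U(1) by (auto simp: open_subgroup_def)
    then have "V \<inter> L \<in> \<W>" using V(1) x(1) by (auto simp: \<V>_def)
    with V(2) B show ?thesis by blast
  qed
  then show ?thesis by (rule that[OF U(1)])
qed

lemma topspace_coset_topology: "topspace (coset_topology G T L) = (\<lambda>x. L #> x) ` carrier G"
  by (simp add: coset_topology_def topspace_quotient_topology topspace_carrier)

lemma quotient_map_coset: "quotient_map T (coset_topology G T L) (\<lambda>x. L #> x)"
  unfolding coset_topology_def by (rule quotient_map_quotient_topology)

lemma quotient_action_eq:
  "x \<in> carrier G \<Longrightarrow> quotient_action G L \<gamma> s (L #> x) = L #> \<gamma> s x"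
  by (rule quotient_action_coset[where \<gamma> = \<gamma>, OF subgroup_L hom invariant_L])

sublocale quot: compact_action "coset_topology G T L" "quotient_action G L \<gamma>"
proof
  show "compact_space (coset_topology G T L)"
    using image_compactin[OF _ quotient_imp_continuous_map[OF quotient_map_coset], of "topspace T"] compact
    by (simp add: compact_space_def topspace_coset_topology topspace_carrier)
  show "topspace (coset_topology G T L) \<noteq> {}" using one_closed by (auto simp: topspace_coset_topology)
  show "continuous_map (coset_topology G T L) (coset_topology G T L) (quotient_action G L \<gamma> s)" for s
  proof (rule continuous_compose_quotient_map[OF quotient_map_coset])
    have "continuous_map T (coset_topology G T L) ((\<lambda>x. L #> x) \<circ> \<gamma> s)"
      by (rule continuous_map_compose[OF continuous quotient_imp_continuous_map[OF quotient_map_coset]])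
    then show "continuous_map T (coset_topology G T L) (quotient_action G L \<gamma> s \<circ> (\<lambda>x. L #> x))"
      by (rule continuous_map_eq) (simp add: quotient_action_eq topspace_carrier)
  qed
  show "quotient_action G L \<gamma> (s * t) C = quotient_action G L \<gamma> s (quotient_action G L \<gamma> t C)"
    if "C \<in> topspace (coset_topology G T L)" for C s t
    using that by (auto simp: topspace_coset_topology quotient_action_eq action closed)
qed

text \<open>Makes \<open>C \<mapsto> V <#> C\<close> the canonical map from cosets of
  \<open>L\<close> to cosets of \<open>V\<close>, whose fibres are the cosets of V / L in the
  quotient.\<close>

lemma set_mult_coset:
  assumes V: "subgroup V G" "L \<subseteq> V" and x: "x \<in> carrier G"
  shows "V <#> (L #> x) = V #> x"
proof (intro equalityI subsetI)
  fix y assume "y \<in> V <#> (L #> x)"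
  then obtain v l where vl: "v \<in> V" "l \<in> L" "y = v \<otimes> (l \<otimes> x)"
    by (auto simp: set_mult_def r_coset_def)
  then have "y = (v \<otimes> l) \<otimes> x"
    using x subgroup.mem_carrier[OF V(1)] L_subset by (auto simp: m_assoc)
  moreover have "v \<otimes> l \<in> V" using vl V by (auto intro: subgroup.m_closed)
  ultimately show "y \<in> V #> x" by (auto simp: r_coset_def)
next
  fix y assume "y \<in> V #> x"
  then obtain v where v: "v \<in> V" "y = v \<otimes> x" by (auto simp: r_coset_def)
  have "x \<in> L #> x" by (rule rcos_self[OF x subgroup_L])
  with v show "y \<in> V <#> (L #> x)" by (auto simp: set_mult_def)
qed

lemma quot_fibre_preimage:
  assumes V: "open_subgroup V" "L \<subseteq> V" and x: "x \<in> carrier G"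
  shows "{y \<in> carrier G. V <#> (L #> y) = V #> x} = V #> x"
  using coset_fibre_eq[OF V(1) x] set_mult_coset[of V] V by (auto simp: open_subgroup_def)

lemma quot_open_cover_cosets:
  assumes V: "open_subgroup V" "L \<subseteq> V"
  shows "open_cover (coset_topology G T L) (quot.fibres (\<lambda>C. V <#> C))"
  unfolding open_cover_def
proof (intro conjI ballI)
  have sub: "subgroup V G" using V by (simp add: open_subgroup_def)
  fix A assume "A \<in> quot.fibres (\<lambda>C. V <#> C)"
  then obtain x where x: "x \<in> carrier G"
    and A: "A = {C \<in> topspace (coset_topology G T L). V <#> C = V #> x}"
    using set_mult_coset[OF sub V(2)] by (auto simp: quot.fibres_def topspace_coset_topology)
  have "{y \<in> topspace T. L #> y \<in> A} = {y \<in> carrier G. V <#> (L #> y) = V #> x}"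
    by (auto simp: A topspace_coset_topology topspace_carrier)
  also have "\<dots> = V #> x" by (rule quot_fibre_preimage[OF V x])
  finally have "openin T {y \<in> topspace T. L #> y \<in> A}"
    using x V by (auto simp: open_subgroup_def intro: openin_r_coset)
  moreover have "A \<subseteq> (\<lambda>x. L #> x) ` topspace T"
    by (auto simp: A topspace_coset_topology topspace_carrier)
  ultimately show "openin (coset_topology G T L) A"
    by (simp add: coset_topology_def openin_quotient_topology)
qed (auto simp: quot.fibres_def)

lemma quot_cosets_refine_cover:
  assumes td: "totally_disconnected_space T" and \<W>: "open_cover (coset_topology G T L) \<W>"
  obtains V where "open_subgroup V" "L \<subseteq> V"
    "\<And>B. B \<in> quot.fibres (\<lambda>C. V <#> C) \<Longrightarrow> \<exists>A\<in>\<W>. B \<subseteq> A"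
proof -
  define \<V> where "\<V> = (\<lambda>A. {x \<in> topspace T. L #> x \<in> A}) ` \<W>"
  have "open_cover T \<V>"
    unfolding open_cover_def
  proof (intro conjI ballI)
    fix V assume "V \<in> \<V>"
    then show "openin T V"
      using \<W> by (auto simp: \<V>_def open_cover_def coset_topology_def openin_quotient_topology)
  next
    have "\<Union>\<V> = {x \<in> topspace T. L #> x \<in> \<Union>\<W>}" by (auto simp: \<V>_def)
    also have "\<dots> = topspace T"
      using \<W> by (auto simp: open_cover_def topspace_coset_topology topspace_carrier)
    finally show "\<Union>\<V> = topspace T" .
  qed
  then obtain U where U: "open_subgroup U" "\<And>x. x \<in> carrier G \<Longrightarrow> \<exists>V\<in>\<V>. U #> x \<subseteq> V"
    using open_subgroup_refines_cover[OF td] by blast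
  have subU: "subgroup U G" using U by (simp add: open_subgroup_def)
  \<comment> \<open>Members of the pulled back cover are unions of cosets of \<open>L\<close>, so
    enlarging \<open>U\<close> to contain \<open>L\<close> keeps its cosets inside them.\<close>
  define V where "V = L <#> U"
  have V: "open_subgroup V" "L \<subseteq> V"
    unfolding V_def using open_subgroup_set_mult_L[OF U(1)] by auto
  have subV: "subgroup V G" using V by (simp add: open_subgroup_def)
  have "\<exists>A\<in>\<W>. B \<subseteq> A" if B: "B \<in> quot.fibres (\<lambda>C. V <#> C)" for B
  proof -
    obtain x where x: "x \<in> carrier G"
      and Bx: "B = {C \<in> topspace (coset_topology G T L). V <#> C = V #> x}"
      using B set_mult_coset[OF subV V(2)] by (auto simp: quot.fibres_def topspace_coset_topology)
    obtain A where A: "A \<in> \<W>" "U #> x \<subseteq> {x \<in> topspace T. L #> x \<in> A}"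
      using U(2)[OF x] by (auto simp: \<V>_def)
    have "C \<in> A" if C: "C \<in> B" for C
    proof -
      obtain y where y: "y \<in> carrier G" "C = L #> y" "V <#> (L #> y) = V #> x"
        using C by (auto simp: Bx topspace_coset_topology)
      then have "y \<in> V #> x" using quot_fibre_preimage[OF V x] by blast
      then obtain l u where lu: "l \<in> L" "u \<in> U" "y = (l \<otimes> u) \<otimes> x"
        by (auto simp: V_def set_mult_def r_coset_def)
      have G: "l \<in> carrier G" "u \<in> carrier G" using lu L_subset subgroup.mem_carrier[OF subU] by auto
      have "u \<otimes> x \<in> U #> x" using lu by (auto simp: r_coset_def)
      then have "L #> (u \<otimes> x) \<in> A" using A(2) by blast
      moreover have "y \<in> L #> (u \<otimes> x)" using lu G x by (auto simp: r_coset_def m_assoc)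
      then have "L #> (u \<otimes> x) = L #> y" using G x subgroup_L by (intro repr_independence) auto
      ultimately show ?thesis by (simp add: y)
    qed
    with A(1) show ?thesis by blast
  qed
  then show ?thesis by (rule that[OF V])
qed

theorem top_entropy_addition:
  assumes amen: "left_amenable TYPE('s)" and td: "totally_disconnected_space T"
  shows "top_entropy T \<gamma> = top_entropy (subtopology T L) (subgroup_action L \<gamma>)
    + top_entropy (coset_topology G T L) (quotient_action G L \<gamma>)"
proof -
  define a where "a U = entropy_cover T \<gamma> (group.fibres (\<lambda>x. U #> x))" for U
  define b where "b U = entropy_cover (subtopology T L) (subgroup_action L \<gamma>) (sub.fibres (\<lambda>x. U #> x))" for U
  define c where "c V = entropy_cover (coset_topology G T L) (quotient_action G L \<gamma>) (quot.fibres (\<lambda>C. V <#> C))" for V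
  define P where "P = Collect open_subgroup"
  define R where "R = {V. open_subgroup V \<and> L \<subseteq> V}"
  have nonbot: "(Folner_filter :: 's set filter) \<noteq> bot" by (rule Folner_filter_neq_bot[OF amen])
  have hK: "top_entropy T \<gamma> = (SUP U\<in>P. ereal (a U))"
    unfolding a_def
  proof (rule group.top_entropy_eq_SUP[OF amen])
    fix \<W> assume "open_cover T \<W>"
    from cosets_refine_cover[OF td this] show "\<exists>U\<in>P. \<forall>B\<in>group.fibres (\<lambda>x. U #> x). \<exists>A\<in>\<W>. B \<subseteq> A"
      unfolding P_def by (metis mem_Collect_eq)
  qed (simp add: P_def open_cover_cosets)
  have hL: "top_entropy (subtopology T L) (subgroup_action L \<gamma>) = (SUP U\<in>P. ereal (b U))"
    unfolding b_def
  proof (rule sub.top_entropy_eq_SUP[OF amen])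
    fix \<W> assume "open_cover (subtopology T L) \<W>"
    from sub_cosets_refine_cover[OF td this] show "\<exists>U\<in>P. \<forall>B\<in>sub.fibres (\<lambda>x. U #> x). \<exists>A\<in>\<W>. B \<subseteq> A"
      unfolding P_def by (metis mem_Collect_eq)
  qed (simp add: P_def sub_open_cover_cosets)
  have hQ: "top_entropy (coset_topology G T L) (quotient_action G L \<gamma>) = (SUP V\<in>R. ereal (c V))"
    unfolding c_def
  proof (rule quot.top_entropy_eq_SUP[OF amen])
    fix \<W> assume "open_cover (coset_topology G T L) \<W>"
    from quot_cosets_refine_cover[OF td this] show "\<exists>V\<in>R. \<forall>B\<in>quot.fibres (\<lambda>C. V <#> C). \<exists>A\<in>\<W>. B \<subseteq> A"
      unfolding R_def by (metis (no_types, lifting) mem_Collect_eq)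
  qed (simp add: R_def quot_open_cover_cosets)
  have a: "((\<lambda>F. ln (coset_index (carrier G) (orbit_preimage U F)) / card F) \<longlongrightarrow> a U) Folner_filter"
    if "open_subgroup U" for U
    unfolding a_def using that open_cover_cosets[OF that]
    by (intro entropy_cover_cosets_limit[where p = id] amen compact_action_group)
       (auto simp: topspace_carrier)
  have b: "((\<lambda>F. ln (coset_index L (orbit_preimage U F)) / card F) \<longlongrightarrow> b U) Folner_filter"
    if "open_subgroup U" for U
    unfolding b_def using that sub_open_cover_cosets[OF that] L_subset
    by (intro entropy_cover_cosets_limit[where p = id] amen sub.compact_action_axioms)
       (auto simp: topspace_sub subgroup_action_def simp del: topspace_subtopology)
  have c: "((\<lambda>F. ln (coset_index (carrier G) (orbit_preimage V F)) / card F) \<longlongrightarrow> c V) Folner_filter"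
    if "open_subgroup V" "L \<subseteq> V" for V
    unfolding c_def
  proof (rule entropy_cover_cosets_limit[OF amen quot.compact_action_axioms that(1)])
    show "V <#> quotient_action G L \<gamma> s (L #> x) = V #> \<gamma> s x" if "x \<in> carrier G" for s x
      using that set_mult_coset[of V] \<open>open_subgroup V\<close> \<open>L \<subseteq> V\<close>
      by (simp add: quotient_action_eq closed open_subgroup_def)
  qed (use quot_open_cover_cosets[OF that] in \<open>auto simp: topspace_coset_topology\<close>)
  have L1: "\<one> \<in> L" by (rule subgroup.one_closed[OF subgroup_L])
  have posL: "1 \<le> coset_index L (orbit_preimage U F)" if "open_subgroup U" "finite F" for U F
    using that L_subset L1 by (intro coset_index_pos open_subgroup_orbit_preimage) auto
  have posG: "1 \<le> coset_index (carrier G) (orbit_preimage U F)" if "open_subgroup U" "finite F" for U F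
    using that one_closed by (intro coset_index_pos open_subgroup_orbit_preimage) auto

  have upper: "a U \<le> c (L <#> orbit_preimage U E) + ln (coset_index L (orbit_preimage U E)) / card E"
    if U: "open_subgroup U" and E: "finite E" "E \<noteq> {}" for U E
  proof -
    define V where "V = L <#> orbit_preimage U E"
    have oU: "open_subgroup (orbit_preimage U E)" by (rule open_subgroup_orbit_preimage[OF U E(1)])
    then have V: "open_subgroup V" "L \<subseteq> V"
      unfolding V_def using open_subgroup_set_mult_L[OF oU] by auto
    define k where "k = ln (coset_index (carrier G) U)"
    \<comment> \<open>\<open>E\<close> is fixed while \<open>F\<close> varies, so this finite sum of
      Folner ratios tends to 0 and the boundary term disappears in the limit.\<close>
    define \<delta> where "\<delta> F = (\<Sum>e\<in>E. real (card ((\<lambda>x. e * x) ` F - F)) / card F)" for F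
    have "left_Folner_net (\<lambda>F. F) (Folner_filter :: 's set filter)"
      by (simp add: left_Folner_net_iff_le_Folner_filter nonbot)
    then have "(\<delta> \<longlongrightarrow> (\<Sum>e\<in>E. 0)) Folner_filter"
      unfolding \<delta>_def by (intro tendsto_sum) (simp add: left_Folner_net_def)
    then have "((\<lambda>F. ln (coset_index (carrier G) (orbit_preimage V F)) / card F
        + ln (coset_index L (orbit_preimage U E)) / card E + k / card E * \<delta> F)
        \<longlongrightarrow> c V + ln (coset_index L (orbit_preimage U E)) / card E + k / card E * 0) Folner_filter"
      by (intro tendsto_intros c V) simp
    moreover have "\<forall>\<^sub>F F in Folner_filter. ln (coset_index (carrier G) (orbit_preimage U F)) / card F
        \<le> ln (coset_index (carrier G) (orbit_preimage V F)) / card F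
          + ln (coset_index L (orbit_preimage U E)) / card E + k / card E * \<delta> F"
      using eventually_Folner_filter_nonempty
    proof eventually_elim
      case (elim F)
      have pos: "0 < real (card E)" "0 < real (card F)" using E elim by (auto simp: card_gt_0_iff)
      have \<delta>: "(\<Sum>e\<in>E. real (card ((\<lambda>x. e * x) ` F - F))) = card F * \<delta> F"
        using pos by (simp add: \<delta>_def sum_distrib_left)
      have "card E * ln (coset_index (carrier G) (orbit_preimage U F))
        \<le> card E * ln (coset_index (carrier G) (orbit_preimage V F))
          + card F * ln (coset_index L (orbit_preimage U E)) + k * (card F * \<delta> F)"
        using coset_index_orbit_preimage_le[OF subgroup_L U E(1), of F] elim
        unfolding V_def k_def \<delta> by simp
      then show ?case using pos by (simp add: field_simps)
    qed
    ultimately have "a U \<le> c V + ln (coset_index L (orbit_preimage U E)) / card E + k / card E * 0"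
      by (intro tendsto_le[OF nonbot _ a[OF U]])
    then show ?thesis by (simp add: V_def)
  qed

  have lower: "c V + b U \<le> a U" if U: "open_subgroup U" and V: "open_subgroup V" "L \<subseteq> V" and UV: "U \<subseteq> V" for U V
  proof (rule tendsto_le[OF nonbot a[OF U] tendsto_add[OF c[OF V] b[OF U]]])
    show "\<forall>\<^sub>F F in Folner_filter. ln (coset_index (carrier G) (orbit_preimage V F)) / card F
        + ln (coset_index L (orbit_preimage U F)) / card F
        \<le> ln (coset_index (carrier G) (orbit_preimage U F)) / card F"
      using eventually_Folner_filter_nonempty
    proof eventually_elim
      case (elim F)
      then have F: "finite F" by simp
      have "L <#> U \<subseteq> V"
        using V UV by (auto simp: set_mult_def open_subgroup_def intro: subgroup.m_closed)
      then have "coset_index (carrier G) (orbit_preimage V F) * coset_index L (orbit_preimage U F)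
          \<le> coset_index (carrier G) (orbit_preimage U F)"
        by (rule coset_index_orbit_preimage_ge[OF subgroup_L invariant_L U V(1) _ F])
      then have "real (coset_index (carrier G) (orbit_preimage V F)) * real (coset_index L (orbit_preimage U F))
          \<le> real (coset_index (carrier G) (orbit_preimage U F))"
        by (metis of_nat_mono of_nat_mult)
      then have "ln (real (coset_index (carrier G) (orbit_preimage V F)) * real (coset_index L (orbit_preimage U F)))
          \<le> ln (real (coset_index (carrier G) (orbit_preimage U F)))"
        using posG[OF V(1) F] posL[OF U F] by (intro ln_mono) auto
      then have "ln (real (coset_index (carrier G) (orbit_preimage V F))) + ln (real (coset_index L (orbit_preimage U F)))
          \<le> ln (real (coset_index (carrier G) (orbit_preimage U F)))"
        using posG[OF V(1) F] posL[OF U F] by (simp add: ln_mult)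
      then show ?case by (simp add: divide_right_mono flip: add_divide_distrib)
    qed
  qed

  \<comment> \<open>The lower bound needs \<open>U\<close> inside \<open>V\<close>. For independent
    \<open>U\<close> and \<open>V\<close> it is applied to U \<inter> V, and the present
    monotonicity shows that this does not lose any entropy on \<open>L\<close>.\<close>
  have b_antimono: "b V \<le> b U" if U: "open_subgroup U" and V: "open_subgroup V" and UV: "U \<subseteq> V" for U V
  proof (rule tendsto_le[OF nonbot b[OF U] b[OF V]])
    show "\<forall>\<^sub>F F in Folner_filter. ln (coset_index L (orbit_preimage V F)) / card F
        \<le> ln (coset_index L (orbit_preimage U F)) / card F"
      using eventually_Folner_filter_nonempty
    proof eventually_elim
      case (elim F)
      then have F: "finite F" by simp
      have "coset_index L (orbit_preimage V F) \<le> coset_index L (orbit_preimage U F)"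
        using open_subgroup_orbit_preimage[OF U F] open_subgroup_orbit_preimage[OF V F] UV L_subset
        by (intro coset_index_antimono finite_cosets orbit_preimage_mono) (auto simp: open_subgroup_def)
      then show ?case
        using posL[OF V F] by (intro divide_right_mono ln_mono) auto
    qed
  qed

  have b_nonneg: "0 \<le> b U" if "open_subgroup U" for U
    unfolding b_def by (rule sub.entropy_cover_nonneg[OF amen sub_open_cover_cosets[OF that]])
  have c_nonneg: "0 \<le> c V" if "open_subgroup V" "L \<subseteq> V" for V
    unfolding c_def by (rule quot.entropy_cover_nonneg[OF amen quot_open_cover_cosets[OF that]])
  have carrier: "carrier G \<in> P" "carrier G \<in> R"
    using open_subgroup_carrier L_subset by (auto simp: P_def R_def)

  have "(SUP U\<in>P. ereal (b U)) + (SUP V\<in>R. ereal (c V)) \<le> (SUP U\<in>P. ereal (a U))"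
  proof (rule SUP_ereal_add_le)
    fix U V assume UV: "U \<in> P" "V \<in> R"
    then have o: "open_subgroup U" "open_subgroup V" "L \<subseteq> V" by (auto simp: P_def R_def)
    have W: "open_subgroup (U \<inter> V)" using o by (intro open_subgroup_Int)
    have "b U + c V \<le> a (U \<inter> V)"
      using lower[OF W o(2,3)] b_antimono[OF W o(1)] by force
    then show "ereal (b U) + ereal (c V) \<le> (SUP U\<in>P. ereal (a U))"
      using W by (intro SUP_upper2[of "U \<inter> V"]) (auto simp: P_def)
  qed (use b_nonneg c_nonneg carrier in \<open>auto simp: P_def R_def\<close>)
  moreover have "(SUP U\<in>P. ereal (a U)) \<le> (SUP U\<in>P. ereal (b U)) + (SUP V\<in>R. ereal (c V))"
  proof (rule SUP_least)
    fix U assume "U \<in> P"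
    then have U: "open_subgroup U" by (simp add: P_def)
    have c0: "0 \<le> (SUP V\<in>R. ereal (c V))"
      using carrier(2) c_nonneg by (intro SUP_upper2[of "carrier G"]) (auto simp: R_def)
    show "ereal (a U) \<le> (SUP U\<in>P. ereal (b U)) + (SUP V\<in>R. ereal (c V))"
    proof (cases "SUP V\<in>R. ereal (c V)")
      case (real r)
      \<comment> \<open>The subgroup \<open>L <#> orbit_preimage U E\<close> varies with
        \<open>E\<close>, but its entropy never exceeds the supremum \<open>r\<close>. So the limit
        over \<open>E\<close> acts only on the normalized index in \<open>L\<close>, which tends to
        \<open>b U\<close>.\<close>
      have "\<forall>\<^sub>F E in Folner_filter. a U - r \<le> ln (coset_index L (orbit_preimage U E)) / card E"
        using eventually_Folner_filter_nonempty
      proof eventually_elim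
        case (elim E)
        have oU: "open_subgroup (orbit_preimage U E)" using elim U by (intro open_subgroup_orbit_preimage) auto
        then have "L <#> orbit_preimage U E \<in> R"
          unfolding R_def using open_subgroup_set_mult_L by auto
        then have "ereal (c (L <#> orbit_preimage U E)) \<le> ereal r"
          unfolding real[symmetric] by (rule SUP_upper)
        then show ?case using upper[OF U, of E] elim by simp
      qed
      then have "a U - r \<le> b U" by (rule tendsto_lowerbound[OF b[OF U] _ nonbot])
      then have "ereal (a U) \<le> ereal (b U) + ereal r" by simp
      also have "\<dots> \<le> (SUP U\<in>P. ereal (b U)) + ereal r"
        using \<open>U \<in> P\<close> by (intro add_right_mono SUP_upper)
      finally show ?thesis by (simp add: real)
    qed (use c0 in auto)
  qed
  ultimately show ?thesis unfolding hK hL hQ by (rule antisym[rotated])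
qed

end

theorem theorem7p9:
  fixes K :: "('k, 'm) monoid_scheme"
    and T :: "'k topology"
    and \<gamma> :: "'s::cancel_semigroup_mult \<Rightarrow> 'k \<Rightarrow> 'k"
    and L :: "'k set"
  assumes amenable: "left_amenable TYPE('s)"
    and K: "compact_abelian_group K T" "totally_disconnected_space T"
    and action: "left_action (carrier K) \<gamma>"
    and endo: "\<And>s. \<gamma> s \<in> hom K K" "\<And>s. continuous_map T T (\<gamma> s)"
    and L: "subgroup L K" "closedin T L" "\<And>s. \<gamma> s ` L \<subseteq> L"
  shows "top_entropy T \<gamma> =
           top_entropy (subtopology T L) (subgroup_action L \<gamma>) +
           top_entropy (coset_topology K T L) (quotient_action K L \<gamma>)"
proof -
  interpret compact_abelian_group K T by (rule K(1))
  interpret compact_group_action K T \<gamma>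
    by unfold_locales (use action endo in \<open>auto simp: left_action_def\<close>)
  interpret compact_group_action_subgroup K T \<gamma> L
    by (intro compact_group_action_subgroup.intro compact_group_action_axioms
        compact_group_action_subgroup_axioms.intro L)
  show ?thesis by (rule top_entropy_addition[OF amenable K(2)])
qed

end
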